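(* Let $T\in\mathcal{KC}(V)$ with $T,\overline{T}$ of type $\omega\in(0,\pi)$ and $\theta\in(\omega,\pi)$. Then for every $f\in\Psi^Q(S_\theta)$ and $g\in\Psi_L^Q(S_\theta)$ one has $$D(fg)(T)=Df(T)g(T)+f(\overline{T})Dg(T)=Df(T)g(\overline{T})+f(T)Dg(T).$$
   Context: $\mathbb{H}$: quaternions $s=s_0+s_1e_1+s_2e_2+s_3e_3$ with $e_1^2=e_2^2=e_3^2=-1$, $e_1e_2=-e_2e_1=e_3$, $e_2e_3=-e_3e_2=e_1$, $e_3e_1=-e_1e_3=e_2$; $|s|$ Euclidean norm; $\mathbb{S}=\{s:s_0=0,|s|=1\}$; $\mathbb{C}_J=\{u+Jv\}$. $S_\omega=\{re^{J\phi}:r>0,J\in\mathbb{S},|\phi|<\omega\}$, $\overline{S_\omega}$ its closure, $S_\omega^c=\mathbb{H}\setminus S_\omega$. $V$ is a two-sided Banach space over $\mathbb{H}$. $\mathcal{KC}(V)$: closed right-linear operators $T$ with two-sided linear domain, $T=T_0+e_1T_1+e_2T_2+e_3T_3$ with two-sided linear $T_i$, $\operatorname{dom}(T_i)=\operatorname{dom}(T)$, $\operatorname{dom}(T^2)\subseteq\operatorname{dom}(T_iT_j)$, $T_iT_j=T_jT_i$ on $\operatorname{dom}(T^2)$. $\overline{T}:=T_0-e_1T_1-e_2T_2-e_3T_3$, $|T|^2:=\sum_iT_i^2$, $Q_{c,s}(T):=s^2\mathcal{I}-2sT_0+|T|^2$ on $\operatorname{dom}(T^2)$; $\rho_S(T)$: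 the $s$ with $Q_{c,s}(T):\operatorname{dom}(T^2)\to V$ bijective, $Q_{c,s}^{-1}(T)$ the inverse; $\sigma_S(T)=\mathbb{H}\setminus\rho_S(T)$. $S_L^{-1}(s,T):=(s\mathcal{I}-\overline{T})Q_{c,s}^{-1}(T)$, $S_R^{-1}(s,T):=sQ_{c,s}^{-1}(T)-\sum_{i=0}^3T_iQ_{c,s}^{-1}(T)\overline{e_i}$ ($e_0=1$). $T$ is of type $\omega$ if $\sigma_S(T)\subseteq\overline{S_\omega}$ and for each $\theta\in(\omega,\pi)$ there is $C_\theta$ with $\|S_L^{-1}(s,T)\|,\|S_R^{-1}(s,T)\|\leq C_\theta/|s|$ on $S_\theta^c\setminus\{0\}$. Left slice hyperholomorphic functions on $S_\theta$: $f(u+Jv)=\alpha(u,v)+J\beta(u,v)$ for all $J\in\mathbb{S}$, with $C^1$ $\mathbb{H}$-valued $\alpha$ even in $v$, $\beta$ odd in $v$, $\partial_u\alpha=\partial_v\beta$, $\partial_v\alpha=-\partial_u\beta$; intrinsic if $\alpha,\beta$ are real valued. $\Psi_L^Q(S_\theta)$ (resp. $\Psi^Q(S_\theta)$): left slice hyperholomorphic (resp. intrinsic) $f$ on $S_\theta$ with $|f(s)|\leq C|s|^{1+\alpha}/(1+|s|^{1+2\alpha})$ for some $\alpha>0,C\geq0$. Path integral: with $\gamma(t)=-te^{J\varphi}$ for $t<0$, $\gamma(t)=te^{-J\varphi}$ for $t>0$, $\int_{\partial(S_\varphi\cap\mathbb{C}_J)}F(s)ds_JG(s):=\int_{\mathbb{R}\setminus\{0\}}F(\gamma(t))\gamma'(t)J^{-1}G(\gamma(t))dt$.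 $S$-functional calculus: $h(T):=\frac{1}{2\pi}\int_{\partial(S_\varphi\cap\mathbb{C}_J)}S_L^{-1}(s,T)ds_Jh(s)$ for $h$ left slice hyperholomorphic in these classes (and $h(\overline{T})$ likewise with $\overline{T}$). Harmonic functional calculus: $Dh(T):=\frac{-1}{\pi}\int_{\partial(S_\varphi\cap\mathbb{C}_J)}Q_{c,s}^{-1}(T)ds_Jh(s)$ for $h\in\Psi_L^Q(S_\theta)$. Here $\varphi\in(\omega,\theta)$, $J\in\mathbb{S}$ are arbitrary (results independent of them). *)

theory Defs
  imports "HOL-Analysis.Analysis"
begin

type_synonym quat = "real^4"

definition Quat :: "real \<Rightarrow> real \<Rightarrow> real \<Rightarrow> real \<Rightarrow> quat" where
  "Quat a b c d = (\<chi> i::4. if i = 0 then a else if i = 1 then b else if i = 2 then c else d)"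

definition qreal :: "real \<Rightarrow> quat" where
  "qreal r = Quat r 0 0 0"

text \<open>Hamilton product: e1 e2 = e3, e2 e3 = e1, e3 e1 = e2, ei^2 = -1.\<close>
definition qmul :: "quat \<Rightarrow> quat \<Rightarrow> quat" where
  "qmul p q = Quat
     (p$0*q$0 - p$1*q$1 - p$2*q$2 - p$3*q$3)
     (p$0*q$1 + p$1*q$0 + p$2*q$3 - p$3*q$2)
     (p$0*q$2 - p$1*q$3 + p$2*q$0 + p$3*q$1)
     (p$0*q$3 + p$1*q$2 - p$2*q$1 + p$3*q$0)"

definition qcnj :: "quat \<Rightarrow> quat" where
  "qcnj q = Quat (q$0) (- q$1) (- q$2) (- q$3)"

definition qinv :: "quat \<Rightarrow> quat" where
  "qinv q = (1 / (norm q)^2) *\<^sub>R qcnj q"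

definition qe :: "nat \<Rightarrow> quat" where
  "qe i = (if i = 0 then Quat 1 0 0 0 else if i = 1 then Quat 0 1 0 0
           else if i = 2 then Quat 0 0 1 0 else Quat 0 0 0 1)"

definition imag_units :: "quat set" where
  "imag_units = {J. J$0 = 0 \<and> norm J = 1}"

definition qexpJ :: "quat \<Rightarrow> real \<Rightarrow> quat" where
  "qexpJ J \<phi> = qreal (cos \<phi>) + sin \<phi> *\<^sub>R J"

definition sector :: "real \<Rightarrow> quat set" where
  "sector \<omega> = {s. \<exists>r>0. \<exists>J\<in>imag_units. \<exists>\<phi>. \<bar>\<phi>\<bar> < \<omega> \<and> s = r *\<^sub>R qexpJ J \<phi>}"

definition two_sided_banach :: "(quat \<Rightarrow> 'v::banach \<Rightarrow> 'v) \<Rightarrow> ('v \<Rightarrow> quat \<Rightarrow> 'v) \<Rightarrow> bool" where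
  "two_sided_banach lm rm \<longleftrightarrow>
     (\<forall>a b v. lm (a + b) v = lm a v + lm b v) \<and>
     (\<forall>a v w. lm a (v + w) = lm a v + lm a w) \<and>
     (\<forall>a b v. lm a (lm b v) = lm (qmul a b) v) \<and>
     (\<forall>r v. lm (qreal r) v = r *\<^sub>R v) \<and>
     (\<forall>a b v. rm v (a + b) = rm v a + rm v b) \<and>
     (\<forall>a v w. rm (v + w) a = rm v a + rm w a) \<and>
     (\<forall>a b v. rm (rm v a) b = rm v (qmul a b)) \<and>
     (\<forall>r v. rm v (qreal r) = r *\<^sub>R v) \<and>
     (\<forall>a b v. rm (lm a v) b = lm a (rm v b)) \<and>
     (\<forall>a v. norm (lm a v) \<le> norm a * norm v) \<and>
     (\<forall>a v. norm (rm v a) \<le> norm a * norm v)"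

definition two_sided_subspace :: "(quat \<Rightarrow> 'v::banach \<Rightarrow> 'v) \<Rightarrow> ('v \<Rightarrow> quat \<Rightarrow> 'v) \<Rightarrow> 'v set \<Rightarrow> bool" where
  "two_sided_subspace lm rm D \<longleftrightarrow> 0 \<in> D \<and> (\<forall>v\<in>D. \<forall>w\<in>D. v + w \<in> D) \<and>
     (\<forall>a. \<forall>v\<in>D. lm a v \<in> D \<and> rm v a \<in> D)"

definition two_sided_linear_on ::
  "(quat \<Rightarrow> 'v::banach \<Rightarrow> 'v) \<Rightarrow> ('v \<Rightarrow> quat \<Rightarrow> 'v) \<Rightarrow> 'v set \<Rightarrow> ('v \<Rightarrow> 'v) \<Rightarrow> bool" where
  "two_sided_linear_on lm rm D A \<longleftrightarrow>
     (\<forall>v\<in>D. \<forall>w\<in>D. A (v + w) = A v + A w) \<and>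
     (\<forall>a. \<forall>v\<in>D. A (lm a v) = lm a (A v) \<and> A (rm v a) = rm (A v) a)"

definition qop :: "(quat \<Rightarrow> 'v::banach \<Rightarrow> 'v) \<Rightarrow> (nat \<Rightarrow> 'v \<Rightarrow> 'v) \<Rightarrow> 'v \<Rightarrow> 'v" where
  "qop lm Tc v = (\<Sum>i<4. lm (qe i) (Tc i v))"

definition conjc :: "(nat \<Rightarrow> 'v::banach \<Rightarrow> 'v) \<Rightarrow> nat \<Rightarrow> 'v \<Rightarrow> 'v" where
  "conjc Tc i = (if i = 0 then Tc 0 else (\<lambda>v. - Tc i v))"

definition dom2 :: "(quat \<Rightarrow> 'v::banach \<Rightarrow> 'v) \<Rightarrow> 'v set \<Rightarrow> (nat \<Rightarrow> 'v \<Rightarrow> 'v) \<Rightarrow> 'v set" where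
  "dom2 lm D Tc = {v \<in> D. qop lm Tc v \<in> D}"

definition KC :: "(quat \<Rightarrow> 'v::banach \<Rightarrow> 'v) \<Rightarrow> ('v \<Rightarrow> quat \<Rightarrow> 'v) \<Rightarrow> 'v set \<Rightarrow> (nat \<Rightarrow> 'v \<Rightarrow> 'v) \<Rightarrow> bool" where
  "KC lm rm D Tc \<longleftrightarrow>
     two_sided_subspace lm rm D \<and>
     (\<forall>i<4. two_sided_linear_on lm rm D (Tc i)) \<and>
     closed {(v, qop lm Tc v) | v. v \<in> D} \<and>
     (\<forall>v\<in>dom2 lm D Tc. \<forall>j<4. Tc j v \<in> D) \<and>
     (\<forall>v\<in>dom2 lm D Tc. \<forall>i<4. \<forall>j<4. Tc i (Tc j v) = Tc j (Tc i v))"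

definition Qcs :: "(quat \<Rightarrow> 'v::banach \<Rightarrow> 'v) \<Rightarrow> (nat \<Rightarrow> 'v \<Rightarrow> 'v) \<Rightarrow> quat \<Rightarrow> 'v \<Rightarrow> 'v" where
  "Qcs lm Tc s v = lm (qmul s s) v - lm (2 *\<^sub>R s) (Tc 0 v) + (\<Sum>i<4. Tc i (Tc i v))"

definition rhoS :: "(quat \<Rightarrow> 'v::banach \<Rightarrow> 'v) \<Rightarrow> 'v set \<Rightarrow> (nat \<Rightarrow> 'v \<Rightarrow> 'v) \<Rightarrow> quat set" where
  "rhoS lm D Tc = {s. bij_betw (Qcs lm Tc s) (dom2 lm D Tc) UNIV}"

definition sigmaS :: "(quat \<Rightarrow> 'v::banach \<Rightarrow> 'v) \<Rightarrow> 'v set \<Rightarrow> (nat \<Rightarrow> 'v \<Rightarrow> 'v) \<Rightarrow> quat set" where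
  "sigmaS lm D Tc = UNIV - rhoS lm D Tc"

definition Qinv :: "(quat \<Rightarrow> 'v::banach \<Rightarrow> 'v) \<Rightarrow> 'v set \<Rightarrow> (nat \<Rightarrow> 'v \<Rightarrow> 'v) \<Rightarrow> quat \<Rightarrow> 'v \<Rightarrow> 'v" where
  "Qinv lm D Tc s = the_inv_into (dom2 lm D Tc) (Qcs lm Tc s)"

definition SLinv :: "(quat \<Rightarrow> 'v::banach \<Rightarrow> 'v) \<Rightarrow> 'v set \<Rightarrow> (nat \<Rightarrow> 'v \<Rightarrow> 'v) \<Rightarrow> quat \<Rightarrow> 'v \<Rightarrow> 'v" where
  "SLinv lm D Tc s v = lm s (Qinv lm D Tc s v) - qop lm (conjc Tc) (Qinv lm D Tc s v)"

text \<open>S_R^{-1}(s,T) = s Q^{-1} - sum_i T_i Q^{-1} conj(e_i), with the convention (A a)(v) = A(a v).\<close>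
definition SRinv :: "(quat \<Rightarrow> 'v::banach \<Rightarrow> 'v) \<Rightarrow> 'v set \<Rightarrow> (nat \<Rightarrow> 'v \<Rightarrow> 'v) \<Rightarrow> quat \<Rightarrow> 'v \<Rightarrow> 'v" where
  "SRinv lm D Tc s v = lm s (Qinv lm D Tc s v)
     - (\<Sum>i<4. Tc i (Qinv lm D Tc s (lm (qcnj (qe i)) v)))"

definition of_type :: "(quat \<Rightarrow> 'v::banach \<Rightarrow> 'v) \<Rightarrow> 'v set \<Rightarrow> (nat \<Rightarrow> 'v \<Rightarrow> 'v) \<Rightarrow> real \<Rightarrow> bool" where
  "of_type lm D Tc \<omega> \<longleftrightarrow>
     sigmaS lm D Tc \<subseteq> closure (sector \<omega>) \<and>
     (\<forall>\<theta>. \<omega> < \<theta> \<and> \<theta> < pi \<longrightarrow> (\<exists>C. \<forall>s. s \<notin> sector \<theta> \<and> s \<noteq> 0 \<longrightarrow>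
        (\<forall>v. norm (SLinv lm D Tc s v) \<le> C / norm s * norm v) \<and>
        (\<forall>v. norm (SRinv lm D Tc s v) \<le> C / norm s * norm v)))"

text \<open>Points (u,v) with u + J v in S_theta for all J (S_theta is axially symmetric).\<close>
definition slice_dom :: "real \<Rightarrow> (real \<times> real) set" where
  "slice_dom \<theta> = {(u, v). \<forall>J\<in>imag_units. qreal u + v *\<^sub>R J \<in> sector \<theta>}"

definition C1_partials :: "(real \<times> real \<Rightarrow> quat) \<Rightarrow> (real \<times> real \<Rightarrow> quat) \<Rightarrow> (real \<times> real \<Rightarrow> quat)
    \<Rightarrow> (real \<times> real) set \<Rightarrow> bool" where
  "C1_partials F Fu Fv U \<longleftrightarrow> continuous_on U Fu \<and> continuous_on U Fv \<and>
     (\<forall>p\<in>U. (F has_derivative (\<lambda>(h, k). h *\<^sub>R Fu p + k *\<^sub>R Fv p)) (at p))"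

definition slice_repr :: "real \<Rightarrow> (quat \<Rightarrow> quat) \<Rightarrow> (real \<times> real \<Rightarrow> quat) \<Rightarrow> (real \<times> real \<Rightarrow> quat) \<Rightarrow> bool" where
  "slice_repr \<theta> f \<alpha> \<beta> \<longleftrightarrow>
     (\<exists>\<alpha>u \<alpha>v \<beta>u \<beta>v.
        C1_partials \<alpha> \<alpha>u \<alpha>v (slice_dom \<theta>) \<and> C1_partials \<beta> \<beta>u \<beta>v (slice_dom \<theta>) \<and>
        (\<forall>p\<in>slice_dom \<theta>. \<alpha>u p = \<beta>v p \<and> \<alpha>v p = - \<beta>u p)) \<and>
     (\<forall>u v. (u, v) \<in> slice_dom \<theta> \<longrightarrow> \<alpha> (u, - v) = \<alpha> (u, v) \<and> \<beta> (u, - v) = - \<beta> (u, v)) \<and>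
     (\<forall>u v. (u, v) \<in> slice_dom \<theta> \<longrightarrow> (\<forall>J\<in>imag_units.
        f (qreal u + v *\<^sub>R J) = \<alpha> (u, v) + qmul J (\<beta> (u, v))))"

definition left_slice_hol :: "real \<Rightarrow> (quat \<Rightarrow> quat) \<Rightarrow> bool" where
  "left_slice_hol \<theta> f \<longleftrightarrow> (\<exists>\<alpha> \<beta>. slice_repr \<theta> f \<alpha> \<beta>)"

definition intrinsic_slice_hol :: "real \<Rightarrow> (quat \<Rightarrow> quat) \<Rightarrow> bool" where
  "intrinsic_slice_hol \<theta> f \<longleftrightarrow> (\<exists>\<alpha> \<beta>. slice_repr \<theta> f \<alpha> \<beta> \<and>
     (\<forall>p\<in>slice_dom \<theta>. \<alpha> p \<in> range qreal \<and> \<beta> p \<in> range qreal))"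

definition decay_Q :: "real \<Rightarrow> (quat \<Rightarrow> quat) \<Rightarrow> bool" where
  "decay_Q \<theta> f \<longleftrightarrow> (\<exists>a>0. \<exists>C\<ge>0. \<forall>s\<in>sector \<theta>.
      norm (f s) \<le> C * norm s powr (1 + a) / (1 + norm s powr (1 + 2 * a)))"

definition PsiLQ :: "real \<Rightarrow> (quat \<Rightarrow> quat) set" where
  "PsiLQ \<theta> = {f. left_slice_hol \<theta> f \<and> decay_Q \<theta> f}"

definition PsiQ :: "real \<Rightarrow> (quat \<Rightarrow> quat) set" where
  "PsiQ \<theta> = {f. intrinsic_slice_hol \<theta> f \<and> decay_Q \<theta> f}"

definition gam :: "real \<Rightarrow> quat \<Rightarrow> real \<Rightarrow> quat" where
  "gam \<phi> J t = (if t < 0 then (- t) *\<^sub>R qexpJ J \<phi> else t *\<^sub>R qexpJ J (- \<phi>))"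

definition gam' :: "real \<Rightarrow> quat \<Rightarrow> real \<Rightarrow> quat" where
  "gam' \<phi> J t = (if t < 0 then - qexpJ J \<phi> else qexpJ J (- \<phi>))"

text \<open>S-functional calculus h(T) = 1/(2 pi) int S_L^{-1}(s,T) ds_J h(s); scalar factors to the
  right of an operator act on its argument: (A a)(v) = A(a v).\<close>
definition SFC :: "(quat \<Rightarrow> 'v::banach \<Rightarrow> 'v) \<Rightarrow> 'v set \<Rightarrow> (nat \<Rightarrow> 'v \<Rightarrow> 'v)
    \<Rightarrow> real \<Rightarrow> quat \<Rightarrow> (quat \<Rightarrow> quat) \<Rightarrow> 'v \<Rightarrow> 'v" where
  "SFC lm D Tc \<phi> J h v = (1 / (2 * pi)) *\<^sub>R integral (UNIV - {0::real})
     (\<lambda>t. SLinv lm D Tc (gam \<phi> J t)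
            (lm (qmul (gam' \<phi> J t) (qmul (qinv J) (h (gam \<phi> J t)))) v))"

definition HFC :: "(quat \<Rightarrow> 'v::banach \<Rightarrow> 'v) \<Rightarrow> 'v set \<Rightarrow> (nat \<Rightarrow> 'v \<Rightarrow> 'v)
    \<Rightarrow> real \<Rightarrow> quat \<Rightarrow> (quat \<Rightarrow> quat) \<Rightarrow> 'v \<Rightarrow> 'v" where
  "HFC lm D Tc \<phi> J h v = (- 1 / pi) *\<^sub>R integral (UNIV - {0::real})
     (\<lambda>t. Qinv lm D Tc (gam \<phi> J t)
            (lm (qmul (gam' \<phi> J t) (qmul (qinv J) (h (gam \<phi> J t)))) v))"

end

theory Submission
  imports Defs "HOL-Complex_Analysis.Complex_Analysis" "HOL-Real_Asymp.Real_Asymp"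
begin

text \<open>
  Write \<open>R\<^sub>s\<close> for the inverse of \<open>Q\<^sub>c\<^sub>,\<^sub>s(T)\<close>, \<open>K\<^sub>s = (s - T\<^sub>0) R\<^sub>s\<close> and \<open>N\<^sub>s = (e\<^sub>1 T\<^sub>1 + e\<^sub>2 T\<^sub>2 + e\<^sub>3 T\<^sub>3) R\<^sub>s\<close>, so
  that the left S-resolvents of \<open>T\<close> and of its conjugate are \<open>K\<^sub>s + N\<^sub>s\<close> and \<open>K\<^sub>s - N\<^sub>s\<close>. Integrating \<open>R\<close>,
  \<open>K\<close> and \<open>N\<close> against an intrinsic \<open>f\<close> gives operators \<open>W(f)\<close>, \<open>U(f)\<close> and \<open>X(f)\<close> with \<open>Df(T) = -2 W(f)\<close>, while
  \<open>f\<close> of \<open>T\<close> and of its conjugate are \<open>U(f) + X(f)\<close> and \<open>U(f) - X(f)\<close>. On a single slice the identity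
  \<open>R\<^sub>s K\<^sub>p + K\<^sub>s R\<^sub>p = (R\<^sub>s - R\<^sub>p) / (p - s)\<close> together with Cauchy's formula yields
  \<open>W(f g) = W(f) U(g) + U(f) W(g)\<close>. The sum of the contributions of the two conjugate boundary points to
  \<open>W(f)\<close> is quaternionic linear, independent of the slice and commutes with the components of \<open>T\<close>, whence
  \<open>W(f) X(g) = X(f) W(g)\<close>, and both product rules follow for intrinsic \<open>g\<close>. A general \<open>g\<close> is a combination
  \<open>g\<^sub>0 + g\<^sub>1 e\<^sub>1 + g\<^sub>2 e\<^sub>2 + g\<^sub>3 e\<^sub>3\<close> of intrinsic functions. Integrals are computed in the logarithmic
  coordinate \<open>s = e\<^sup>w\<close>, which turns sectors into strips and their boundary rays into horizontal lines.
\<close>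

section \<open>Integrals of vector-valued functions over the line\<close>

text \<open>For s = 1 or s = -1, the identity W(f) X(g) = X(f) W(g) allows a multiple of a vanishing
  difference to be added to the product formula: -2 W(f g) = -2 W(f) (U(g) + s X(g)) + (U(f) - s
  X(f)) (-2 W(g)). This is why each rule involves the conjugate in exactly one place. Three
  obstacles shape the rest. The type condition bounds only the S-resolvents, while W needs the decay
  |s|^-2 of the inverse of Q; it is recovered from (s - T_0)^2 - (e_1 T_1 + e_2 T_2 + e_3 T_3)^2 =
  Q_s, which takes left and right resolvents of both T and its conjugate. The components may be
  unbounded, so their commutation with the inverse of Q is a question of domains, settled by
  comparing dom(T^2) with the domain of the squared conjugate. Finally, every integral comes with
  its own angle and unit. Cauchy's formula in the double integral needs two distinct angles; equal
  angles are reached because W is shown to be independent of the angle by moving the contour, and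
  the product formulas pass this on to the products in which U and X occur.\<close>

lemmas HK_diff = Henstock_Kurzweil_Integration.integral_diff
lemmas HK_combine = Henstock_Kurzweil_Integration.integral_combine
lemmas HK_add = Henstock_Kurzweil_Integration.integral_add
lemmas HK_sum = Henstock_Kurzweil_Integration.integral_sum

lemma has_integral_UNIV_of_antiderivative:
  fixes F f :: "real \<Rightarrow> 'v::banach"
  assumes S: "finite S" and contF: "continuous_on UNIV F"
    and F: "\<And>x. x \<notin> S \<Longrightarrow> (F has_vector_derivative f x) (at x)"
    and bot: "(F \<longlongrightarrow> L0) at_bot" and top: "(F \<longlongrightarrow> L1) at_top"
  shows "(f has_integral (L1 - L0)) UNIV"
proof -
  have *: "(f has_integral (F b - F a)) {a..b}" if "a \<le> b" for a b
    using that F continuous_on_subset[OF contF]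
    by (intro fundamental_theorem_of_calculus_interior_strong[OF S]) auto
  show ?thesis
    unfolding has_integral_alt'[of f]
  proof (intro conjI allI impI)
    fix a b :: real
    show "(\<lambda>x. if x \<in> UNIV then f x else 0) integrable_on cbox a b"
      using * [of a b] by (cases "a \<le> b") (auto simp: has_integral_integrable)
  next
    fix e :: real assume e: "e > 0"
    have "\<forall>\<^sub>F x in at_top. dist (F x) L1 < e/2" "\<forall>\<^sub>F x in at_bot. dist (F x) L0 < e/2"
      using tendstoD[OF top, of "e/2"] tendstoD[OF bot, of "e/2"] e by auto
    then obtain b0 a0 where b0: "\<And>x. x \<ge> b0 \<Longrightarrow> dist (F x) L1 < e/2"
      and a0: "\<And>x. x \<le> a0 \<Longrightarrow> dist (F x) L0 < e/2"
      unfolding eventually_at_top_linorder eventually_at_bot_linorder by blast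
    \<comment> \<open>The 1 keeps the ball nonempty, so that
      \<open>ball 0 B \<subseteq> cbox a b\<close> forces \<open>a \<le> -B\<close> and
      \<open>B \<le> b\<close>.\<close>
    define B where "B = max 1 (max \<bar>a0\<bar> \<bar>b0\<bar>)"
    have "norm (integral (cbox a b) (\<lambda>x. if x \<in> UNIV then f x else 0) - (L1 - L0)) < e"
      if "ball 0 B \<subseteq> cbox a b" for a b
    proof -
      have "a \<le> -B" "B \<le> b"
      proof -
        have "{-B<..<B} \<subseteq> {a..b}" using that by (simp add: ball_eq_greaterThanLessThan)
        moreover have "-B < B" by (simp add: B_def)
        ultimately show "a \<le> -B" "B \<le> b"
          using greaterThanLessThan_subseteq_atLeastAtMost_iff[of "-B" B a b] by auto
      qed
      then have "a \<le> b" "a \<le> a0" "b0 \<le> b" by (auto simp: B_def)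
      then have "integral (cbox a b) f = F b - F a" "dist (F b) L1 < e/2" "dist (F a) L0 < e/2"
        using *[of a b] a0 b0 by (auto simp: integral_unique)
      moreover have "norm (F b - F a - (L1 - L0)) \<le> norm (F b - L1) + norm (F a - L0)"
        using norm_triangle_ineq4[of "F b - L1" "F a - L0"] by (simp add: algebra_simps)
      ultimately show ?thesis by (simp add: dist_norm)
    qed
    then show "\<exists>B>0. \<forall>a b. ball 0 B \<subseteq> cbox a b \<longrightarrow>
        norm (integral (cbox a b) (\<lambda>x. if x \<in> UNIV then f x else 0) - (L1 - L0)) < e"
      by (intro exI[of _ B]) (auto simp: B_def)
  qed
qed

lemma has_integral_Ioi_of_antiderivative:
  fixes F f :: "real \<Rightarrow> 'v::banach"
  assumes F: "\<And>x. x > 0 \<Longrightarrow> (F has_vector_derivative f x) (at x)"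
    and bot: "(F \<longlongrightarrow> L0) (at_right 0)" and top: "(F \<longlongrightarrow> L1) at_top"
  shows "(f has_integral (L1 - L0)) {0<..}"
proof -
  \<comment> \<open>Extended by its limit, the primitive is continuous on the whole line and 0 is
    the only exceptional point.\<close>
  define G where "G x = (if x \<le> 0 then L0 else F x)" for x
  define h where "h x = (if x \<in> {0<..} then f x else 0)" for x :: real
  have dG: "(G has_vector_derivative h x) (at x)" if "x \<noteq> 0" for x
  proof (cases "x > 0")
    case True
    then have "(F has_vector_derivative h x) (at x)" using F[OF True] by (simp add: h_def)
    then show ?thesis
      by (rule has_vector_derivative_transform_within_open[where S="{0<..}"])
        (use True in \<open>auto simp: G_def\<close>)
  next
    case False
    then have x: "x < 0" using that by simp
    have "((\<lambda>_. L0) has_vector_derivative h x) (at x)" using x by (simp add: h_def)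
    then show ?thesis
      by (rule has_vector_derivative_transform_within_open[where S="{..<0}"])
        (use x in \<open>auto simp: G_def\<close>)
  qed
  have cont0: "isCont G 0"
  proof -
    have "(G \<longlongrightarrow> L0) (at_right 0)"
      using bot by (rule Lim_transform_eventually)
        (auto simp: G_def eventually_at_right_less eventually_at_filter)
    moreover have "(G \<longlongrightarrow> L0) (at_left 0)"
      by (rule tendsto_eventually) (auto simp: G_def eventually_at_filter)
    ultimately show ?thesis by (simp add: isCont_def filterlim_at_split G_def)
  qed
  have cont: "continuous_on UNIV G"
    using cont0 dG has_vector_derivative_continuous
    by (metis UNIV_I continuous_at_imp_continuous_on)
  have "(G \<longlongrightarrow> L1) at_top"
    using top by (rule Lim_transform_eventually)
      (use eventually_gt_at_top[of "0::real"] in \<open>eventually_elim, auto simp: G_def\<close>)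
  moreover have "(G \<longlongrightarrow> L0) at_bot"
    by (rule tendsto_eventually)
      (use eventually_le_at_bot[of "0::real"] in \<open>eventually_elim, auto simp: G_def\<close>)
  ultimately have "(h has_integral (L1 - L0)) UNIV"
    by (intro has_integral_UNIV_of_antiderivative[of "{0}" G] cont) (auto intro: dG)
  then show ?thesis unfolding h_def by (simp only: has_integral_restrict_UNIV)
qed

lemma has_integral_reflect_UNIV:
  fixes f :: "real \<Rightarrow> 'v::banach"
  assumes "(f has_integral I) UNIV"
  shows "((\<lambda>x. f (- x)) has_integral I) UNIV"
  unfolding has_integral_alt'[of "\<lambda>x. f (- x)"]
proof (intro conjI allI impI)
  have f: "f integrable_on {a..b}" for a b
    using assms unfolding has_integral_alt' by (simp add: box_real)
  show "(\<lambda>x. if x \<in> UNIV then f (- x) else 0) integrable_on cbox a b" for a b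
    using f[of "- b" "- a"] Henstock_Kurzweil_Integration.integrable_reflect_real[where f=f and a="- b" and b="- a"] by simp
  fix e :: real assume "e > 0"
  then obtain B where B: "B > 0" "\<And>a b. ball 0 B \<subseteq> cbox a b \<Longrightarrow>
      norm (integral (cbox a b) f - I) < e"
    using assms unfolding has_integral_alt' by auto
  have "norm (integral (cbox a b) (\<lambda>x. f (- x)) - I) < e" if "ball 0 B \<subseteq> cbox a b" for a b
  proof -
    have "ball 0 B \<subseteq> cbox (- b) (- a)"
    proof
      fix x :: real assume "x \<in> ball 0 B"
      then have "- x \<in> ball 0 B" by simp
      then have "- x \<in> cbox a b" using that by blast
      then show "x \<in> cbox (- b) (- a)" by auto
    qed
    from B(2)[OF this] show ?thesis
      using Henstock_Kurzweil_Integration.integral_reflect_real[where f=f and a="- b" and b="- a"] by simp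
  qed
  then show "\<exists>B>0. \<forall>a b. ball 0 B \<subseteq> cbox a b \<longrightarrow>
      norm (integral (cbox a b) (\<lambda>x. if x \<in> UNIV then f (- x) else 0) - I) < e"
    using B(1) by auto
qed

section \<open>Exponentially decaying integrands, their tails, and exchange of integrals\<close>

abbreviation edecay :: "real \<Rightarrow> real \<Rightarrow> real" where
  "edecay a x \<equiv> exp (- a * \<bar>x\<bar>)"

lemma exp_abs_integrable:
  fixes a :: real
  assumes a: "a > 0"
  shows "(\<lambda>x. edecay a x) integrable_on UNIV"
proof -
  define h where "h x = (if x \<in> {0..} then exp (- a * x) else 0)" for x
  have h: "(h has_integral (exp (- a * 0) / a)) UNIV"
    unfolding h_def has_integral_restrict_UNIV by (rule has_integral_exp_minus_to_infinity[OF a])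
  have "(\<lambda>x. h x + h (- x)) integrable_on UNIV"
    using has_integral_add[OF h has_integral_reflect_UNIV[OF h]] by blast
  then show ?thesis
    by (rule integrable_on_all_intervals_UNIV[rotated 2])
      (auto simp: h_def intro!: integrable_continuous_interval continuous_intros)
qed

lemma exp_decay_integrable:
  fixes f :: "real \<Rightarrow> 'v::banach"
  assumes a: "a > 0" and cont: "continuous_on UNIV f"
    and le: "\<And>x. norm (f x) \<le> M * edecay a x"
  shows "f integrable_on UNIV"
proof -
  have "(\<lambda>x. M * edecay a x) integrable_on UNIV"
    using integrable_on_cmult_left[OF exp_abs_integrable[OF a], of M] by simp
  then show ?thesis
    by (intro integrable_on_all_intervals_integrable_bound[OF _ le])
       (auto intro: integrable_continuous_interval continuous_on_subset[OF cont])
qed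

definition exp_decaying :: "(real \<Rightarrow> 'v::banach) \<Rightarrow> bool" where
  "exp_decaying f \<longleftrightarrow> continuous_on UNIV f \<and> (\<exists>a>0. \<exists>M. \<forall>x. norm (f x) \<le> M * edecay a x)"

lemma exp_decaying_integrable: "exp_decaying f \<Longrightarrow> f integrable_on UNIV"
  unfolding exp_decaying_def using exp_decay_integrable by blast

lemma exp_decaying_add:
  assumes f: "exp_decaying f" and g: "exp_decaying g"
  shows "exp_decaying (\<lambda>x. f x + g x)"
proof -
  obtain a M b N where a: "a > 0" "\<And>x. norm (f x) \<le> M * edecay a x"
    and b: "b > 0" "\<And>x. norm (g x) \<le> N * edecay b x"
    using f g unfolding exp_decaying_def by blast
  have MN: "M \<ge> 0" "N \<ge> 0" using order_trans[OF norm_ge_zero a(2)[of 0]] order_trans[OF norm_ge_zero b(2)[of 0]] by simp_all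
  have "norm (f x + g x) \<le> (M + N) * edecay (min a b) x" for x
  proof -
    have "M * edecay a x \<le> M * edecay (min a b) x" "N * edecay b x \<le> N * edecay (min a b) x"
      using MN by (auto intro!: mult_left_mono mult_right_mono)
    then show ?thesis using a(2)[of x] b(2)[of x] norm_triangle_ineq[of "f x" "g x"]
      unfolding distrib_right by linarith
  qed
  moreover have "min a b > 0" using a b by simp
  ultimately show ?thesis using f g unfolding exp_decaying_def by (blast intro: continuous_on_add)
qed

lemma exp_decaying_0: "exp_decaying (\<lambda>x. 0)"
  unfolding exp_decaying_def by (intro conjI exI[of _ 1] exI[of _ 0]) auto

lemma exp_decaying_sum:
  assumes "\<And>i. i \<in> I \<Longrightarrow> exp_decaying (f i)"
  shows "exp_decaying (\<lambda>x. \<Sum>i\<in>I. f i x)"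
  using assms
proof (induction I rule: infinite_finite_induct)
  case (insert i I)
  then show ?case by (simp add: exp_decaying_add)
qed (simp_all add: exp_decaying_0)

lemma exp_decay_norm_integral:
  fixes f :: "real \<Rightarrow> 'v::banach"
  assumes a: "a > 0" and int: "f integrable_on UNIV"
    and le: "\<And>x. norm (f x) \<le> M * edecay a x"
  shows "norm (integral UNIV f) \<le> M * integral UNIV (\<lambda>x. edecay a x)"
proof -
  have "norm (integral UNIV f) \<le> integral UNIV (\<lambda>x. M * edecay a x)"
    using integrable_on_cmult_left[OF exp_abs_integrable[OF a], of M]
    by (intro integral_norm_bound_integral int le) auto
  then show ?thesis by simp
qed

definition exp_tail :: "real \<Rightarrow> nat \<Rightarrow> real" where
  "exp_tail a n = integral UNIV (\<lambda>x. edecay a x)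
     - integral {- real n..real n} (\<lambda>x. edecay a x)"

lemma integral_Int_symmetric_tendsto:
  fixes f :: "real \<Rightarrow> 'v::banach"
  assumes "f integrable_on S"
  shows "((\<lambda>t. integral (S \<inter> {- t..t}) f) \<longlongrightarrow> integral S f) at_top"
proof (rule tendstoI)
  fix e :: real assume e: "e > 0"
  obtain B where B: "B > 0" "\<And>a b. ball 0 B \<subseteq> cbox a b \<Longrightarrow>
      norm (integral (cbox a b) (\<lambda>x. if x \<in> S then f x else 0) - integral S f) < e"
    using integrable_integral[OF assms] e unfolding has_integral_alt'[of f] by meson
  have "dist (integral (S \<inter> {- t..t}) f) (integral S f) < e" if "t \<ge> B" for t
    using that B(1) B(2)[of "- t" t] subset_trans[of "{-B<..<B}" "{-B..B}" "{-t..t}"]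
    by (auto simp: greaterThanLessThan_subseteq_atLeastAtMost_iff ball_eq_greaterThanLessThan Henstock_Kurzweil_Integration.integral_restrict_Int dist_norm)
  then show "\<forall>\<^sub>F t in at_top. dist (integral (S \<inter> {- t..t}) f) (integral S f) < e"
    using eventually_at_top_linorder by blast
qed

lemma integral_symmetric_tendsto:
  fixes f :: "real \<Rightarrow> 'v::banach"
  assumes "f integrable_on UNIV"
  shows "(\<lambda>n. integral {- real n..real n} f) \<longlonglongrightarrow> integral UNIV f"
  using filterlim_compose[OF integral_Int_symmetric_tendsto[OF assms] filterlim_real_sequentially]
  by simp

lemma exp_tail_tendsto: "a > 0 \<Longrightarrow> exp_tail a \<longlonglongrightarrow> 0"
  unfolding exp_tail_def
  using tendsto_diff[OF tendsto_const integral_symmetric_tendsto[OF exp_abs_integrable[of a]],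
      of "integral UNIV (\<lambda>x. edecay a x)"] by simp

lemma exp_decay_tail:
  fixes f :: "real \<Rightarrow> 'v::banach"
  assumes a: "a > 0" and cont: "continuous_on UNIV f"
    and le: "\<And>x. norm (f x) \<le> M * edecay a x"
  shows "norm (integral UNIV f - integral {- real n..real n} f) \<le> M * exp_tail a n"
proof -
  let ?S = "{- real n..real n}" and ?e = "\<lambda>x. M * edecay a x"
  have f: "f integrable_on UNIV" by (rule exp_decay_integrable[OF assms])
  have e: "?e integrable_on UNIV"
    using integrable_on_cmult_left[OF exp_abs_integrable[OF a], of M] by simp
  have fS: "(\<lambda>x. if x \<in> ?S then f x else 0) integrable_on UNIV"
    unfolding integrable_restrict_UNIV by (auto intro: integrable_continuous_interval continuous_on_subset[OF cont])
  have eS: "(\<lambda>x. if x \<in> ?S then ?e x else 0) integrable_on UNIV"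
    unfolding integrable_restrict_UNIV by (intro integrable_continuous_interval continuous_intros)
  have "norm (integral UNIV (\<lambda>x. f x - (if x \<in> ?S then f x else 0)))
     \<le> integral UNIV (\<lambda>x. ?e x - (if x \<in> ?S then ?e x else 0))"
    using le by (intro integral_norm_bound_integral integrable_diff f e fS eS) auto
  then show ?thesis
    unfolding HK_diff[OF f fS]
      HK_diff[OF e eS]
      Henstock_Kurzweil_Integration.integral_restrict_UNIV
    by (simp add: exp_tail_def algebra_simps)
qed

lemma exp_tail_nonneg: "a > 0 \<Longrightarrow> exp_tail a n \<ge> 0"
  using order_trans[OF norm_ge_zero exp_decay_tail[of a "\<lambda>x. edecay a x" 1 n]]
  by (simp add: continuous_intros)

text \<open>The codomain need not be second countable, so the Bochner integral and its version of Fubini's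
  theorem are not available.\<close>
lemma swap_integral_exp_decay:
  fixes F :: "real \<Rightarrow> real \<Rightarrow> 'v::banach"
  assumes a: "a > 0" and cont: "continuous_on UNIV (\<lambda>(x, y). F x y)"
    and le: "\<And>x y. norm (F x y) \<le> M * edecay a x * edecay a y"
  shows "(\<lambda>x. integral UNIV (F x)) integrable_on UNIV"
    and "integral UNIV (\<lambda>x. integral UNIV (F x)) = integral UNIV (\<lambda>y. integral UNIV (\<lambda>x. F x y))"
proof -
  \<comment> \<open>On the squares obtained by truncating both variables, continuity suffices for
    the exchange. \<open>main\<close> shows that these truncations converge to the iterated
    integral; its hypotheses are symmetric in the two variables, so it serves both orders.\<close>
  have main: "(\<lambda>x. integral UNIV (F x)) integrable_on UNIV \<and>
     (\<lambda>n. integral {-real n..real n} (\<lambda>x. integral {-real n..real n} (F x)))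
       \<longlonglongrightarrow> integral UNIV (\<lambda>x. integral UNIV (F x))"
    if cont: "continuous_on UNIV (\<lambda>(x, y). F x y)"
    and le: "\<And>x y. norm (F x y) \<le> M * edecay a x * edecay a y"
    for F :: "real \<Rightarrow> real \<Rightarrow> 'v"
  proof -
    define E where "E = integral UNIV (\<lambda>x. edecay a x)"
    have M: "M \<ge> 0" using order_trans[OF norm_ge_zero le[of 0 0]] by simp
    define \<Phi> where "\<Phi> x = integral UNIV (F x)" for x
    define \<Phi>n where "\<Phi>n n x = integral {-real n..real n} (F x)" for n x
    have cF: "continuous_on UNIV (F x)" for x
      using continuous_on_compose2[OF cont, of UNIV "\<lambda>y. (x, y)"] by (simp add: continuous_intros)
    have c\<Phi>n: "continuous_on UNIV (\<Phi>n n)" for n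
      unfolding \<Phi>n_def using integral_continuous_on_param[of UNIV "-real n" "real n" F]
      by (simp add: continuous_on_subset[OF cont])
    have diff: "norm (\<Phi> x - \<Phi>n n x) \<le> M * edecay a x * exp_tail a n" for x n
      unfolding \<Phi>_def \<Phi>n_def by (rule exp_decay_tail[OF a cF le])
    have bnd: "norm (\<Phi> x) \<le> (M * E) * edecay a x" for x
      using exp_decay_norm_integral[OF a exp_decay_integrable[OF a cF[of x] le] le]
      by (simp add: \<Phi>_def E_def algebra_simps)
    \<comment> \<open>Uniformity in \<open>x\<close> is what passes continuity from the truncated
      inner integrals to \<open>\<Phi>\<close>.\<close>
    have unif: "uniform_limit UNIV \<Phi>n \<Phi> sequentially"
    proof (rule uniform_limitI)
      fix e :: real assume "e > 0"
      then have "\<forall>\<^sub>F n in sequentially. M * exp_tail a n < e"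
        using tendsto_mult[OF tendsto_const exp_tail_tendsto[OF a], of M]
        by (auto dest: order_tendstoD)
      then show "\<forall>\<^sub>F n in sequentially. \<forall>x\<in>UNIV. dist (\<Phi>n n x) (\<Phi> x) < e"
      proof eventually_elim
        case (elim n)
        have "M * edecay a x * exp_tail a n \<le> M * 1 * exp_tail a n" for x
          using M a exp_tail_nonneg[OF a] by (intro mult_right_mono mult_left_mono) auto
        then show ?case using diff[of _ n] elim
          by (auto simp: dist_norm norm_minus_commute) (smt (verit))
      qed
    qed
    have c\<Phi>: "continuous_on UNIV \<Phi>"
      by (rule uniform_limit_theorem[OF _ unif]) (auto simp: c\<Phi>n)
    have i\<Phi>: "\<Phi> integrable_on UNIV" by (rule exp_decay_integrable[OF a c\<Phi> bnd])
    have "(\<lambda>n. integral {-real n..real n} \<Phi> - integral {-real n..real n} (\<Phi>n n)) \<longlonglongrightarrow> 0"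
    proof (rule Lim_null_comparison)
      have i: "\<Phi> integrable_on {-real n..real n}" "\<Phi>n n integrable_on {-real n..real n}"
        "(\<lambda>x. M * exp_tail a n * edecay a x) integrable_on {-real n..real n}" for n
        by (auto intro!: integrable_continuous_interval continuous_intros
            continuous_on_subset[OF c\<Phi>] continuous_on_subset[OF c\<Phi>n])
      have "norm (integral {-real n..real n} \<Phi> - integral {-real n..real n} (\<Phi>n n)) \<le> M * E * exp_tail a n" for n
      proof -
        have "norm (integral {-real n..real n} (\<lambda>x. \<Phi> x - \<Phi>n n x))
          \<le> integral {-real n..real n} (\<lambda>x. M * exp_tail a n * edecay a x)"
          using diff by (intro integral_norm_bound_integral integrable_diff i) (auto simp: mult_ac)
        also have "\<dots> = M * exp_tail a n * integral {-real n..real n} (\<lambda>x. edecay a x)"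
          by simp
        also have "\<dots> \<le> M * exp_tail a n * E"
          using exp_tail_nonneg[OF a, of n] M
          by (intro mult_left_mono) (auto simp: exp_tail_def E_def)
        finally show ?thesis
          using HK_diff[OF i(1,2)] by (simp add: mult_ac)
      qed
      then show "\<forall>\<^sub>F n in sequentially. norm (integral {-real n..real n} \<Phi> - integral {-real n..real n} (\<Phi>n n))
          \<le> M * E * exp_tail a n" by simp
      show "(\<lambda>n. M * E * exp_tail a n) \<longlonglongrightarrow> 0"
        using tendsto_mult[OF tendsto_const exp_tail_tendsto[OF a], of "M * E"] by simp
    qed
    from tendsto_diff[OF integral_symmetric_tendsto[OF i\<Phi>] this]
    have "(\<lambda>n. integral {-real n..real n} (\<Phi>n n)) \<longlonglongrightarrow> integral UNIV \<Phi>" by simp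
    with i\<Phi> show ?thesis unfolding \<Phi>_def \<Phi>n_def by blast
  qed
  show "(\<lambda>x. integral UNIV (F x)) integrable_on UNIV" using main[OF cont le] by blast
  have cont': "continuous_on UNIV (\<lambda>(y, x). F x y)"
    using continuous_on_compose2[OF cont, of UNIV "\<lambda>p. (snd p, fst p)"]
    by (simp add: continuous_intros case_prod_beta)
  have le': "norm (F x y) \<le> M * edecay a y * edecay a x" for y x
    using le[of x y] by (simp add: mult_ac)
  have swap: "integral {-real n..real n} (\<lambda>x. integral {-real n..real n} (F x))
      = integral {-real n..real n} (\<lambda>y. integral {-real n..real n} (\<lambda>x. F x y))" for n
    using integral_swap_continuous[of "-real n" "-real n" "real n" "real n" F]
      continuous_on_subset[OF cont] by simp
  show "integral UNIV (\<lambda>x. integral UNIV (F x)) = integral UNIV (\<lambda>y. integral UNIV (\<lambda>x. F x y))"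
    using main[OF cont le] main[of "\<lambda>y x. F x y", OF cont' le'] LIMSEQ_unique
    unfolding swap by blast
qed

text \<open>If \<open>G\<close> is a primitive of the integrand in the logarithmic coordinate, then
  \<open>G\<close> composed with \<open>ln\<close> is a primitive of \<open>f\<close> on the
  half-line, and the limits of \<open>G\<close> at both infinities become its boundary values at 0
  and at infinity.\<close>

lemma has_integral_Ioi_exp_substitution:
  fixes f :: "real \<Rightarrow> 'v::banach"
  defines "g \<equiv> \<lambda>x. exp x *\<^sub>R f (exp x)"
  assumes g: "exp_decaying g"
  shows "(f has_integral (integral UNIV g)) {0<..}"
proof -
  obtain a M where a: "a > 0" and cont: "continuous_on UNIV g"
    and le: "\<And>x. norm (g x) \<le> M * edecay a x"
    using g unfolding exp_decaying_def by blast
  have gi: "g integrable_on {c..d}" for c d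
    by (intro integrable_continuous_interval continuous_on_subset[OF cont]) auto
  \<comment> \<open>An interval with reversed ends is empty and contributes 0, so the difference is
    the oriented integral from 0 to \<open>x\<close> for either sign of \<open>x\<close>.\<close>
  define G where "G x = integral {0..x} g - integral {x..0} g" for x
  have Gdiff: "G x = G c + integral {c..x} g" if "c \<le> x" for c x
  proof -
    consider "0 \<le> c" | "c \<le> 0" "0 \<le> x" | "x \<le> 0" using that by linarith
    then show ?thesis
    proof cases
      case 1
      then show ?thesis using that HK_combine[of 0 c x g, OF _ _ gi]
        by (cases "c = 0"; cases "x = 0") (auto simp: G_def)
    next
      case 2
      then show ?thesis using that HK_combine[of c 0 x g, OF _ _ gi]
        by (cases "c = 0"; cases "x = 0") (auto simp: G_def algebra_simps)
    next
      case 3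
      then show ?thesis using that HK_combine[of c x 0 g, OF _ _ gi]
        by (cases "c = 0"; cases "x = 0") (auto simp: G_def algebra_simps)
    qed
  qed
  have dG: "(G has_vector_derivative g x) (at x)" for x
  proof -
    have "((\<lambda>y. integral {x-1..y} g) has_vector_derivative g x) (at x within {x-1..x+1})"
      by (rule integral_has_vector_derivative) (auto intro: continuous_on_subset[OF cont])
    then have "((\<lambda>y. G (x-1) + integral {x-1..y} g) has_vector_derivative g x) (at x within {x-1..x+1})"
      by (auto intro!: derivative_eq_intros)
    then have "(G has_vector_derivative g x) (at x within {x-1..x+1})"
      by (intro has_vector_derivative_transform[of x "{x-1..x+1}" G "\<lambda>y. G (x-1) + integral {x-1..y} g"])
        (simp_all, metis Gdiff)
    moreover have "at x within {x-1..x+1} = at x" by (rule at_within_interior) auto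
    ultimately show ?thesis by simp
  qed
  have gS: "g integrable_on S" if "S = {0..} \<or> S = {..0}" for S
  proof -
    have "(\<lambda>x. M * edecay a x) integrable_on UNIV"
      using integrable_on_cmult_left[OF exp_abs_integrable[OF a], of M] by simp
    moreover have "(\<lambda>x. if x \<in> S then g x else 0) integrable_on cbox c d" for c d
    proof -
      have "{0..} \<inter> {c..d} = {max 0 c..d}" "{..0} \<inter> {c..d} = {c..min 0 d}" by auto
      then show ?thesis
        using that gi unfolding Henstock_Kurzweil_Integration.integrable_restrict_Int by auto
    qed
    moreover have "norm (if x \<in> S then g x else 0) \<le> M * edecay a x" for x
      using le[of x] order_trans[OF norm_ge_zero le[of x]] by simp
    ultimately have "(\<lambda>x. if x \<in> S then g x else 0) integrable_on UNIV"
      by (rule integrable_on_all_intervals_UNIV[rotated 2])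
    then show ?thesis unfolding Henstock_Kurzweil_Integration.integrable_restrict_UNIV .
  qed
  have Int_pos: "{0..} \<inter> {-t..t} = {0..t}" and Int_neg: "{..0} \<inter> {-t..t} = {-t..0}" if "t > 0" for t :: real
    using that by auto
  have "((\<lambda>t. integral ({0..} \<inter> {-t..t}) g) \<longlongrightarrow> integral {0..} g) at_top"
    by (intro integral_Int_symmetric_tendsto gS) auto
  then have top: "(G \<longlongrightarrow> integral {0..} g) at_top"
    by (rule Lim_transform_eventually)
      (use eventually_gt_at_top[of "0::real"] in \<open>eventually_elim, simp add: G_def Int_pos\<close>)
  have "((\<lambda>t. - integral ({..0} \<inter> {-t..t}) g) \<longlongrightarrow> - integral {..0} g) at_top"
    by (intro integral_Int_symmetric_tendsto tendsto_minus gS) auto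
  then have "((\<lambda>t. G (-t)) \<longlongrightarrow> - integral {..0} g) at_top"
    by (rule Lim_transform_eventually)
      (use eventually_gt_at_top[of "0::real"] in \<open>eventually_elim, simp add: G_def Int_neg\<close>)
  then have bot: "(G \<longlongrightarrow> - integral {..0} g) at_bot"
    by (simp add: filterlim_at_bot_mirror)
  have "(g has_integral (integral {0..} g - - integral {..0} g)) UNIV"
    by (rule has_integral_UNIV_of_antiderivative[of "{}" G, OF _ _ dG bot top])
      (auto intro!: continuous_at_imp_continuous_on has_vector_derivative_continuous[OF dG])
  then have I: "integral UNIV g = integral {0..} g - - integral {..0} g" by (rule integral_unique)
  have "((\<lambda>t. G (ln t)) has_vector_derivative f t) (at t)" if t: "t > 0" for t
  proof -
    have "(ln has_vector_derivative 1 / t) (at t)"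
      using t DERIV_ln_divide[of t] by (simp add: has_real_derivative_iff_has_vector_derivative)
    from vector_diff_chain_at[OF this dG] t show ?thesis
      by (simp add: o_def g_def)
  qed
  then show ?thesis
    unfolding I
    by (rule has_integral_Ioi_of_antiderivative)
      (auto intro: filterlim_compose[OF bot ln_at_0] filterlim_compose[OF top ln_at_top])
qed

section \<open>Cauchy's formula in a strip\<close>

lemma open_strip: "open {w. \<bar>Im w\<bar> < \<theta>}" and convex_strip: "convex {w. \<bar>Im w\<bar> < \<theta>}"
proof -
  have eq: "{w. \<bar>Im w\<bar> < \<theta>} = {w. Im w < \<theta>} \<inter> {w. Im w > - \<theta>}" by auto
  show "open {w. \<bar>Im w\<bar> < \<theta>}" "convex {w. \<bar>Im w\<bar> < \<theta>}"
    unfolding eq by (auto intro!: convex_Int open_Int open_halfspace_Im_lt open_halfspace_Im_gt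
        convex_halfspace_Im_lt convex_halfspace_Im_gt)
qed

lemma has_contour_integral_linepath_same_Im_iff:
  assumes "a < b"
  shows "(f has_contour_integral I) (linepath (Complex a c) (Complex b c)) \<longleftrightarrow>
    ((\<lambda>x. f (Complex x c)) has_integral I) {a..b}"
proof -
  have "(f has_contour_integral I) (linepath (Complex a c) (Complex b c)) \<longleftrightarrow>
      ((\<lambda>z. f (z + \<i> * of_real c)) has_contour_integral I) (linepath (of_real a) (of_real b))"
    unfolding has_contour_integral_linepath
    by (intro has_integral_cong) (auto simp: linepath_def Complex_eq algebra_simps)
  also have "\<dots> \<longleftrightarrow> ((\<lambda>x. f (Complex x c)) has_integral I) {a..b}"
    using assms by (subst has_contour_integral_linepath_Reals_iff) (auto simp: Complex_eq)
  finally show ?thesis .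
qed

lemma contour_integral_rectpath:
  assumes "a < b" "c < d" and cont: "continuous_on (path_image (rectpath (Complex a c) (Complex b d))) f"
  shows "contour_integral (rectpath (Complex a c) (Complex b d)) f =
     integral {a..b} (\<lambda>x. f (Complex x c) - f (Complex x d))
     + contour_integral (linepath (Complex b c) (Complex b d)) f
     + contour_integral (linepath (Complex a d) (Complex a c)) f"
proof -
  have sub: "closed_segment (Complex a c) (Complex b c) \<union> closed_segment (Complex b c) (Complex b d)
     \<union> closed_segment (Complex b d) (Complex a d) \<union> closed_segment (Complex a d) (Complex a c)
     \<subseteq> path_image (rectpath (Complex a c) (Complex b d))"
    by (auto simp: rectpath_def Let_def path_image_join)
  have ci: "f contour_integrable_on linepath (Complex a c) (Complex b c)"
    "f contour_integrable_on linepath (Complex b c) (Complex b d)"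
    "f contour_integrable_on linepath (Complex b d) (Complex a d)"
    "f contour_integrable_on linepath (Complex a d) (Complex a c)"
    using sub by (auto intro!: contour_integrable_continuous_linepath continuous_on_subset[OF cont])
  have i: "((\<lambda>x. f (Complex x e)) has_integral
      contour_integral (linepath (Complex a e) (Complex b e)) f) {a..b}"
    if "f contour_integrable_on linepath (Complex a e) (Complex b e)" for e
    using that has_contour_integral_integral[OF that] has_contour_integral_linepath_same_Im_iff[OF assms(1)]
    by blast
  have ci3: "f contour_integrable_on linepath (Complex a d) (Complex b d)"
    using contour_integrable_reversepath[OF valid_path_linepath ci(3)] by simp
  have 3: "contour_integral (linepath (Complex b d) (Complex a d)) f
      = - contour_integral (linepath (Complex a d) (Complex b d)) f"
    using contour_integral_reversepath[of "linepath (Complex a d) (Complex b d)" f] by simp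
  have "integral {a..b} (\<lambda>x. f (Complex x c) - f (Complex x d)) =
     contour_integral (linepath (Complex a c) (Complex b c)) f
     - contour_integral (linepath (Complex a d) (Complex b d)) f"
    using has_integral_diff[OF i[OF ci(1)] i[OF ci3]] by (rule integral_unique)
  then show ?thesis
    using ci by (simp add: rectpath_def Let_def 3 contour_integral_join contour_integrable_join)
qed

text \<open>With r = exp (Re z) and c = cos (Im z), the squares of the two sides differ by (1 - r)^2
  (1 + c) / 2. The factor 1 + r keeps the bound effective at both ends of a horizontal line.\<close>

lemma norm_one_minus_exp_ge:
  "norm (1 - exp z) \<ge> (1 + exp (Re z)) * sqrt ((1 - cos (Im z)) / 2)"
proof -
  let ?r = "exp (Re z)" and ?c = "cos (Im z)"
  have "(norm (1 - exp z))\<^sup>2 = (1 - ?r * ?c)\<^sup>2 + (?r * sin (Im z))\<^sup>2"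
    by (simp add: cmod_power2 Re_exp Im_exp)
  also have "\<dots> = (1 + ?r)\<^sup>2 - 2 * ?r * (1 + ?c)"
    using sin_cos_squared_add[of "Im z"] by algebra
  also have "\<dots> \<ge> (1 + ?r)\<^sup>2 * ((1 - ?c) / 2)"
  proof -
    have "(1 + ?r)\<^sup>2 - 2 * ?r * (1 + ?c) - (1 + ?r)\<^sup>2 * ((1 - ?c) / 2) = (1 - ?r)\<^sup>2 * (1 + ?c) / 2"
      by (simp add: power2_eq_square field_simps)
    moreover have "(1 - ?r)\<^sup>2 * (1 + ?c) / 2 \<ge> 0" 
    proof -
      have "0 \<le> 1 + ?c" using cos_ge_minus_one[of "Im z"] by linarith
      then show ?thesis by simp
    qed
    ultimately show ?thesis by linarith
  qed
  also have "(1 + ?r)\<^sup>2 * ((1 - ?c) / 2) = ((1 + ?r) * sqrt ((1 - ?c) / 2))\<^sup>2"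
    by (simp add: power_mult_distrib)
  finally show ?thesis by (rule power2_le_imp_le) simp
qed

text \<open>The quotient equals 1 / (1 - exp (z - w)), so on two fixed horizontal lines it is
  controlled by the difference of the heights alone. The second bound is the first with
  \<open>w\<close> and \<open>z\<close> exchanged.\<close>

lemma exp_kernel_bound:
  assumes "cos (y - y') \<noteq> 1"
  obtains c where "c > 0"
    "\<And>w z. Im w = y \<Longrightarrow> Im z = y' \<Longrightarrow> norm (exp w / (exp w - exp z)) \<le> c \<and> norm (exp z / (exp w - exp z)) \<le> c
      \<and> exp w \<noteq> exp z"
proof -
  define k where "k = sqrt ((1 - cos (y - y')) / 2)"
  have "cos (y - y') < 1" using assms cos_le_one[of "y - y'"] by linarith
  then have k: "k > 0" by (simp add: k_def)
  have *: "norm (exp w / (exp w - exp z)) \<le> 1 / k \<and> exp w \<noteq> exp z"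
    if "cos (Im w - Im z) = cos (y - y')" for w z
  proof -
    have "k * 1 \<le> (1 + exp (Re (z - w))) * k" using k by (simp add: algebra_simps)
    also have "\<dots> \<le> norm (1 - exp (z - w))"
      using norm_one_minus_exp_ge[of "z - w"] that cos_minus[of "Im w - Im z"] by (simp add: k_def)
    finally have le: "k \<le> norm (1 - exp (z - w))" by simp
    have eq: "exp w - exp z = exp w * (1 - exp (z - w))" by (simp add: exp_diff algebra_simps)
    have "1 - exp (z - w) \<noteq> 0" using le k by auto
    then have "norm (exp w / (exp w - exp z)) = 1 / norm (1 - exp (z - w))"
      unfolding eq by (simp add: norm_divide norm_mult)
    also have "\<dots> \<le> 1 / k" using le k by (simp add: frac_le)
    finally show ?thesis using \<open>1 - exp (z - w) \<noteq> 0\<close> eq by auto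
  qed
  show thesis
  proof (rule that[of "1/k"])
    show "1 / k > 0" using k by simp
    fix w z assume "Im w = y" "Im z = y'"
    then show "norm (exp w / (exp w - exp z)) \<le> 1/k \<and> norm (exp z / (exp w - exp z)) \<le> 1/k
      \<and> exp w \<noteq> exp z"
      using *[of w z] *[of z w] cos_minus[of "y - y'"] by (auto simp: norm_divide norm_minus_commute)
  qed
qed

lemma cos_neq_1:
  assumes "\<bar>x\<bar> < 2 * pi" "x \<noteq> 0"
  shows "cos x \<noteq> 1"
proof
  assume "cos x = 1"
  then obtain n :: int where n: "x = of_int n * 2 * pi" using cos_one_2pi_int by auto
  then have "\<bar>real_of_int n\<bar> * (2 * pi) < 1 * (2 * pi)" using assms(1) by (simp add: abs_mult)
  then have "\<bar>n\<bar> < 1" by (subst (asm) mult_less_cancel_right_pos) auto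
  then show False using n assms(2) by auto
qed

text \<open>When the real parts are at least 1 apart, the moduli of the exponentials differ by a
  factor of at least e \<ge> 2, whatever the imaginary parts. This controls the vertical sides of
  the rectangle, whose heights may include that of \<open>w0\<close>.\<close>

lemma exp_kernel_bound_far:
  assumes "\<bar>Re w - Re z\<bar> \<ge> 1"
  shows "norm (exp w / (exp w - exp z)) \<le> 2"
proof -
  have e: "exp (1::real) \<ge> 2" using exp_ge_add_one_self[of 1] by simp
  have "exp (Re w) \<le> 2 * norm (exp w - exp z)"
  proof (cases "Re w \<ge> Re z")
    case True
    then have "exp (Re z + 1) \<le> exp (Re w)" using assms by simp
    then have "exp (Re z) * 2 \<le> exp (Re w)"
      using mult_left_mono[OF e, of "exp (Re z)"] unfolding exp_add by (smt (verit) exp_ge_zero)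
    then show ?thesis using norm_triangle_ineq2[of "exp w" "exp z"] by simp
  next
    case False
    then have "exp (Re w + 1) \<le> exp (Re z)" using assms by simp
    then have "exp (Re w) * 2 \<le> exp (Re z)"
      using mult_left_mono[OF e, of "exp (Re w)"] unfolding exp_add by (smt (verit) exp_ge_zero)
    then show ?thesis using norm_triangle_ineq3[of "exp w" "exp z"] exp_gt_zero[of "Re w"] by simp
  qed
  moreover from this have "norm (exp w - exp z) > 0" using exp_gt_zero[of "Re w"] by linarith
  ultimately show ?thesis by (simp add: norm_divide divide_simps)
qed

text \<open>In the coordinate s = e^w the factor \<open>exp w\<close> is ds/dw, and it cancels the
  derivative of the denominator, so the residue at \<open>w0\<close> is \<open>G w0\<close>. The
  bound pi on \<open>Im w0\<close> makes \<open>w0\<close> the only zero of the denominator in the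
  strip. The minus sign arises because the rectangle is traversed with its lower side running to the
  right.\<close>

theorem strip_Cauchy_formula:
  fixes G :: "complex \<Rightarrow> complex"
  assumes G: "G holomorphic_on {w. \<bar>Im w\<bar> < \<theta>}" and \<theta>: "\<theta> \<le> pi" and \<phi>: "0 < \<phi>" "\<phi> < \<theta>"
    and a: "a > 0" and le: "\<And>w. \<bar>Im w\<bar> \<le> \<phi> \<Longrightarrow> norm (G w) \<le> C * edecay a (Re w)"
    and w0: "\<bar>Im w0\<bar> < pi" "\<bar>Im w0\<bar> \<noteq> \<phi>"
  defines "H \<equiv> \<lambda>w. exp w * G w / (exp w - exp w0)"
  shows "((\<lambda>x. H (Complex x \<phi>) - H (Complex x (- \<phi>))) has_integral
     (if \<bar>Im w0\<bar> < \<phi> then - 2 * pi * \<i> * G w0 else 0)) UNIV"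
proof -
  let ?S = "{w. \<bar>Im w\<bar> < \<theta>}"
  define L where "L = (if \<bar>Im w0\<bar> < \<phi> then - 2 * pi * \<i> * G w0 else 0)"
  have C: "C \<ge> 0" using order_trans[OF norm_ge_zero le[of 0]] \<phi> by simp
  note S = open_strip[of \<theta>] convex_strip[of \<theta>]
  have neq: "exp w \<noteq> exp w0" if "w \<in> ?S" "w \<noteq> w0" for w
  proof -
    have "\<bar>Im w - Im w0\<bar> < 2 * pi" using that w0 \<theta> by auto
    then show ?thesis using exp_complex_eqI that by blast
  qed
  have neq': "cos (\<phi> - Im w0) \<noteq> 1" "cos (- \<phi> - Im w0) \<noteq> 1"
    by (rule cos_neq_1; use w0 \<phi> \<theta> in \<open>simp add: abs_if split: if_splits\<close>)+
  have Hhol: "H holomorphic_on (?S - {w0})"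
    unfolding H_def using neq by (intro holomorphic_intros holomorphic_on_subset[OF G]) auto
  have Hcont: "continuous_on (?S - {w0}) H" using Hhol by (rule holomorphic_on_imp_continuous_on)
  have line_cont: "continuous_on UNIV (\<lambda>x. H (Complex x y))" if "\<bar>y\<bar> = \<phi>" for y
    by (rule continuous_on_compose2[OF Hcont, of UNIV "\<lambda>x. Complex x y"])
      (use that \<phi> w0 in \<open>auto simp: Complex_eq intro!: continuous_intros\<close>)
  have line_bound: "\<exists>M. \<forall>x. norm (H (Complex x y)) \<le> M * edecay a x" if "\<bar>y\<bar> = \<phi>" for y
  proof -
    have "cos (y - Im w0) \<noteq> 1" using neq' that by (auto simp: abs_if split: if_splits)
    then obtain c where c: "c > 0" "\<And>w. Im w = y \<Longrightarrow> norm (exp w / (exp w - exp w0)) \<le> c"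
      using exp_kernel_bound[of y "Im w0"] by metis
    have "norm (H (Complex x y)) \<le> c * C * edecay a x" for x
    proof -
      have "norm (H (Complex x y)) = norm (exp (Complex x y) / (exp (Complex x y) - exp w0)) * norm (G (Complex x y))"
        by (simp add: H_def norm_divide norm_mult)
      also have "\<dots> \<le> c * (C * edecay a x)"
        using c(2)[of "Complex x y"] le[of "Complex x y"] that c(1) by (intro mult_mono) auto
      finally show ?thesis by (simp add: mult_ac)
    qed
    then show ?thesis by blast
  qed
  let ?D = "\<lambda>x. H (Complex x \<phi>) - H (Complex x (- \<phi>))"
  have Dint: "?D integrable_on UNIV"
  proof -
    have "(\<lambda>x. H (Complex x y)) integrable_on UNIV" if "\<bar>y\<bar> = \<phi>" for y
      using line_bound[OF that] exp_decay_integrable[OF a line_cont[OF that]] by blast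
    then show ?thesis using \<phi> by (intro integrable_diff) auto
  qed
  have side: "norm (H w) \<le> 2 * C * edecay a (Re w)"
    if "\<bar>Im w\<bar> \<le> \<phi>" "\<bar>Re w - Re w0\<bar> \<ge> 1" for w
  proof -
    have "norm (H w) = norm (exp w / (exp w - exp w0)) * norm (G w)"
      by (simp add: H_def norm_divide norm_mult)
    also have "\<dots> \<le> 2 * (C * edecay a (Re w))"
      using exp_kernel_bound_far[OF that(2)] le[OF that(1)] by (intro mult_mono) auto
    finally show ?thesis by (simp add: mult_ac)
  qed
  have "(\<lambda>n. integral {- real n..real n} ?D) \<longlonglongrightarrow> L"
  proof -
    \<comment> \<open>The two vertical sides; they have fixed length, and the decay of
      \<open>G\<close> makes their contribution vanish in the limit.\<close>
    define V where "V n = contour_integral (linepath (Complex (real n) (-\<phi>)) (Complex (real n) \<phi>)) H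
      + contour_integral (linepath (Complex (-real n) \<phi>) (Complex (-real n) (-\<phi>))) H" for n
    have ev: "\<forall>\<^sub>F n in sequentially. real n > \<bar>Re w0\<bar> + 1"
      by real_asymp
    have Vlim: "V \<longlonglongrightarrow> 0"
    proof (rule Lim_null_comparison)
      show "\<forall>\<^sub>F n in sequentially. norm (V n) \<le> 2 * (2 * C * exp (- a * real n) * (2 * \<phi>))"
        using ev
      proof eventually_elim
        case (elim n)
        have b: "norm (contour_integral (linepath (Complex x c) (Complex x d)) H)
            \<le> 2 * C * exp (- a * real n) * (2 * \<phi>)"
          if "\<bar>x\<bar> = real n" "c = -\<phi> \<and> d = \<phi> \<or> c = \<phi> \<and> d = -\<phi>" for x c d
        proof -
          have *: "\<bar>Im w\<bar> \<le> \<phi>" "Re w = x" if "w \<in> closed_segment (Complex x c) (Complex x d)" for w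
            using that \<open>c = -\<phi> \<and> d = \<phi> \<or> c = \<phi> \<and> d = -\<phi>\<close> \<phi>
            by (auto simp: closed_segment_same_Re closed_segment_eq_real_ivl split: if_splits)
          have far: "\<bar>Re w - Re w0\<bar> \<ge> 1" if "w \<in> closed_segment (Complex x c) (Complex x d)" for w
            using *[OF that] elim \<open>\<bar>x\<bar> = real n\<close> by linarith
          have bd: "norm (H w) \<le> 2 * C * exp (- a * real n)"
            if "w \<in> closed_segment (Complex x c) (Complex x d)" for w
            using side[OF *(1)[OF that] far[OF that]] *(2)[OF that] \<open>\<bar>x\<bar> = real n\<close> by simp
          have "closed_segment (Complex x c) (Complex x d) \<subseteq> ?S - {w0}"
            using * far \<phi> by force
          then have "H contour_integrable_on linepath (Complex x c) (Complex x d)"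
            by (intro contour_integrable_continuous_linepath continuous_on_subset[OF Hcont])
          then have "norm (contour_integral (linepath (Complex x c) (Complex x d)) H)
             \<le> 2 * C * exp (- a * real n) * norm (Complex x d - Complex x c)"
            using C bd by (intro contour_integral_bound_linepath) auto
          also have "norm (Complex x d - Complex x c) = 2 * \<phi>"
            using that \<phi> by (auto simp: complex_diff cmod_def)
          finally show ?thesis .
        qed
        show ?case
          unfolding V_def
          using norm_triangle_le[OF add_mono[OF b[of "real n" "-\<phi>" \<phi>] b[of "-real n" \<phi> "-\<phi>"]]] by (simp add: mult_ac)
      qed
      show "(\<lambda>n. 2 * (2 * C * exp (- a * real n) * (2 * \<phi>))) \<longlonglongrightarrow> 0"
        using a by real_asymp
    qed
    have ev2: "\<forall>\<^sub>F n in sequentially. L + V n = integral {- real n..real n} ?D"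
      using ev
    proof eventually_elim
      case (elim n)
      let ?p = "rectpath (Complex (-real n) (-\<phi>)) (Complex (real n) \<phi>)"
      have sub: "path_image ?p \<subseteq> ?S - {w0}"
        using elim \<phi> w0 by (subst path_image_rectpath) auto
      \<comment> \<open>If \<open>w0\<close> lies outside the rectangle, even outside the strip, its
        winding number is 0, so one residue sum covers both cases.\<close>
      have res: "contour_integral ?p H = 2 * pi * \<i> * (\<Sum>p\<in>{w0}. winding_number ?p p * residue H p)"
      proof (rule Residue_theorem[OF S(1) convex_connected[OF S(2)] _ Hhol])
        show "\<forall>z. z \<notin> ?S \<longrightarrow> winding_number ?p z = 0"
          using \<phi> by (intro allI impI winding_number_rectpath_outside) (auto simp: in_cbox_complex_iff)
      qed (use sub in auto)
      have "winding_number ?p w0 * residue H w0 = (if \<bar>Im w0\<bar> < \<phi> then G w0 else 0)"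
      proof (cases "\<bar>Im w0\<bar> < \<phi>")
        case True
        then have "winding_number ?p w0 = 1"
          using elim by (intro winding_number_rectpath) (auto simp: in_box_complex_iff)
        moreover have "residue H w0 = G w0"
        proof (rule residue_simple'[OF S(1) _ Hhol])
          show "w0 \<in> ?S" using True \<phi> by simp
          have "((\<lambda>w. (exp w - exp w0) / (w - w0)) \<longlongrightarrow> exp w0) (at w0)"
            using DERIV_exp[of w0] by (simp add: has_field_derivative_iff)
          then have "((\<lambda>w. exp w * G w * inverse ((exp w - exp w0) / (w - w0))) \<longlongrightarrow> exp w0 * G w0 * inverse (exp w0)) (at w0)"
            using G S(1) \<open>w0 \<in> ?S\<close>
            by (intro tendsto_intros) (auto simp: isCont_def[symmetric] intro: continuous_on_interior
              holomorphic_on_imp_continuous_on  simp: interior_open)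
          then show "((\<lambda>w. H w * (w - w0)) \<longlongrightarrow> G w0) (at w0)"
            by (simp add: H_def field_simps)
        qed
        ultimately show ?thesis using True by simp
      next
        case False
        then have "winding_number ?p w0 = 0"
          using w0 \<phi> by (intro winding_number_rectpath_outside) (auto simp: in_cbox_complex_iff)
        then show ?thesis using False by simp
      qed
      then have "contour_integral ?p H = - L" unfolding res L_def by simp
      moreover have "contour_integral ?p H =
          integral {- real n..real n} (\<lambda>x. H (Complex x (-\<phi>)) - H (Complex x \<phi>)) + V n"
        unfolding V_def using \<phi> elim sub
        by (subst contour_integral_rectpath) (auto intro: continuous_on_subset[OF Hcont])
      moreover have "integral {- real n..real n} (\<lambda>x. H (Complex x (-\<phi>)) - H (Complex x \<phi>)) =
          - integral {- real n..real n} ?D"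
        by (subst integral_neg[symmetric]) simp
      ultimately show ?case by (simp add: algebra_simps)
    qed
    have "(\<lambda>n. L + V n) \<longlonglongrightarrow> L"
      using tendsto_add[OF tendsto_const Vlim, of L] by simp
    then show ?thesis using ev2 by (rule Lim_transform_eventually)
  qed
  from LIMSEQ_unique[OF integral_symmetric_tendsto[OF Dint] this] integrable_integral[OF Dint]
  show ?thesis unfolding L_def by (simp only:)
qed

section \<open>Quaternions and slices\<close>

lemma Quat_nth [simp]:
  "Quat a b c d $ 0 = a" "Quat a b c d $ 1 = b" "Quat a b c d $ 2 = c" "Quat a b c d $ 3 = d"
  by (simp_all add: Quat_def)

lemma quat_eq_iff: "p = q \<longleftrightarrow> p$0 = q$0 \<and> p$1 = q$1 \<and> p$2 = q$2 \<and> p$3 = (q$3::real)" for p q :: quat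
proof -
  \<comment> \<open>\<open>forall_4\<close> enumerates the indices as 1, 2, 3, 4, whereas the real
    part is stored at index 0, which is the same element of the index type.\<close>
  have "(4::4) = 0" by simp
  show ?thesis unfolding vec_eq_iff forall_4 \<open>(4::4) = 0\<close> by auto
qed

lemma norm_quat: "norm q = sqrt ((q$0)\<^sup>2 + (q$1)\<^sup>2 + (q$2)\<^sup>2 + (q$3)\<^sup>2)" for q :: quat
proof -
  have "(4::4) = 0" by simp
  show ?thesis unfolding norm_vec_def L2_set_def sum_4 \<open>(4::4) = 0\<close> by (simp add: add_ac)
qed

lemma qmul_nth [simp]:
  "qmul p q $ 0 = p$0*q$0 - p$1*q$1 - p$2*q$2 - p$3*q$3"
  "qmul p q $ 1 = p$0*q$1 + p$1*q$0 + p$2*q$3 - p$3*q$2"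
  "qmul p q $ 2 = p$0*q$2 - p$1*q$3 + p$2*q$0 + p$3*q$1"
  "qmul p q $ 3 = p$0*q$3 + p$1*q$2 - p$2*q$1 + p$3*q$0"
  by (simp_all add: qmul_def)

lemma qreal_nth [simp]: "qreal r $ 0 = r" "qreal r $ 1 = 0" "qreal r $ 2 = 0" "qreal r $ 3 = 0"
  by (simp_all add: qreal_def)

lemma qcnj_nth [simp]: "qcnj q $ 0 = q$0" "qcnj q $ 1 = - q$1" "qcnj q $ 2 = - q$2" "qcnj q $ 3 = - q$3"
  by (simp_all add: qcnj_def)

lemma qmul_assoc: "qmul (qmul p q) r = qmul p (qmul q r)"
  by (simp add: quat_eq_iff algebra_simps)

lemma qmul_add_left: "qmul (p + q) r = qmul p r + qmul q r"
  and qmul_add_right: "qmul p (q + r) = qmul p q + qmul p r"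
  and qmul_minus_left: "qmul (- p) r = - qmul p r"
  and qmul_scaleR_left: "qmul (c *\<^sub>R p) r = c *\<^sub>R qmul p r"
  and qmul_scaleR_right: "qmul p (c *\<^sub>R r) = c *\<^sub>R qmul p r"
  by (simp_all add: quat_eq_iff algebra_simps)

lemma qmul_qreal: "qmul (qreal r) q = r *\<^sub>R q" "qmul q (qreal r) = r *\<^sub>R q"
  by (simp_all add: quat_eq_iff)

lemma qmul_0 [simp]: "qmul 0 q = 0" "qmul q 0 = 0"
  by (simp_all add: quat_eq_iff)

lemma qmul_sum_right: "qmul p (\<Sum>i\<in>I. q i) = (\<Sum>i\<in>I. qmul p (q i))"
  by (induction I rule: infinite_finite_induct) (auto simp: qmul_add_right)

lemma norm_qreal [simp]: "norm (qreal r) = \<bar>r\<bar>"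
  by (simp add: norm_quat)

lemma qe_simps: "qe 0 = qreal 1" "qe (Suc 0) = Quat 0 1 0 0" "qe 2 = Quat 0 0 1 0" "qe 3 = Quat 0 0 0 1"
  by (simp_all add: qe_def qreal_def)

lemma sum_lessThan_4: "(\<Sum>i<4. f i) = f 0 + f (Suc 0) + f 2 + f 3" for f :: "nat \<Rightarrow> 'a::comm_monoid_add"
  by (simp add: eval_nat_numeral add_ac)

text \<open>For an imaginary unit \<open>J\<close> this is the algebra isomorphism from the complex
  numbers onto the slice of \<open>J\<close>, through which complex analysis is transported.\<close>

definition qc :: "quat \<Rightarrow> complex \<Rightarrow> quat" where
  "qc J z = qreal (Re z) + Im z *\<^sub>R J"

lemma imag_units_D:
  fixes J :: quat
  assumes "J \<in> imag_units" shows "J $ 0 = 0" "(J$1)\<^sup>2 + (J$2)\<^sup>2 + (J$3)\<^sup>2 = 1" "norm J = 1"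
  using assms by (auto simp: imag_units_def norm_quat real_sqrt_eq_1_iff)

lemma imag_unit_square: "J \<in> imag_units \<Longrightarrow> qmul J J = qreal (- 1)"
  using imag_units_D[of J] by (simp add: quat_eq_iff power2_eq_square)

lemma imag_units_uminus: "J \<in> imag_units \<Longrightarrow> - J \<in> imag_units"
  by (simp add: imag_units_def)

lemma qc_add: "qc J (z + w) = qc J z + qc J w" and qc_minus: "qc J (- z) = - qc J z"
  and qc_of_real: "qc J (of_real r) = qreal r" and qc_ii: "qc J \<i> = J"
  and qc_0 [simp]: "qc J 0 = 0" and qc_scaleR: "qc J (r *\<^sub>R z) = r *\<^sub>R qc J z"
  and qc_cnj: "qc (- J) z = qc J (cnj z)"
  by (simp_all add: qc_def quat_eq_iff algebra_simps)

lemma qc_mult: "J \<in> imag_units \<Longrightarrow> qc J (z * w) = qmul (qc J z) (qc J w)"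
  using imag_units_D[of J] by (simp add: qc_def quat_eq_iff algebra_simps power2_eq_square) algebra

lemma norm_qc: "J \<in> imag_units \<Longrightarrow> norm (qc J z) = norm z"
proof -
  assume J: "J \<in> imag_units"
  have "(Im z * J$1)\<^sup>2 + (Im z * J$2)\<^sup>2 + (Im z * J$3)\<^sup>2 = (Im z)\<^sup>2 * ((J$1)\<^sup>2 + (J$2)\<^sup>2 + (J$3)\<^sup>2)"
    by (simp add: power_mult_distrib algebra_simps)
  then show ?thesis using imag_units_D[OF J] by (simp add: norm_quat qc_def cmod_def add.assoc)
qed

lemma qc_nth_0: "J \<in> imag_units \<Longrightarrow> qc J z $ 0 = Re z"
  by (simp add: qc_def imag_units_D)

lemma qexpJ_eq: "qexpJ J \<phi> = qc J (cis \<phi>)"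
  by (simp add: qexpJ_def qc_def)

lemma qinv_imag_unit: "J \<in> imag_units \<Longrightarrow> qinv J = - J"
  using imag_units_D[of J] by (simp add: qinv_def quat_eq_iff)

lemma ex_imag_unit: "\<exists>J. J \<in> imag_units"
  by (rule exI[of _ "Quat 0 1 0 0"]) (simp add: imag_units_def norm_quat)

lemma quat_eq_qc: "\<exists>J\<in>imag_units. \<exists>z. q = qc J z"
proof (cases "q - qreal (q$0) = 0")
  case True
  obtain J where "J \<in> imag_units" using ex_imag_unit by blast
  moreover have "q = qc J (of_real (q$0))" using True by (simp add: qc_of_real)
  ultimately show ?thesis by blast
next
  case False
  define J where "J = (1 / norm (q - qreal (q$0))) *\<^sub>R (q - qreal (q$0))"
  have "J \<in> imag_units" using False by (simp add: imag_units_def J_def)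
  moreover have "q = qc J (Complex (q$0) (norm (q - qreal (q$0))))"
    using False by (simp add: qc_def J_def)
  ultimately show ?thesis by blast
qed

text \<open>Cosine decreases on [0, pi], so comparing arguments amounts to comparing
  \<open>Re z\<close> with \<open>norm z * cos \<theta>\<close>. This form makes closures and
  interiors accessible; the strict inequality also excludes the origin.\<close>

lemma qc_in_sector_iff:
  assumes J: "J \<in> imag_units" and \<theta>: "0 < \<theta>" "\<theta> \<le> pi"
  shows "qc J z \<in> sector \<theta> \<longleftrightarrow> norm z * cos \<theta> < Re z"
proof
  assume "qc J z \<in> sector \<theta>"
  then obtain r J' \<phi> where r: "r > 0" "J' \<in> imag_units" "\<bar>\<phi>\<bar> < \<theta>" "qc J z = r *\<^sub>R qexpJ J' \<phi>"
    by (auto simp: sector_def)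
  then have eq: "qc J z = qc J' (r *\<^sub>R cis \<phi>)" by (simp add: qexpJ_eq qc_scaleR)
  have "norm z = r" using norm_qc[OF J, of z] norm_qc[OF r(2), of "r *\<^sub>R cis \<phi>"] r(1) eq by simp
  moreover have "Re z = r * cos \<phi>" using qc_nth_0[OF J, of z] qc_nth_0[OF r(2), of "r *\<^sub>R cis \<phi>"] eq by simp
  moreover have "cos \<theta> < cos \<bar>\<phi>\<bar>" using r(3) \<theta> by (intro cos_monotone_0_pi) auto
  ultimately show "norm z * cos \<theta> < Re z" using r(1) by simp
next
  assume *: "norm z * cos \<theta> < Re z"
  then have z: "z \<noteq> 0" by auto
  have pol: "z = norm z *\<^sub>R cis (Arg z)" using rcis_cmod_Arg[of z] by (simp add: rcis_def scaleR_conv_of_real)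
  have "Re z = norm z * cos (Arg z)" using arg_cong[OF pol, of Re] unfolding scaleR_complex.simps cis.simps .
  then have "cos \<theta> < cos \<bar>Arg z\<bar>" using * z by simp
  then have "\<bar>Arg z\<bar> < \<theta>"
    using cos_monotone_0_pi_le[of \<theta> "\<bar>Arg z\<bar>"] \<theta> Arg_bounded[of z] by (smt (verit))
  moreover have "qc J z = norm z *\<^sub>R qexpJ J (Arg z)" unfolding qexpJ_eq qc_scaleR[symmetric] pol[symmetric] ..
  ultimately show "qc J z \<in> sector \<theta>"
    unfolding sector_def using z J
    by (intro CollectI exI[of _ "norm z"] conjI bexI[of _ J] exI[of _ "Arg z"]) simp_all
qed

lemma closure_sector_subset:
  assumes "0 < \<omega>" "\<omega> \<le> pi"
  shows "closure (sector \<omega>) \<subseteq> {s. norm s * cos \<omega> \<le> s $ 0}"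
proof (rule closure_minimal)
  show "sector \<omega> \<subseteq> {s. norm s * cos \<omega> \<le> s $ 0}"
  proof
    fix s :: quat assume s: "s \<in> sector \<omega>"
    obtain J z where J: "J \<in> imag_units" and z: "s = qc J z" using quat_eq_qc by blast
    then show "s \<in> {s. norm s * cos \<omega> \<le> s $ 0}"
      using s qc_in_sector_iff[OF J assms, of z] by (simp add: norm_qc qc_nth_0)
  qed
  show "closed {s::quat. norm s * cos \<omega> \<le> s $ 0}"
    by (intro closed_Collect_le continuous_intros)
qed

section \<open>Left multiplication on the two-sided space and its restriction to a slice\<close>

locale quat_banach =
  fixes lm :: "quat \<Rightarrow> 'v::banach \<Rightarrow> 'v" and rm :: "'v \<Rightarrow> quat \<Rightarrow> 'v"
  assumes V: "two_sided_banach lm rm"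
begin

lemma lm_add_left: "lm (a + b) v = lm a v + lm b v"
  and lm_add: "lm a (v + w) = lm a v + lm a w"
  and lm_lm: "lm a (lm b v) = lm (qmul a b) v"
  and lm_qreal: "lm (qreal r) v = r *\<^sub>R v"
  and norm_lm: "norm (lm a v) \<le> norm a * norm v"
  using V by (auto simp: two_sided_banach_def)

lemma lm_scaleR_left: "lm (r *\<^sub>R a) v = r *\<^sub>R lm a v"
  using lm_lm[of "qreal r" a v] by (simp add: qmul_qreal lm_qreal)

lemma lm_scaleR: "lm a (r *\<^sub>R v) = r *\<^sub>R lm a v"
  using lm_lm[of a "qreal r" v] by (simp add: qmul_qreal lm_qreal lm_scaleR_left)

lemma bounded_bilinear_lm: "bounded_bilinear lm"
  by (rule bounded_bilinear.intro)
    (auto simp: lm_add_left lm_add lm_scaleR_left lm_scaleR intro!: exI[of _ 1] norm_lm)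

sublocale lm: bounded_bilinear lm
  by (rule bounded_bilinear_lm)

lemma lm_imag_unit: "J \<in> imag_units \<Longrightarrow> lm J (lm J v) = - v"
  by (simp add: lm_lm imag_unit_square lm_qreal)

lemma lm_one: "lm (qe 0) v = v"
  by (simp add: qe_simps lm_qreal)

end

locale quat_slice = quat_banach lm rm for lm :: "quat \<Rightarrow> 'v::banach \<Rightarrow> 'v" and rm +
  fixes J :: quat
  assumes J: "J \<in> imag_units"
begin

text \<open>The scalar multiplication of the complex Banach space that left multiplication by the
  slice of \<open>J\<close> makes of the underlying space.\<close>

definition cs :: "complex \<Rightarrow> 'v \<Rightarrow> 'v" where
  "cs c v = lm (qc J c) v"

lemma cs_cs: "cs c (cs d v) = cs (c * d) v"
  by (simp add: cs_def lm_lm qc_mult J)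

lemma cs_of_real: "cs (of_real r) v = r *\<^sub>R v"
  by (simp add: cs_def qc_of_real lm_qreal)

lemma cs_1 [simp]: "cs 1 v = v"
  using cs_of_real[of 1 v] by simp

lemma norm_cs: "norm (cs c v) \<le> norm c * norm v"
  using norm_lm[of "qc J c" v] by (simp add: cs_def norm_qc J)

lemma bounded_bilinear_cs: "bounded_bilinear cs"
  by (rule bounded_bilinear.intro)
    (auto simp: cs_def qc_add lm_add_left lm_add qc_scaleR lm_scaleR_left lm_scaleR
      intro!: exI[of _ 1] norm_cs[unfolded cs_def, THEN order_trans])

sublocale cs: bounded_bilinear cs
  by (rule bounded_bilinear_cs)

lemma cs_expand: "cs c v = Re c *\<^sub>R v + Im c *\<^sub>R lm J v"
  by (simp add: cs_def qc_def lm_add_left lm_qreal lm_scaleR_left)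

text \<open>The derivative in the vertical direction of the
  truncated line integral is the difference of the values at the two ends.\<close>
lemma integral_horizontal_lines_eq:
  assumes y: "y1 \<le> y2" and a: "a > 0"
    and H: "\<And>w. y1 \<le> Im w \<Longrightarrow> Im w \<le> y2 \<Longrightarrow> (H has_derivative (\<lambda>d. cs d (H' w))) (at w)"
    and cont: "continuous_on {w. y1 \<le> Im w \<and> Im w \<le> y2} H'"
    and le: "\<And>w. y1 \<le> Im w \<Longrightarrow> Im w \<le> y2 \<Longrightarrow> norm (H w) \<le> M * edecay a (Re w)"
  shows "integral UNIV (\<lambda>x. H (Complex x y1)) = integral UNIV (\<lambda>x. H (Complex x y2))"
proof -
  have Hcont: "continuous_on UNIV (\<lambda>x. H (Complex x y))" if "y1 \<le> y" "y \<le> y2" for y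
  proof -
    have "continuous_on {w. y1 \<le> Im w \<and> Im w \<le> y2} H"
      using H by (intro continuous_at_imp_continuous_on ballI has_derivative_continuous) auto
    then show ?thesis
      by (rule continuous_on_compose2) (use that in \<open>auto simp: Complex_eq intro!: continuous_intros\<close>)
  qed
  have Hint: "(\<lambda>x. H (Complex x y)) integrable_on UNIV" if "y1 \<le> y" "y \<le> y2" for y
    using le[of "Complex _ y"] that by (intro exp_decay_integrable[OF a Hcont, of _ M]) auto
  define A where "A n y = integral {- real n..real n} (\<lambda>x. H (Complex x y))" for n y
  have dy: "((\<lambda>y. H (Complex x y)) has_vector_derivative cs \<i> (H' (Complex x y))) (at y within S)"
    if "y1 \<le> y" "y \<le> y2" for x y S
  proof -
    have "((\<lambda>y. Complex x y) has_vector_derivative \<i>) (at y within S)"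
      unfolding Complex_eq by (auto intro!: derivative_eq_intros)
    then show ?thesis
      using diff_chain_within[of "\<lambda>y. Complex x y" "\<lambda>r. r *\<^sub>R \<i>" y S H "\<lambda>d. cs d (H' (Complex x y))"]
        has_derivative_at_withinI[OF H[of "Complex x y"]] that
      by (simp add: has_vector_derivative_def o_def cs.scaleR_left)
  qed
  have dx: "((\<lambda>x. H (Complex x y)) has_vector_derivative H' (Complex x y)) (at x within S)"
    if "y1 \<le> y" "y \<le> y2" for x y S
  proof -
    have "((\<lambda>x. Complex x y) has_vector_derivative 1) (at x within S)"
      unfolding Complex_eq by (auto intro!: derivative_eq_intros)
    then show ?thesis
      using diff_chain_within[of "\<lambda>x. Complex x y" "\<lambda>r. r *\<^sub>R 1" x S H "\<lambda>d. cs d (H' (Complex x y))"]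
        has_derivative_at_withinI[OF H[of "Complex x y"]] that
      by (simp add: has_vector_derivative_def o_def cs.scaleR_left)
  qed
  have dA: "(A n has_vector_derivative cs \<i> (H (Complex (real n) y) - H (Complex (- real n) y))) (at y within {y1..y2})"
    if "y \<in> {y1..y2}" for n y
  proof -
    have "((\<lambda>x. cs \<i> (H' (Complex x y))) has_integral
        (cs \<i> (H (Complex (real n) y)) - cs \<i> (H (Complex (- real n) y)))) {- real n..real n}"
      using that
      by (intro fundamental_theorem_of_calculus) (auto intro!: bounded_linear.has_vector_derivative[OF cs.bounded_linear_right] dx)
    then have "integral (cbox (- real n) (real n)) (\<lambda>x. cs \<i> (H' (Complex x y)))
        = cs \<i> (H (Complex (real n) y) - H (Complex (- real n) y))"
      by (simp add: integral_unique cs.diff_right)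
    moreover have "(A n has_vector_derivative integral (cbox (- real n) (real n)) (\<lambda>x. cs \<i> (H' (Complex x y))))
        (at y within {y1..y2})"
      unfolding A_def box_real(2)[of "- real n" "real n", symmetric]
    proof (rule leibniz_rule_vector_derivative[where U="{y1..y2}"])
      have "continuous_on ({y1..y2} \<times> cbox (- real n) (real n)) (\<lambda>p. H' (Complex (snd p) (fst p)))"
        by (rule continuous_on_compose2[OF cont]) (auto simp: Complex_eq intro!: continuous_intros)
      then show "continuous_on ({y1..y2} \<times> cbox (- real n) (real n)) (\<lambda>(y, x). cs \<i> (H' (Complex x y)))"
        by (auto simp: case_prod_beta intro!: cs.continuous_on continuous_intros)
    qed (use that dy in \<open>auto intro!: integrable_continuous_interval continuous_on_subset[OF Hcont]\<close>)
    ultimately show ?thesis by simp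
  qed
  \<comment> \<open>The end values, hence the derivative in \<open>y\<close>, are of size exp (- a
    n) uniformly in \<open>y\<close>; the mean value inequality then brings the two truncated
    integrals together.\<close>
  have nA: "norm (A n y1 - A n y2) \<le> 2 * M * exp (- a * real n) * (y2 - y1)" for n
  proof -
    have "norm (A n y1 - A n y2) \<le> 2 * M * exp (- a * real n) * norm (y1 - y2)"
    proof (rule differentiable_bound[where S="{y1..y2}" and f'="\<lambda>y h. h *\<^sub>R cs \<i> (H (Complex (real n) y) - H (Complex (- real n) y))"])
      fix y assume y: "y \<in> {y1..y2}"
      show "(A n has_derivative (\<lambda>h. h *\<^sub>R cs \<i> (H (Complex (real n) y) - H (Complex (- real n) y)))) (at y within {y1..y2})"
        using dA[OF y] by (simp add: has_vector_derivative_def)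
      have "norm (cs \<i> (H (Complex (real n) y) - H (Complex (- real n) y)))
          \<le> norm (H (Complex (real n) y)) + norm (H (Complex (- real n) y))"
        using norm_cs[of \<i>] norm_triangle_ineq4 order_trans by fastforce
      also have "\<dots> \<le> 2 * M * exp (- a * real n)"
        using le[of "Complex (real n) y"] le[of "Complex (- real n) y"] y by simp
      finally show "onorm (\<lambda>h. h *\<^sub>R cs \<i> (H (Complex (real n) y) - H (Complex (- real n) y))) \<le> 2 * M * exp (- a * real n)"
        by (subst onorm_scaleR_left) (auto simp: onorm_id bounded_linear_ident)
    qed (use y in auto)
    then show ?thesis using y by simp
  qed
  have "(\<lambda>n. 2 * M * exp (- a * real n) * (y2 - y1)) \<longlonglongrightarrow> 0"
    using a by real_asymp
  then have "(\<lambda>n. A n y1 - A n y2) \<longlonglongrightarrow> 0"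
    by (rule Lim_null_comparison[rotated]) (intro always_eventually allI nA)
  moreover have "(\<lambda>n. A n y1 - A n y2) \<longlonglongrightarrow> integral UNIV (\<lambda>x. H (Complex x y1)) - integral UNIV (\<lambda>x. H (Complex x y2))"
    unfolding A_def
    using tendsto_diff[OF integral_symmetric_tendsto[OF Hint[of y1]] integral_symmetric_tendsto[OF Hint[of y2]]] y
    by simp
  ultimately have "integral UNIV (\<lambda>x. H (Complex x y1)) - integral UNIV (\<lambda>x. H (Complex x y2)) = 0"
    using LIMSEQ_unique[of "\<lambda>n. A n y1 - A n y2"] by metis
  then show ?thesis by simp
qed

end

section \<open>Operators with commuting components\<close>

text \<open>Applied to \<open>K + N\<close> and \<open>K - N\<close>, the S-resolvents of the
  operator and of its conjugate, and to the values of a slice function at two conjugate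
  points.\<close>

lemma norm_add_diff_bounds:
  fixes k n :: "'a::real_normed_vector"
  shows "2 * norm k \<le> norm (k + n) + norm (k - n)" "2 * norm n \<le> norm (k + n) + norm (k - n)"
  using norm_triangle_ineq[of "k + n" "k - n"] norm_triangle_ineq4[of "k + n" "k - n"]
  by (simp_all add: scaleR_2[symmetric])

text \<open>A map that is already onto has no injective extension to a larger set.\<close>

lemma bij_betw_UNIV_extension_eq:
  assumes "bij_betw f A UNIV" "bij_betw g B UNIV" "A \<subseteq> B" "\<And>x. x \<in> A \<Longrightarrow> f x = g x"
  shows "A = B"
proof
  show "B \<subseteq> A"
  proof
    fix b assume b: "b \<in> B"
    obtain a where a: "a \<in> A" "f a = g b" using assms(1) by (metis bij_betw_def UNIV_I imageE)
    then have "g a = g b" using assms(4) by simp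
    then have "a = b" using assms(2,3) a b by (meson bij_betw_def inj_onD subsetD)
    then show "b \<in> A" using a by simp
  qed
qed fact

lemma qmul_qe:
  "qmul (qe (Suc 0)) (qe (Suc 0)) = - qe 0" "qmul (qe 2) (qe 2) = - qe 0" "qmul (qe 3) (qe 3) = - qe 0"
  "qmul (qe (Suc 0)) (qe 2) = qe 3" "qmul (qe 2) (qe (Suc 0)) = - qe 3"
  "qmul (qe 2) (qe 3) = qe (Suc 0)" "qmul (qe 3) (qe 2) = - qe (Suc 0)"
  "qmul (qe 3) (qe (Suc 0)) = qe 2" "qmul (qe (Suc 0)) (qe 3) = - qe 2"
  by (simp_all add: qe_simps quat_eq_iff)

lemma qcnj_qe: "qcnj (qe 0) = qe 0" "qcnj (qe (Suc 0)) = - qe (Suc 0)" "qcnj (qe 2) = - qe 2" "qcnj (qe 3) = - qe 3"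
  by (simp_all add: qe_simps quat_eq_iff)

lemma conjc_conjc: "conjc (conjc Tc) = Tc"
  by (auto simp: conjc_def)

locale quat_op = quat_banach lm rm for lm :: "quat \<Rightarrow> 'v::banach \<Rightarrow> 'v" and rm +
  fixes D :: "'v set" and Tc :: "nat \<Rightarrow> 'v \<Rightarrow> 'v" and \<omega> :: real
  assumes T: "KC lm rm D Tc"
    and \<omega>: "0 < \<omega>" "\<omega> < pi"
    and typeT: "of_type lm D Tc \<omega>"
    and typeTbar: "of_type lm D (conjc Tc) \<omega>"
begin

section \<open>Domains and linearity of the components\<close>

abbreviation "D2 \<equiv> dom2 lm D Tc"

lemma D_0: "0 \<in> D" and D_add: "v \<in> D \<Longrightarrow> w \<in> D \<Longrightarrow> v + w \<in> D" and D_lm: "v \<in> D \<Longrightarrow> lm a v \<in> D"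
  using T by (auto simp: KC_def two_sided_subspace_def)

lemma D_scaleR: "v \<in> D \<Longrightarrow> r *\<^sub>R v \<in> D"
  using D_lm[of v "qreal r"] by (simp add: lm_qreal)

lemma D_minus: "v \<in> D \<Longrightarrow> - v \<in> D"
  using D_scaleR[of v "-1"] by simp

lemma D_diff: "v \<in> D \<Longrightarrow> w \<in> D \<Longrightarrow> v - w \<in> D"
  using D_add[of v "- w"] D_minus by simp

lemma D_sum: "(\<And>i. i \<in> I \<Longrightarrow> f i \<in> D) \<Longrightarrow> (\<Sum>i\<in>I. f i) \<in> D"
  by (induction I rule: infinite_finite_induct) (auto intro: D_0 D_add)

lemmas D_intros = D_0 D_add D_lm D_scaleR D_minus D_diff D_sum

lemma Tc_add: "i < 4 \<Longrightarrow> v \<in> D \<Longrightarrow> w \<in> D \<Longrightarrow> Tc i (v + w) = Tc i v + Tc i w"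
  and Tc_lm: "i < 4 \<Longrightarrow> v \<in> D \<Longrightarrow> Tc i (lm a v) = lm a (Tc i v)"
  using T by (auto simp: KC_def two_sided_linear_on_def)

lemma Tc_scaleR: "i < 4 \<Longrightarrow> v \<in> D \<Longrightarrow> Tc i (r *\<^sub>R v) = r *\<^sub>R Tc i v"
  using Tc_lm[of i v "qreal r"] by (simp add: lm_qreal)

lemma Tc_minus: "i < 4 \<Longrightarrow> v \<in> D \<Longrightarrow> Tc i (- v) = - Tc i v"
  using Tc_scaleR[of i v "-1"] by simp

lemma Tc_0: "i < 4 \<Longrightarrow> Tc i 0 = 0"
  using Tc_scaleR[of i 0 0] by (simp add: D_0)

lemma Tc_diff: "i < 4 \<Longrightarrow> v \<in> D \<Longrightarrow> w \<in> D \<Longrightarrow> Tc i (v - w) = Tc i v - Tc i w"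
  using Tc_add[of i v "- w"] by (simp add: Tc_minus D_minus)

lemma Tc_sum: "i < 4 \<Longrightarrow> (\<And>k. k \<in> I \<Longrightarrow> f k \<in> D) \<Longrightarrow> Tc i (\<Sum>k\<in>I. f k) = (\<Sum>k\<in>I. Tc i (f k))"
  by (induction I rule: infinite_finite_induct) (auto simp: Tc_0 Tc_add D_sum)

lemmas Tc_linear = Tc_add Tc_lm Tc_scaleR Tc_minus Tc_diff Tc_sum

text \<open>The inclusion of dom(T^2) in every dom(T_i T_j) allows a condition on the single vector
  T v to be read component by component.\<close>

lemma D2_iff: "v \<in> D2 \<longleftrightarrow> v \<in> D \<and> (\<forall>j<4. Tc j v \<in> D)"
proof
  assume "v \<in> D2"
  then show "v \<in> D \<and> (\<forall>j<4. Tc j v \<in> D)" using T by (auto simp: KC_def dom2_def)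
next
  assume "v \<in> D \<and> (\<forall>j<4. Tc j v \<in> D)"
  then show "v \<in> D2" unfolding dom2_def qop_def by (auto intro!: D_intros)
qed

lemma D2_D: "v \<in> D2 \<Longrightarrow> v \<in> D" and D2_Tc: "v \<in> D2 \<Longrightarrow> j < 4 \<Longrightarrow> Tc j v \<in> D"
  by (auto simp: D2_iff)

lemma Tc_commute: "v \<in> D2 \<Longrightarrow> i < 4 \<Longrightarrow> j < 4 \<Longrightarrow> Tc i (Tc j v) = Tc j (Tc i v)"
  using T by (auto simp: KC_def)

lemma D2_add: "v \<in> D2 \<Longrightarrow> w \<in> D2 \<Longrightarrow> v + w \<in> D2" and D2_lm: "v \<in> D2 \<Longrightarrow> lm a v \<in> D2"
  and D2_scaleR: "v \<in> D2 \<Longrightarrow> r *\<^sub>R v \<in> D2" and D2_diff: "v \<in> D2 \<Longrightarrow> w \<in> D2 \<Longrightarrow> v - w \<in> D2"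
  and D2_minus: "v \<in> D2 \<Longrightarrow> - v \<in> D2"
  unfolding D2_iff by (auto simp: Tc_linear intro!: D_intros)

definition TT :: "'v \<Rightarrow> 'v" where
  "TT v = (\<Sum>i<4. Tc i (Tc i v))"

lemma Qcs_eq: "Qcs lm Tc s v = lm (qmul s s) v - lm (2 *\<^sub>R s) (Tc 0 v) + TT v"
  by (simp add: Qcs_def TT_def)

lemma TT_add: "v \<in> D2 \<Longrightarrow> w \<in> D2 \<Longrightarrow> TT (v + w) = TT v + TT w"
  and TT_lm: "v \<in> D2 \<Longrightarrow> TT (lm a v) = lm a (TT v)"
  by (simp_all add: TT_def D2_D D2_Tc Tc_linear sum.distrib lm.sum_right)

lemma Qcs_add: "v \<in> D2 \<Longrightarrow> w \<in> D2 \<Longrightarrow> Qcs lm Tc s (v + w) = Qcs lm Tc s v + Qcs lm Tc s w"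
  by (simp add: Qcs_eq TT_add D2_D Tc_linear lm_add)

lemma Qcs_lm: "v \<in> D2 \<Longrightarrow> qmul a s = qmul s a \<Longrightarrow> Qcs lm Tc s (lm a v) = lm a (Qcs lm Tc s v)"
proof -
  assume v: "v \<in> D2" and comm: "qmul a s = qmul s a"
  have "qmul (qmul s s) a = qmul a (qmul s s)" by (metis comm qmul_assoc)
  then show ?thesis
    by (simp add: Qcs_eq TT_lm v D2_D Tc_linear lm_lm lm_add lm.diff_right comm qmul_scaleR_left qmul_scaleR_right)
qed

lemma D2_subset_conj: "D2 \<subseteq> dom2 lm D (conjc Tc)"
proof
  fix v assume "v \<in> D2"
  then have "v \<in> D" "\<forall>j<4. Tc j v \<in> D" using D2_iff by blast+
  then show "v \<in> dom2 lm D (conjc Tc)" by (auto simp: dom2_def qop_def conjc_def intro!: D_intros)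
qed

lemma Qcs_conj: "v \<in> D2 \<Longrightarrow> Qcs lm (conjc Tc) s v = Qcs lm Tc s v"
  by (auto simp: Qcs_def conjc_def sum_lessThan_4 D2_Tc Tc_minus)

text \<open>The points outside the closed sector, hence in the S-resolvent sets of both the operator
  and its conjugate.\<close>

definition reg :: "quat \<Rightarrow> bool" where
  "reg s \<longleftrightarrow> s $ 0 < norm s * cos \<omega>"

lemma reg_rhoS: "reg s \<Longrightarrow> bij_betw (Qcs lm Tc s) D2 UNIV"
  "reg s \<Longrightarrow> bij_betw (Qcs lm (conjc Tc) s) (dom2 lm D (conjc Tc)) UNIV"
  using closure_sector_subset[of \<omega>] \<omega> typeT typeTbar
  by (force simp: reg_def of_type_def sigmaS_def rhoS_def)+

text \<open>A priori the square of the conjugate may have a larger domain; a common point of the two resolvent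
  sets excludes this.\<close>
lemma D2_conj_eq: "dom2 lm D (conjc Tc) = D2"
proof -
  \<comment> \<open>The negative axis avoids every closed sector of angle below pi, so -1 serves as
    the common point.\<close>
  have "reg (qreal (-1))" using cos_monotone_0_pi[of \<omega> pi] \<omega> by (simp add: reg_def)
  then show ?thesis
    using bij_betw_UNIV_extension_eq[OF reg_rhoS D2_subset_conj] Qcs_conj by metis
qed

lemma Qinv_conj: "Qinv lm D (conjc Tc) s = Qinv lm D Tc s"
  unfolding Qinv_def the_inv_into_def D2_conj_eq using Qcs_conj
  by (intro ext arg_cong[where f=The]) auto

section \<open>The inverse of Q and its commutation with the components\<close>

abbreviation "Qi \<equiv> Qinv lm D Tc"

lemma Qi_D2: "reg s \<Longrightarrow> Qi s v \<in> D2"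
  unfolding Qinv_def using reg_rhoS(1)[of s] by (auto simp: bij_betw_def intro: the_inv_into_into)

lemma Qcs_Qi: "reg s \<Longrightarrow> Qcs lm Tc s (Qi s v) = v"
  unfolding Qinv_def using reg_rhoS(1)[of s] by (auto simp: bij_betw_def intro: f_the_inv_into_f)

lemma Qi_Qcs: "reg s \<Longrightarrow> u \<in> D2 \<Longrightarrow> Qi s (Qcs lm Tc s u) = u"
  unfolding Qinv_def using reg_rhoS(1)[of s] by (auto simp: bij_betw_def intro: the_inv_into_f_f)

lemma Qi_D: "reg s \<Longrightarrow> Qi s v \<in> D" "reg s \<Longrightarrow> i < 4 \<Longrightarrow> Tc i (Qi s v) \<in> D"
  using Qi_D2 D2_D D2_Tc by auto

lemma Qi_add: "reg s \<Longrightarrow> Qi s (v + w) = Qi s v + Qi s w"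
  using Qi_Qcs[of s "Qi s v + Qi s w"] by (simp add: Qcs_add Qi_D2 D2_add Qcs_Qi)

lemma Qi_lm: "reg s \<Longrightarrow> qmul a s = qmul s a \<Longrightarrow> Qi s (lm a v) = lm a (Qi s v)"
  using Qi_Qcs[of s "lm a (Qi s v)"] by (simp add: Qcs_lm Qi_D2 D2_lm Qcs_Qi)

lemma Qi_scaleR: "reg s \<Longrightarrow> Qi s (r *\<^sub>R v) = r *\<^sub>R Qi s v"
  using Qi_lm[of s "qreal r" v] by (simp add: qmul_qreal lm_qreal)

lemma linear_Qi: "reg s \<Longrightarrow> linear (Qi s)"
  by (rule linearI) (auto simp: Qi_add Qi_scaleR)

lemmas Qi_linear = Qi_add Qi_scaleR linear_diff[OF linear_Qi] linear_neg[OF linear_Qi] linear_sum[OF linear_Qi]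

lemma qop_eq: "qop lm Tc v = Tc 0 v + (lm (qe (Suc 0)) (Tc (Suc 0) v) + lm (qe 2) (Tc 2 v) + lm (qe 3) (Tc 3 v))"
  by (simp add: qop_def sum_lessThan_4 lm_one add_ac)

definition Tv :: "'v \<Rightarrow> 'v" where
  "Tv v = lm (qe (Suc 0)) (Tc (Suc 0) v) + lm (qe 2) (Tc 2 v) + lm (qe 3) (Tc 3 v)"

lemma qop_Tv: "qop lm Tc v = Tc 0 v + Tv v"
  by (simp add: qop_eq Tv_def)

lemma qop_conj_Tv: "qop lm (conjc Tc) v = Tc 0 v - Tv v"
  by (simp add: qop_def sum_lessThan_4 lm_one conjc_def Tv_def lm.minus_right)

lemma Tv_add: "v \<in> D \<Longrightarrow> w \<in> D \<Longrightarrow> Tv (v + w) = Tv v + Tv w"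
  and Tv_scaleR: "v \<in> D \<Longrightarrow> Tv (r *\<^sub>R v) = r *\<^sub>R Tv v"
  by (simp_all add: Tv_def Tc_linear lm_add lm_scaleR algebra_simps)

text \<open>The mixed terms cancel because the components commute and the imaginary units anticommute.\<close>
lemma Tv_Tv: "u \<in> D2 \<Longrightarrow> Tv (Tv u) = Tc 0 (Tc 0 u) - TT u"
  using Tc_commute[of u "Suc 0" 2] Tc_commute[of u "Suc 0" 3] Tc_commute[of u 2 3]
  by (simp add: Tv_def TT_def sum_lessThan_4 Tc_linear D2_Tc D_intros lm_add lm_lm qmul_qe lm_one lm.minus_left)

lemma Tv_D: "u \<in> D2 \<Longrightarrow> Tv u \<in> D"
  by (simp add: Tv_def D_intros D2_Tc)

lemma Tc0_Tv: "u \<in> D2 \<Longrightarrow> Tc 0 (Tv u) = Tv (Tc 0 u)"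
  using Tc_commute[of u 0] by (simp add: Tv_def Tc_linear D_intros D2_Tc)

text \<open>If \<open>\<bar>T\<bar>\<^sup>2 u\<close> stays in the domain then \<open>T u\<close> lies in the domain of the square of the conjugate,
  which is the domain of \<open>T\<^sup>2\<close>.\<close>
lemma D2_Tc_D2:
  assumes u: "u \<in> D2" and TTu: "TT u \<in> D" and i: "i < 4"
  shows "Tc i u \<in> D2"
proof -
  let ?y = "qop lm Tc u"
  have y: "?y \<in> D" using u by (simp add: dom2_def)
  have "qop lm (conjc Tc) ?y = TT u"
  proof -
    have D: "Tc 0 u \<in> D" "Tv u \<in> D" using u by (auto intro: D2_Tc Tv_D)
    have "Tc 0 (Tc 0 u + Tv u) = Tc 0 (Tc 0 u) + Tv (Tc 0 u)"
      using Tc_add[of 0, OF _ D] Tc0_Tv[OF u] by simp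
    moreover have "Tv (Tc 0 u + Tv u) = Tv (Tc 0 u) + (Tc 0 (Tc 0 u) - TT u)"
      using Tv_add[OF D] Tv_Tv[OF u] by simp
    ultimately show ?thesis unfolding qop_conj_Tv qop_Tv by simp
  qed
  then have "?y \<in> dom2 lm D (conjc Tc)" using TTu y by (auto simp: dom2_def)
  then have "?y \<in> D2" by (simp only: D2_conj_eq)
  then have "Tc i ?y \<in> D" using i by (rule D2_Tc)
  \<comment> \<open>Moving \<open>T_i\<close> through T shows that T maps \<open>T_i u\<close> into
    the domain, the remaining condition for \<open>Tc i u \<in> D2\<close>.\<close>
  moreover have "Tc i ?y = qop lm Tc (Tc i u)"
  proof -
    have "Tc i ?y = (\<Sum>j<4. Tc i (lm (qe j) (Tc j u)))"
      unfolding qop_def using u i by (intro Tc_sum) (auto intro: D_lm D2_Tc)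
    also have "\<dots> = (\<Sum>j<4. lm (qe j) (Tc j (Tc i u)))"
    proof (rule sum.cong[OF refl])
      fix j :: nat assume "j \<in> {..<4}"
      then have j: "j < 4" by simp
      show "Tc i (lm (qe j) (Tc j u)) = lm (qe j) (Tc j (Tc i u))"
        unfolding Tc_lm[OF i D2_Tc[OF u j]] Tc_commute[OF u i j] ..
    qed
    finally show ?thesis by (simp add: qop_def)
  qed
  ultimately show ?thesis using D2_Tc[OF u i] by (simp add: dom2_def)
qed

text \<open>The equation Q_s u = v, solved for |T|^2 u, shows that this vector lies in the domain as
  soon as \<open>v\<close> does.\<close>

lemma Tc_Qi_D2:
  assumes s: "reg s" and v: "v \<in> D" and i: "i < 4"
  shows "Tc i (Qi s v) \<in> D2"
proof (rule D2_Tc_D2[OF Qi_D2[OF s] _ i])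
  have "TT (Qi s v) = v - lm (qmul s s) (Qi s v) + lm (2 *\<^sub>R s) (Tc 0 (Qi s v))"
    using Qcs_Qi[OF s, of v] by (simp add: Qcs_eq algebra_simps)
  also have "\<dots> \<in> D" using v s by (intro D_intros Qi_D) auto
  finally show "TT (Qi s v) \<in> D" .
qed

text \<open>The delicate point is the third-order identity |T|^2 T_i u = T_i |T|^2 u: it exchanges
  components twice, once at \<open>u\<close> and once at \<open>T_j u\<close>, so
  \<open>T_j u\<close> must itself lie in \<open>D2\<close>.\<close>

lemma Tc_Qi:
  assumes s: "reg s" and v: "v \<in> D" and i: "i < 4"
  shows "Tc i (Qi s v) = Qi s (Tc i v)"
proof -
  define u where "u = Qi s v"
  have Tu: "Tc j u \<in> D2" if "j < 4" for j
    using that s v by (auto simp: u_def Tc_Qi_D2)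
  have u2: "u \<in> D2" by (simp add: u_def Qi_D2 s)
  have "Tc j (Tc j (Tc i u)) = Tc i (Tc j (Tc j u))" if "j < 4" for j
    using Tc_commute[OF u2 that i] Tc_commute[OF Tu[OF that] that i] by simp
  moreover have "Tc i (TT u) = (\<Sum>j<4. Tc i (Tc j (Tc j u)))"
    unfolding TT_def by (rule Tc_sum[OF i]) (auto intro: D2_Tc Tu)
  moreover have TT_D: "TT u \<in> D" unfolding TT_def by (intro D_sum) (auto intro: D2_Tc Tu)
  ultimately have "TT (Tc i u) = Tc i (TT u)" by (simp add: TT_def)
  then have "Qcs lm Tc s (Tc i u) = Tc i (Qcs lm Tc s u)"
    using i u2 Tu Tc_commute[OF u2 i, of 0]
    by (simp add: Qcs_eq Tc_linear D_intros D2_Tc D2_D TT_D)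
  then have "Qi s (Tc i (Qcs lm Tc s u)) = Tc i u"
    using Qi_Qcs[OF s Tu[OF i]] by simp
  then show ?thesis by (simp add: u_def Qcs_Qi s)
qed

section \<open>The parts of the S-resolvents and their decay\<close>

definition Kq :: "quat \<Rightarrow> 'v \<Rightarrow> 'v" where
  "Kq s v = lm s (Qi s v) - Tc 0 (Qi s v)"

definition Nq :: "quat \<Rightarrow> 'v \<Rightarrow> 'v" where
  "Nq s v = Tv (Qi s v)"

text \<open>The counterpart of \<open>Nq\<close> in the right S-resolvent. The units act before the
  inverse of Q, which in general does not commute with them; on the domain this is
  \<open>Qi s (Tv v)\<close>.\<close>

definition Nq' :: "quat \<Rightarrow> 'v \<Rightarrow> 'v" where
  "Nq' s v = Tc (Suc 0) (Qi s (lm (qe (Suc 0)) v)) + Tc 2 (Qi s (lm (qe 2) v)) + Tc 3 (Qi s (lm (qe 3) v))"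

lemma SLinv_eq: "SLinv lm D Tc s v = Kq s v + Nq s v"
  by (simp add: SLinv_def qop_conj_Tv Kq_def Nq_def)

lemma SLinv_conj_eq: "SLinv lm D (conjc Tc) s v = Kq s v - Nq s v"
  by (simp add: SLinv_def conjc_conjc qop_Tv Kq_def Nq_def Qinv_conj)

lemma SRinv_eq: "reg s \<Longrightarrow> SRinv lm D Tc s v = Kq s v + Nq' s v"
  by (simp add: SRinv_def Kq_def Nq'_def sum_lessThan_4 qcnj_qe lm_one lm.minus_left Qi_linear Tc_linear Qi_D)

lemma SRinv_conj_eq: "reg s \<Longrightarrow> SRinv lm D (conjc Tc) s v = Kq s v - Nq' s v"
  by (simp add: SRinv_def Kq_def Nq'_def sum_lessThan_4 qcnj_qe lm_one lm.minus_left Qi_linear Tc_linear Qi_D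
      conjc_def[of Tc] Qinv_conj)

text \<open>This expresses \<open>Q\<^sup>-\<^sup>1\<close> through the two resolvents of \<open>T\<close> and of its conjugate,
  whence the quadratic decay of \<open>Q\<^sup>-\<^sup>1\<close>.\<close>
lemma Qi_eq_Kq_Nq: "reg s \<Longrightarrow> Qi s v = Kq s (Kq s v) - Nq' s (Nq s v)"
proof -
  assume s: "reg s"
  define u where "u = Qi s v"
  have u: "u \<in> D2" and uD: "u \<in> D" and Tu: "\<And>i. i < 4 \<Longrightarrow> Tc i u \<in> D"
    using s by (auto simp: u_def Qi_D2 Qi_D)
  have com: "Qi s (lm s w) = lm s (Qi s w)" for w by (rule Qi_lm[OF s]) simp
  have 1: "Kq s w = Qi s (lm s w - Tc 0 w)" if "w \<in> D" for w
    using that s by (simp add: Kq_def Qi_linear com Tc_Qi)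
  have "Kq s v = lm s u - Tc 0 u" by (simp add: Kq_def u_def)
  moreover have "lm s u - Tc 0 u \<in> D" using uD Tu by (intro D_intros) auto
  moreover have "lm s (lm s u - Tc 0 u) - Tc 0 (lm s u - Tc 0 u)
      = lm (qmul s s) u - 2 *\<^sub>R lm s (Tc 0 u) + Tc 0 (Tc 0 u)"
    using uD Tu by (simp add: Tc_linear D_intros lm.diff_right lm_lm scaleR_2 algebra_simps)
  ultimately have K: "Kq s (Kq s v) = Qi s (lm (qmul s s) u - 2 *\<^sub>R lm s (Tc 0 u) + Tc 0 (Tc 0 u))"
    by (simp only: 1)
  have "Nq s v = Tv u" by (simp add: Nq_def u_def)
  \<comment> \<open>In this order the two factors \<open>Tv\<close> meet directly, without a unit
    having to cross the inverse of Q.\<close>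
  moreover have "Nq' s w = Qi s (Tv w)" if "w \<in> D" for w
    using that s by (simp add: Nq'_def Tv_def Tc_Qi D_intros Qi_linear Tc_linear)
  ultimately have N: "Nq' s (Nq s v) = Qi s (Tc 0 (Tc 0 u) - TT u)"
    using Tv_D[OF u] Tv_Tv[OF u] by simp
  \<comment> \<open>By \<open>Tv_Tv\<close>, (s - T_0)^2 - Tv^2 = s^2 - 2 s T_0 + |T|^2, which is
    Q_s itself.\<close>
  have "Kq s (Kq s v) - Nq' s (Nq s v) = Qi s (Qcs lm Tc s u)"
    unfolding K N linear_diff[OF linear_Qi[OF s], symmetric] by (simp add: Qcs_eq lm_scaleR_left)
  also have "\<dots> = u" by (rule Qi_Qcs[OF s u])
  finally show ?thesis by (simp add: u_def)
qed

lemma resolvent_bounds: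
  assumes \<phi>: "\<omega> < \<phi>" "\<phi> < pi"
  obtains C where "C > 0" "\<And>s v. (s::quat) \<noteq> 0 \<Longrightarrow> s $ 0 \<le> norm s * cos \<phi> \<Longrightarrow> reg s \<and>
     norm (Kq s v) \<le> C / norm s * norm v \<and> norm (Nq s v) \<le> C / norm s * norm v
     \<and> norm (Qi s v) \<le> C / (norm s)\<^sup>2 * norm v"
proof -
  have cos: "cos \<phi> < cos \<omega>" using \<omega> \<phi> by (intro cos_monotone_0_pi) auto
  obtain C1 where C1: "\<And>s v. s \<notin> sector \<phi> \<Longrightarrow> s \<noteq> 0 \<Longrightarrow> norm (SLinv lm D Tc s v) \<le> C1 / norm s * norm v"
    "\<And>s v. s \<notin> sector \<phi> \<Longrightarrow> s \<noteq> 0 \<Longrightarrow> norm (SRinv lm D Tc s v) \<le> C1 / norm s * norm v"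
    using typeT \<phi> unfolding of_type_def by meson
  obtain C2 where C2: "\<And>s v. s \<notin> sector \<phi> \<Longrightarrow> s \<noteq> 0 \<Longrightarrow> norm (SLinv lm D (conjc Tc) s v) \<le> C2 / norm s * norm v"
    "\<And>s v. s \<notin> sector \<phi> \<Longrightarrow> s \<noteq> 0 \<Longrightarrow> norm (SRinv lm D (conjc Tc) s v) \<le> C2 / norm s * norm v"
    using typeTbar \<phi> unfolding of_type_def by meson
  \<comment> \<open>The 1 gives \<open>B \<ge> 1\<close> and hence
    \<open>B \<le> 2 * B\<^sup>2\<close>, so the constant \<open>2 * B\<^sup>2\<close>, coming from
    the two products in \<open>Qi_eq_Kq_Nq\<close>, also bounds \<open>Kq\<close> and
    \<open>Nq\<close>.\<close>
  define B where "B = \<bar>C1\<bar> + \<bar>C2\<bar> + 1"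
  have half: "norm k \<le> B / r * x \<and> norm n \<le> B / r * x"
    if "norm (k + n) \<le> C1 / r * x" "norm (k - n) \<le> C2 / r * x" "r > 0" "x \<ge> 0" for k n :: 'v and r x
  proof -
    have "C1 / r * x \<le> B / r * x" "C2 / r * x \<le> B / r * x"
      using that(3,4) by (auto intro!: mult_right_mono divide_right_mono simp: B_def)
    then have "norm (k + n) + norm (k - n) \<le> 2 * (B / r * x)" using that by linarith
    moreover note norm_add_diff_bounds[where k = k and n = n]
    ultimately show ?thesis by linarith
  qed
  have B: "B \<ge> 1" by (simp add: B_def)
  have *: "reg s \<and> norm (Kq s v) \<le> B / norm s * norm v \<and> norm (Nq s v) \<le> B / norm s * norm v \<and> norm (Nq' s v) \<le> B / norm s * norm v"
    if s: "s \<noteq> 0" "s $ 0 \<le> norm s * cos \<phi>" for s :: quat and v :: 'v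
  proof -
    have "norm s * cos \<phi> < norm s * cos \<omega>" using s cos by simp
    then have reg: "reg s" using s unfolding reg_def by linarith
    have "s \<notin> sector \<phi>"
    proof -
      obtain J z where J: "J \<in> imag_units" and z: "s = qc J z" using quat_eq_qc by blast
      then show ?thesis using qc_in_sector_iff[OF J, of \<phi> z] s \<phi> \<omega> by (simp add: norm_qc qc_nth_0)
    qed
    then show ?thesis
      using reg s(1) half[of "Kq s v" "Nq s v" "norm s" "norm v"] half[of "Kq s v" "Nq' s v" "norm s" "norm v"]
        C1[of s v] C2[of s v]
      by (simp add: SLinv_eq SLinv_conj_eq SRinv_eq SRinv_conj_eq)
  qed
  show thesis
  proof (rule that[of "2 * B\<^sup>2"])
    show "2 * B\<^sup>2 > 0" using B by simp
    have B2: "B \<le> 2 * B\<^sup>2" using B mult_mono[of 1 B 1 B] mult_right_mono[of 1 B B] by (simp add: power2_eq_square)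
    fix s :: quat and v :: 'v assume s: "s \<noteq> 0" "s $ 0 \<le> norm s * cos \<phi>"
    have mono: "B / norm s * norm v \<le> 2 * B\<^sup>2 / norm s * norm v"
      using B2 by (intro mult_right_mono divide_right_mono) auto
    have "norm (Qi s v) \<le> norm (Kq s (Kq s v)) + norm (Nq' s (Nq s v))"
      using *[OF s] norm_triangle_ineq4 by (simp add: Qi_eq_Kq_Nq)
    also have "\<dots> \<le> B / norm s * (B / norm s * norm v) + B / norm s * (B / norm s * norm v)"
    proof -
      have "B / norm s * x \<le> B / norm s * (B / norm s * norm v)" if "x \<le> B / norm s * norm v" for x
        using B by (intro mult_left_mono that) auto
      then show ?thesis
        using *[OF s, of v] *[OF s, of "Kq s v"] *[OF s, of "Nq s v"] by (meson add_mono order_trans)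
    qed
    also have "\<dots> = 2 * B\<^sup>2 / (norm s)\<^sup>2 * norm v"
      by (simp add: power2_eq_square)
    finally show "reg s \<and> norm (Kq s v) \<le> 2 * B\<^sup>2 / norm s * norm v \<and> norm (Nq s v) \<le> 2 * B\<^sup>2 / norm s * norm v
     \<and> norm (Qi s v) \<le> 2 * B\<^sup>2 / (norm s)\<^sup>2 * norm v"
      using *[OF s, of v] mono by linarith
  qed
qed

section \<open>Dependence of the inverse of Q on the imaginary unit\<close>

lemma reg_qc: "J \<in> imag_units \<Longrightarrow> reg (qc J z) \<longleftrightarrow> Re z < norm z * cos \<omega>"
  by (simp add: reg_def norm_qc qc_nth_0)

text \<open>Writing \<open>Q\<^sub>s = E + J F\<close> for \<open>s = x + J y\<close>, where \<open>E\<close> and \<open>F\<close> commute with all quaternions, the inverse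
  has the same form \<open>P + J M\<close> with \<open>P\<close> and \<open>M\<close> independent of \<open>J\<close>.\<close>
lemma Qi_slice:
  assumes z: "Re z < norm z * cos \<omega>"
  obtains P M where "\<And>v. P v \<in> D2" "\<And>v. M v \<in> D2"
    "\<And>J v. J \<in> imag_units \<Longrightarrow> Qi (qc J z) v = P v + lm J (M v)"
proof -
  obtain J0 where J0: "J0 \<in> imag_units" using ex_imag_unit by blast
  define R1 R2 where "R1 = Qi (qc J0 z)" and "R2 = Qi (qc (- J0) z)"
  \<comment> \<open>The solution of \<open>R1 = P + J0 M\<close>, \<open>R2 = P - J0 M\<close>,
    since \<open>- J0\<close> is the inverse of \<open>J0\<close>.\<close>
  define P where "P v = (1/2) *\<^sub>R (R1 v + R2 v)" for v
  define M where "M v = - (1/2) *\<^sub>R lm J0 (R1 v - R2 v)" for v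
  have J0': "- J0 \<in> imag_units" using J0 by (rule imag_units_uminus)
  note JJ = lm_imag_unit
  have reg: "reg (qc J z)" if "J \<in> imag_units" for J using that z by (simp add: reg_qc)
  have D2': "P v \<in> D2" "M v \<in> D2" for v
    unfolding P_def M_def R1_def R2_def using reg[OF J0] reg[OF J0']
    by (auto intro!: D2_add D2_scaleR D2_lm D2_diff D2_minus Qi_D2)
  have R: "R1 v = P v + lm J0 (M v)" "R2 v = P v + lm (- J0) (M v)" for v
  proof -
    have M1: "lm J0 (M v) = (1/2) *\<^sub>R (R1 v - R2 v)"
      unfolding M_def by (simp add: lm_scaleR lm.minus_right JJ J0 scaleR_right_diff_distrib)
    have "(1/2) *\<^sub>R x + (1/2) *\<^sub>R x = x" for x :: 'v by (simp flip: scaleR_left.add)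
    then show "R1 v = P v + lm J0 (M v)" "R2 v = P v + lm (- J0) (M v)"
      by (simp_all add: P_def M1 lm.minus_left scaleR_right_distrib scaleR_right_diff_distrib)
  qed
  define E where "E u = Re (z\<^sup>2) *\<^sub>R u - (2 * Re z) *\<^sub>R Tc 0 u + TT u" for u
  define F where "F u = Im (z\<^sup>2) *\<^sub>R u - (2 * Im z) *\<^sub>R Tc 0 u" for u
  have Q: "Qcs lm Tc (qc J z) (P v + lm J (M v)) = (E (P v) - F (M v)) + lm J (E (M v) + F (P v))"
    if J: "J \<in> imag_units" for J v
  proof -
    have "Qcs lm Tc (qc J z) u = E u + lm J (F u)" if "u \<in> D2" for u
    proof -
      have "qmul (qc J z) (qc J z) = qc J (z\<^sup>2)" using J by (simp add: qc_mult power2_eq_square)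
      then show ?thesis
        by (simp add: Qcs_eq E_def F_def qc_def lm_add_left lm_scaleR_left lm_qreal lm.diff_right lm_scaleR algebra_simps)
    qed
    moreover have "E (P v + lm J (M v)) = E (P v) + lm J (E (M v))" "F (P v + lm J (M v)) = F (P v) + lm J (F (M v))"
      using D2'[of v] by (simp_all add: E_def F_def TT_add TT_lm D2_lm D2_D D_lm Tc_linear lm_add lm.diff_right lm_scaleR algebra_simps)
    ultimately show ?thesis
      using D2'[of v] by (simp add: D2_add D2_lm lm_add JJ J)
  qed
  \<comment> \<open>Comparing the equations at \<open>J0\<close> and \<open>- J0\<close> leaves
    \<open>E (P v) - F (M v) = v\<close> and \<open>E (M v) + F (P v) = 0\<close>. No unit occurs in
    them, so they yield the inverse for every unit.\<close>
  have "(E (P v) - F (M v)) + lm J0 (E (M v) + F (P v)) = v" for v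
    using Q[OF J0, of v] Qcs_Qi[OF reg[OF J0], of v] R(1)[of v] by (simp add: R1_def)
  moreover have "(E (P v) - F (M v)) - lm J0 (E (M v) + F (P v)) = v" for v
    using Q[OF J0', of v] Qcs_Qi[OF reg[OF J0'], of v] R(2)[of v] by (simp add: R2_def lm.minus_left)
  ultimately have EF: "E (P v) - F (M v) = v" "lm J0 (E (M v) + F (P v)) = 0" for v
  proof -
    have *: "a + b = w \<Longrightarrow> a - b = w \<Longrightarrow> a = w \<and> b = 0" for a b w :: 'v
    proof -
      assume "a + b = w" "a - b = w"
      then have "(a + b) - (a - b) = 0" by simp
      then have "2 *\<^sub>R b = 0" by (simp add: scaleR_2)
      then show ?thesis using \<open>a + b = w\<close> by simp
    qed
    show "E (P v) - F (M v) = v" "lm J0 (E (M v) + F (P v)) = 0"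
      using *[OF \<open>(E (P v) - F (M v)) + lm J0 (E (M v) + F (P v)) = v\<close> \<open>(E (P v) - F (M v)) - lm J0 (E (M v) + F (P v)) = v\<close>] by blast+
  qed
  have EF2: "E (M v) + F (P v) = 0" for v
    using JJ[OF J0] EF(2)[of v] by (metis lm.zero_right neg_equal_0_iff_equal)
  have "Qi (qc J z) v = P v + lm J (M v)" if J: "J \<in> imag_units" for J v
    using Qi_Qcs[OF reg[OF J], of "P v + lm J (M v)"] Q[OF J, of v] D2'[of v]
    by (simp add: EF EF2 D2_add D2_lm lm.zero_right)
  with D2' that show thesis by blast
qed

text \<open>Two conjugate points with conjugate weights: the joint contribution of the two boundary
  rays to the integrand of W.\<close>

definition Qpair :: "quat \<Rightarrow> complex \<Rightarrow> complex \<Rightarrow> 'v \<Rightarrow> 'v" where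
  "Qpair J z c v = Qi (qc J z) (lm (qc J c) v) + Qi (qc J (cnj z)) (lm (qc J (cnj c)) v)"

text \<open>With \<open>Qi (qc J z) = P + J M\<close> the pair becomes 2 (Re c P - Im c M), from
  which \<open>J\<close> has disappeared. Both claims follow, the second because \<open>P\<close>
  and \<open>M\<close> commute with all quaternions.\<close>

lemma Qpair_props:
  assumes z: "Re z < norm z * cos \<omega>" and J: "J \<in> imag_units"
  shows Qpair_indep: "J' \<in> imag_units \<Longrightarrow> Qpair J' z c v = Qpair J z c v"
    and Qpair_lm: "Qpair J z c (lm a v) = lm a (Qpair J z c v)"
proof -
  obtain P M where PM: "\<And>v. P v \<in> D2" "\<And>v. M v \<in> D2"
    "\<And>J v. J \<in> imag_units \<Longrightarrow> Qi (qc J z) v = P v + lm J (M v)"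
    using Qi_slice[OF z] by blast
  have reg: "reg (qc J z)" if "J \<in> imag_units" for J using that z by (simp add: reg_qc)
  note JJ = lm_imag_unit
  have half: "a = a' \<and> b = b'" if "a + b = a' + b'" "a - b = a' - b'" for a b a' b' :: 'v
  proof -
    have "2 *\<^sub>R a = (a + b) + (a - b)" "2 *\<^sub>R a' = (a' + b') + (a' - b')" by (simp_all add: scaleR_2)
    then have "2 *\<^sub>R a = 2 *\<^sub>R a'" using that by simp
    then show ?thesis using that by simp
  qed
  \<comment> \<open>\<open>Qi_lm\<close> gives commutation with \<open>J\<close> only at the points
    of the slice of \<open>J\<close>; but \<open>P\<close> and \<open>M\<close> are the same for all
    units, so each unit can be treated in its own slice, at \<open>J\<close> and
    \<open>- J\<close>.\<close>
  have PMJ: "P (lm J v) = lm J (P v) \<and> M (lm J v) = lm J (M v)" if J: "J \<in> imag_units" for J v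
  proof -
    note J' = imag_units_uminus[OF J]
    have c: "qmul J (qc J z) = qmul (qc J z) J" "qmul J (qc (-J) z) = qmul (qc (-J) z) J"
      by (simp_all add: qc_def quat_eq_iff algebra_simps)
    have "P (lm J v) + lm J (M (lm J v)) = lm J (P v) + lm J (lm J (M v))"
      using Qi_lm[OF reg[OF J] c(1), of v] by (simp add: PM(3) J lm_add)
    moreover have "P (lm J v) - lm J (M (lm J v)) = lm J (P v) - lm J (lm J (M v))"
      using Qi_lm[OF reg[OF J'] c(2), of v] by (simp add: PM(3) J' lm_add lm.minus_left lm.diff_right)
    ultimately have *: "P (lm J v) = lm J (P v)" "lm J (M (lm J v)) = lm J (lm J (M v))"
      using half by blast+
    from arg_cong[OF *(2), of "lm J"] have "M (lm J v) = lm J (M v)" by (simp add: JJ J lm.minus_right)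
    with * show ?thesis by blast
  qed
  have lin: "P (v + w) = P v + P w \<and> M (v + w) = M v + M w" for v w
  proof -
    note J' = imag_units_uminus[OF J]
    have "P (v + w) = P v + P w \<and> lm J (M (v + w)) = lm J (M v + M w)"
      using Qi_add[OF reg[OF J], of v w] Qi_add[OF reg[OF J'], of v w]
      by (intro half) (simp_all add: PM(3) J J' lm_add lm.minus_left algebra_simps)
    then show ?thesis using JJ[OF J] by (metis neg_equal_iff_equal)
  qed
  have sc: "P (r *\<^sub>R v) = r *\<^sub>R P v \<and> M (r *\<^sub>R v) = r *\<^sub>R M v" for r v
  proof -
    note J' = imag_units_uminus[OF J]
    have "P (r *\<^sub>R v) = r *\<^sub>R P v \<and> lm J (M (r *\<^sub>R v)) = lm J (r *\<^sub>R M v)"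
      using Qi_scaleR[OF reg[OF J], of r v] Qi_scaleR[OF reg[OF J'], of r v]
      by (intro half) (simp_all add: PM(3) J J' lm_add lm.minus_left lm_scaleR algebra_simps)
    then show ?thesis using JJ[OF J] by (metis neg_equal_iff_equal)
  qed
  have form: "Qpair J z c v = 2 *\<^sub>R (Re c *\<^sub>R P v - Im c *\<^sub>R M v)" if J: "J \<in> imag_units" for J c v
  proof -
    note J' = imag_units_uminus[OF J]
    have e: "lm (qc J c) v = Re c *\<^sub>R v + Im c *\<^sub>R lm J v" "lm (qc J (cnj c)) v = Re c *\<^sub>R v + (- Im c) *\<^sub>R lm J v"
      by (simp_all add: qc_def lm_add_left lm.diff_left lm_qreal lm_scaleR_left)
    show ?thesis
      unfolding Qpair_def e qc_cnj[symmetric, of J z] PM(3)[OF J] PM(3)[OF J']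
        lin[THEN conjunct1] lin[THEN conjunct2] sc[THEN conjunct1] sc[THEN conjunct2]
        PMJ[OF J, THEN conjunct1] PMJ[OF J, THEN conjunct2] scaleR_2
      by (simp add: lin sc PMJ[OF J] lm_add lm.diff_right lm_scaleR lm.minus_left JJ J algebra_simps)
  qed
  show "J' \<in> imag_units \<Longrightarrow> Qpair J' z c v = Qpair J z c v"
    using form J by simp
  have "P (lm a v) = lm a (P v) \<and> M (lm a v) = lm a (M v)" for a v
  proof -
    obtain J z where J: "J \<in> imag_units" and a: "a = qc J z" using quat_eq_qc by blast
    have "lm a v = Re z *\<^sub>R v + Im z *\<^sub>R lm J v" for v
      by (simp add: a qc_def lm_add_left lm_qreal lm_scaleR_left)
    then show ?thesis by (simp add: lin sc PMJ[OF J])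
  qed
  then show "Qpair J z c (lm a v) = lm a (Qpair J z c v)"
    by (simp add: form J lm.diff_right lm_scaleR)
qed

lemma Qpair_D: "Re z < norm z * cos \<omega> \<Longrightarrow> J \<in> imag_units \<Longrightarrow> Qpair J z c v \<in> D"
  unfolding Qpair_def by (intro D_add Qi_D) (simp_all add: reg_qc)

lemma Qpair_Tc: "Re z < norm z * cos \<omega> \<Longrightarrow> J \<in> imag_units \<Longrightarrow> v \<in> D \<Longrightarrow> i < 4 \<Longrightarrow>
    Qpair J z c (Tc i v) = Tc i (Qpair J z c v)"
  unfolding Qpair_def by (simp add: Tc_linear Qi_D reg_qc Tc_Qi D_lm)

lemma Qpair_add: "Re z < norm z * cos \<omega> \<Longrightarrow> J \<in> imag_units \<Longrightarrow> Qpair J z c (v + w) = Qpair J z c v + Qpair J z c w"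
  unfolding Qpair_def by (simp add: lm_add Qi_add reg_qc)

text \<open>A single \<open>Qi\<close> commutes with the components but in general not with the
  units inside \<open>Tv\<close>; the pair commutes with both.\<close>

lemma Qpair_Tv: "Re z < norm z * cos \<omega> \<Longrightarrow> J \<in> imag_units \<Longrightarrow> v \<in> D \<Longrightarrow>
    Qpair J z c (Tv v) = Tv (Qpair J z c v)"
  unfolding Tv_def by (simp add: Qpair_add Qpair_lm Qpair_Tc)

end

section \<open>The calculus of intrinsic functions on a slice\<close>

text \<open>Here \<open>G w = h (e\<^sup>w)\<close> for an intrinsic \<open>h\<close>, and the bound is the decay condition of \<open>\<Psi>\<^sup>Q\<close>.\<close>
definition strip_admissible :: "real \<Rightarrow> (complex \<Rightarrow> complex) \<Rightarrow> bool" where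
  "strip_admissible \<theta> G \<longleftrightarrow> G holomorphic_on {w. \<bar>Im w\<bar> < \<theta>} \<and>
     (\<forall>w. \<bar>Im w\<bar> < \<theta> \<longrightarrow> G (cnj w) = cnj (G w)) \<and>
     (\<exists>a>0. \<exists>C\<ge>0. \<forall>w. \<bar>Im w\<bar> < \<theta> \<longrightarrow>
        norm (G w) \<le> C * exp (min 0 (Re w)) * edecay a (Re w))"

lemma strip_admissibleE:
  assumes "strip_admissible \<theta> G"
  obtains a C where "a > 0" "C \<ge> 0"
    "\<And>w. \<bar>Im w\<bar> < \<theta> \<Longrightarrow> norm (G w) \<le> C * exp (min 0 (Re w)) * edecay a (Re w)"
    "\<And>w. \<bar>Im w\<bar> < \<theta> \<Longrightarrow> norm (G w) \<le> C * edecay a (Re w)"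
proof -
  obtain a C where aC: "a > 0" "C \<ge> 0"
    "\<And>w. \<bar>Im w\<bar> < \<theta> \<Longrightarrow> norm (G w) \<le> C * exp (min 0 (Re w)) * edecay a (Re w)"
    using assms unfolding strip_admissible_def by blast
  have le: "C * exp (min 0 (Re w)) * edecay a (Re w) \<le> C * 1 * edecay a (Re w)" for w
    using aC(2) by (intro mult_right_mono mult_left_mono) auto
  show thesis by (rule that[OF aC]) (use order_trans[OF aC(3) le] in simp_all)
qed

lemma strip_admissible_mult:
  assumes F: "strip_admissible \<theta> F" and G: "strip_admissible \<theta> G"
  shows "strip_admissible \<theta> (\<lambda>w. F w * G w)"
proof -
  obtain a C where F': "a > 0" "C \<ge> 0"
    "\<And>w. \<bar>Im w\<bar> < \<theta> \<Longrightarrow> norm (F w) \<le> C * edecay a (Re w)"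
    using strip_admissibleE[OF F] by metis
  obtain b B where G': "b > 0" "B \<ge> 0"
    "\<And>w. \<bar>Im w\<bar> < \<theta> \<Longrightarrow> norm (G w) \<le> B * exp (min 0 (Re w)) * edecay b (Re w)"
    using strip_admissibleE[OF G] by metis
  have "norm (F w * G w) \<le> (C * B) * exp (min 0 (Re w)) * edecay b (Re w)" if "\<bar>Im w\<bar> < \<theta>" for w
  proof -
    have "edecay a (Re w) \<le> 1" using F'(1) by simp
    then have "norm (F w) \<le> C" using F'(3)[OF that] mult_left_mono[of "edecay a (Re w)" 1 C] F'(2) by simp
    then have "norm (F w) * norm (G w) \<le> C * (B * exp (min 0 (Re w)) * edecay b (Re w))"
      using G'(3)[OF that] F'(2) by (intro mult_mono) auto
    then show ?thesis by (simp add: norm_mult mult_ac)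
  qed
  then show ?thesis using F G F'(2) G'(1,2) unfolding strip_admissible_def
    by (intro conjI exI[of _ b] exI[of _ "C * B"]) (auto intro: holomorphic_on_mult)
qed

text \<open>The boundary rays of the sector are the images of the lines \<open>Im w = \<sigma> \<phi>\<close> with \<open>\<sigma> = \<plusminus>1\<close>, and \<open>kern\<close> is
  \<open>ds J\<^sup>-\<^sup>1 h(s)\<close> in the coordinate \<open>x = Re w\<close>; the sign \<open>\<sigma>\<close> accounts for the orientation.\<close>
definition pt :: "real \<Rightarrow> real \<Rightarrow> real \<Rightarrow> complex" where
  "pt \<phi> \<sigma> x = exp (Complex x (\<sigma> * \<phi>))"

definition kern :: "real \<Rightarrow> (complex \<Rightarrow> complex) \<Rightarrow> real \<Rightarrow> real \<Rightarrow> complex" where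
  "kern \<phi> G \<sigma> x = of_real \<sigma> * \<i> * pt \<phi> \<sigma> x * G (Complex x (\<sigma> * \<phi>))"

lemma norm_pt: "norm (pt \<phi> \<sigma> x) = exp x" and Re_pt: "\<sigma> \<in> {1, -1} \<Longrightarrow> Re (pt \<phi> \<sigma> x) = exp x * cos \<phi>"
  and pt_neq_0 [simp]: "pt \<phi> \<sigma> x \<noteq> 0"
  by (auto simp: pt_def Re_exp)

lemma continuous_Complex: "continuous_on UNIV (\<lambda>x. Complex x y)"
  by (simp add: Complex_eq continuous_intros)

lemma continuous_pt: "continuous_on UNIV (pt \<phi> \<sigma>)"
  unfolding pt_def by (intro continuous_intros continuous_Complex)

lemma continuous_kern:
  assumes "strip_admissible \<theta> G" "\<bar>\<phi>\<bar> < \<theta>" "\<sigma> \<in> {1, -1}"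
  shows "continuous_on UNIV (kern \<phi> G \<sigma>)"
proof -
  have "continuous_on {w. \<bar>Im w\<bar> < \<theta>} G"
    using assms(1) by (auto simp: strip_admissible_def intro: holomorphic_on_imp_continuous_on)
  then have "continuous_on UNIV (\<lambda>x. G (Complex x (\<sigma> * \<phi>)))"
    by (rule continuous_on_compose2) (use assms in \<open>auto intro: continuous_Complex\<close>)
  then show ?thesis unfolding kern_def by (intro continuous_intros continuous_pt)
qed

text \<open>At |s| = e^x the first factor comes from ds, the second from the decay of the function,
  and the bracket from the resolvents, of order |s|^-1 and |s|^-2. Near the origin the additional
  power of |s| in the decay condition compensates for |s|^-2.\<close>

lemma exp_weight: "exp x * exp (min 0 x) * (exp (- x) + exp (- 2 * x)) \<le> 2" for x :: real
proof (cases "x \<ge> 0")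
  case True
  then have "exp x * exp (min 0 x) * (exp (- x) + exp (- 2 * x)) = 1 + exp (- x)"
    by (simp add: min_def algebra_simps flip: exp_add)
  then show ?thesis using True by simp
next
  case False
  then have "exp x * exp (min 0 x) * (exp (- x) + exp (- 2 * x)) = exp x + 1"
    by (simp add: min_def algebra_simps flip: exp_add)
  then show ?thesis using False by simp
qed

locale quat_op_slice = quat_op lm rm D Tc \<omega> + quat_slice lm rm J
  for lm :: "quat \<Rightarrow> 'v::banach \<Rightarrow> 'v" and rm D Tc \<omega> J
begin

section \<open>Resolvent identities, bounds and differentiability on a slice\<close>

abbreviation "Rz z \<equiv> Qi (qc J z)"
abbreviation "Kz z \<equiv> Kq (qc J z)"
abbreviation "Nz z \<equiv> Nq (qc J z)"

text \<open>In slice coordinates, the complement of the open sector without the origin. It contains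
  the path of integration as its boundary, and the resolvent bounds are uniform on it.\<close>

definition Sc :: "real \<Rightarrow> complex set" where
  "Sc \<phi> = {z. z \<noteq> 0 \<and> Re z \<le> norm z * cos \<phi>}"

lemma qc_commute: "qmul (qc J a) (qc J b) = qmul (qc J b) (qc J a)"
  by (metis J mult.commute qc_mult)

lemma Rz_cs: "reg (qc J z) \<Longrightarrow> Rz z (cs c v) = cs c (Rz z v)"
  unfolding cs_def by (rule Qi_lm) (auto intro: qc_commute)

lemma Kz_eq: "Kz z v = cs z (Rz z v) - Tc 0 (Rz z v)"
  by (simp add: Kq_def cs_def)

lemma Tc_cs: "i < 4 \<Longrightarrow> v \<in> D \<Longrightarrow> Tc i (cs c v) = cs c (Tc i v)"
  by (simp add: cs_def Tc_lm)

lemma Kz_cs: "reg (qc J z) \<Longrightarrow> Kz z (cs c v) = cs c (Kz z v)"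
  by (simp add: Kz_eq Rz_cs Tc_cs Qi_D cs.diff_right cs_cs mult.commute)

lemma D_cs: "v \<in> D \<Longrightarrow> cs c v \<in> D"
  by (simp add: cs_def D_lm)

lemma Tv_linear: "v \<in> D \<Longrightarrow> w \<in> D \<Longrightarrow> Tv (v - w) = Tv v - Tv w"
  using Tv_add[of v "- w"] Tv_scaleR[of w "-1"] by (simp add: D_minus)

text \<open>In Q_p - Q_z the term |T|^2 cancels and p^2 - z^2 - 2 (p - z) T_0 remains, with all
  scalars in one commutative slice. The first form is symmetric in the two resolvents and feeds the
  product formula; the second has everything behind \<open>Rz z\<close> and gives continuity and the
  derivative.\<close>

lemma resolvent:
  assumes z: "reg (qc J z)" and p: "reg (qc J p)"
  shows "Rz z v - Rz p v = cs (p - z) (Rz z (Kz p v) + Kz z (Rz p v))"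
    and "Rz z v - Rz p v = Rz z (cs (p - z) (2 *\<^sub>R Kz p v + cs (z - p) (Rz p v)))"
proof -
  define u where "u = Rz p v"
  have u: "u \<in> D2" and uD: "u \<in> D" and Tu: "Tc 0 u \<in> D" by (simp_all add: u_def Qi_D2 Qi_D p)
  define a where "a = Rz z u"
  define b where "b = Rz z (Tc 0 u)"
  have Q: "Qcs lm Tc (qc J s) u = cs (s * s) u - cs (2 * s) (Tc 0 u) + TT u" for s
  proof -
    have "qc J (2 * s) = 2 *\<^sub>R qc J s" using qc_scaleR[of J 2 s] by (simp add: scaleR_conv_of_real)
    then show ?thesis by (simp add: Qcs_eq cs_def qc_mult J)
  qed
  have "Qcs lm Tc (qc J p) u = Qcs lm Tc (qc J z) u + cs (p * p - z * z) u - cs (2 * p - 2 * z) (Tc 0 u)"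
    unfolding Q by (simp add: cs.diff_left)
  then have "v = Qcs lm Tc (qc J z) u + cs (p * p - z * z) u - cs (2 * p - 2 * z) (Tc 0 u)"
    by (simp add: u_def Qcs_Qi p)
  then have "Rz z v = Rz z (Qcs lm Tc (qc J z) u + cs (p * p - z * z) u - cs (2 * p - 2 * z) (Tc 0 u))" by simp
  also have "\<dots> = u + cs (p * p - z * z) a - cs (2 * p - 2 * z) b"
    by (simp add: Qi_linear z Qi_Qcs u Rz_cs a_def b_def)
  finally have "Rz z v - Rz p v = cs (p * p - z * z) a - cs (2 * p - 2 * z) b" by (simp add: u_def)
  then have 1: "Rz z v - Rz p v = cs (p * p) a - cs (z * z) a - (cs p b + cs p b) + (cs z b + cs z b)"
    unfolding cs.diff_left mult_2 cs.add_left by simp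
  have K1: "Rz z (Kz p v) = cs p a - b"
    by (simp add: Kz_eq u_def[symmetric] Qi_linear z Rz_cs a_def b_def)
  have K2: "Kz z (Rz p v) = cs z a - b"
    by (simp add: Kz_eq u_def[symmetric] a_def b_def Tc_Qi z uD)
  show "Rz z v - Rz p v = cs (p - z) (Rz z (Kz p v) + Kz z (Rz p v))"
    unfolding 1 K1 K2 cs.diff_left cs.add_right cs.diff_right cs_cs left_diff_distrib by (simp add: mult.commute)
  have "Rz z (cs (p - z) (2 *\<^sub>R Kz p v + cs (z - p) (Rz p v))) = cs (p - z) ((cs p a - b) + (cs p a - b) + cs (z - p) a)"
  proof -
    have "Rz z (2 *\<^sub>R Kz p v + cs (z - p) (Rz p v)) = 2 *\<^sub>R Rz z (Kz p v) + cs (z - p) (Rz z (Rz p v))"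
      by (simp add: Qi_add Qi_scaleR z Rz_cs)
    also have "Rz z (Rz p v) = a" by (simp add: a_def u_def)
    finally show ?thesis unfolding Rz_cs[OF z] K1 scaleR_2 by simp
  qed
  also have "\<dots> = Rz z v - Rz p v"
    unfolding 1 cs.diff_left cs.add_right cs.diff_right cs_cs left_diff_distrib by (simp add: mult.commute)
  finally show "Rz z v - Rz p v = Rz z (cs (p - z) (2 *\<^sub>R Kz p v + cs (z - p) (Rz p v)))" ..
qed

lemma Sc_bounds:
  assumes "\<omega> < \<phi>" "\<phi> < pi"
  obtains C where "C > 0"
    "\<And>z v. z \<in> Sc \<phi> \<Longrightarrow> reg (qc J z) \<and> norm (Rz z v) \<le> C * (1 / norm z ^ 2) * norm v \<and>
      norm (Kz z v) \<le> C * (1 / norm z) * norm v \<and> norm (Nz z v) \<le> C * (1 / norm z) * norm v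
      \<and> norm (Tc 0 (Rz z v)) \<le> C * (1 / norm z) * norm v"
proof -
  obtain C where C: "C > 0" "\<And>s v. (s::quat) \<noteq> 0 \<Longrightarrow> s $ 0 \<le> norm s * cos \<phi> \<Longrightarrow> reg s \<and>
     norm (Kq s v) \<le> C / norm s * norm v \<and> norm (Nq s v) \<le> C / norm s * norm v
     \<and> norm (Qi s v) \<le> C / (norm s)\<^sup>2 * norm v"
    using resolvent_bounds[OF assms] by blast
  show thesis
  proof (rule that[of "2 * C"])
    show "2 * C > 0" using C by simp
    fix z v assume z: "z \<in> Sc \<phi>"
    have "qc J z \<noteq> 0" using z norm_qc[OF J, of z] by (auto simp: Sc_def)
    then have *: "reg (qc J z)" "norm (Kz z v) \<le> C / norm z * norm v" "norm (Nz z v) \<le> C / norm z * norm v"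
      "norm (Rz z v) \<le> C / (norm z)\<^sup>2 * norm v"
      using C(2)[of "qc J z" v] z by (auto simp: Sc_def norm_qc J qc_nth_0)
    have mono: "x \<le> C / norm z ^ k * norm v \<Longrightarrow> x \<le> 2 * C * (1 / norm z ^ k) * norm v" for x k
      using C(1) by (elim order_trans) (auto intro!: mult_right_mono divide_right_mono)
    \<comment> \<open>\<open>T_0 R_z = z R_z - K_z\<close> is a sum of two bounded terms, which
      explains the doubled constant.\<close>
    have "norm (Tc 0 (Rz z v)) \<le> norm (cs z (Rz z v)) + norm (Kz z v)"
      using norm_triangle_ineq4[of "cs z (Rz z v)" "Kz z v"] by (simp add: Kz_eq)
    also have "\<dots> \<le> norm z * (C / (norm z)\<^sup>2 * norm v) + C / norm z * norm v"
      using *(2,4) by (intro add_mono order_trans[OF norm_cs] mult_left_mono) auto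
    also have "\<dots> = 2 * C * (1 / norm z) * norm v"
      using z by (simp add: Sc_def power2_eq_square)
    finally have "norm (Tc 0 (Rz z v)) \<le> 2 * C * (1 / norm z) * norm v" .
    then show "reg (qc J z) \<and> norm (Rz z v) \<le> 2 * C * (1 / norm z ^ 2) * norm v \<and>
      norm (Kz z v) \<le> 2 * C * (1 / norm z) * norm v \<and> norm (Nz z v) \<le> 2 * C * (1 / norm z) * norm v
      \<and> norm (Tc 0 (Rz z v)) \<le> 2 * C * (1 / norm z) * norm v"
      using * mono[of _ 1] mono[of _ 2] by simp
  qed
qed

lemma Sc_reg: "\<omega> < \<phi> \<Longrightarrow> \<phi> < pi \<Longrightarrow> z \<in> Sc \<phi> \<Longrightarrow> reg (qc J z)"
  using Sc_bounds by metis

text \<open>\<open>L\<close> will be the identity, \<open>Tc 0\<close> or \<open>Tv\<close>. It may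
  be unbounded, so the estimate rests on the bound for \<open>L\<close> after \<open>Rz z\<close>,
  made applicable by the second resolvent identity.\<close>

lemma continuous_on_Sc_resolvent:
  fixes L :: "'v \<Rightarrow> 'v"
  assumes \<phi>: "\<omega> < \<phi>" "\<phi> < pi"
    and L: "\<And>v w. v \<in> D \<Longrightarrow> w \<in> D \<Longrightarrow> L (v - w) = L v - L w"
    and le: "\<And>z v. z \<in> Sc \<phi> \<Longrightarrow> norm (L (Rz z v)) \<le> B * (1 / norm z ^ k) * norm v" and B: "B \<ge> 0"
  shows "continuous_on (Sc \<phi>) (\<lambda>z. L (Rz z v))"
  unfolding continuous_on_def
proof
  fix p assume p: "p \<in> Sc \<phi>"
  have reg: "reg (qc J z)" if "z \<in> Sc \<phi>" for z using Sc_reg[OF \<phi> that] .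
  have "((\<lambda>z. L (Rz z v) - L (Rz p v)) \<longlongrightarrow> 0) (at p within Sc \<phi>)"
  proof (rule Lim_null_comparison)
    have "norm (L (Rz z v) - L (Rz p v)) \<le> B * (1 / norm z ^ k) * (norm (p - z) * (2 * norm (Kz p v) + norm (z - p) * norm (Rz p v)))"
      if z: "z \<in> Sc \<phi>" for z
    proof -
      have "L (Rz z v) - L (Rz p v) = L (Rz z (cs (p - z) (2 *\<^sub>R Kz p v + cs (z - p) (Rz p v))))"
        using resolvent(2)[OF reg[OF z] reg[OF p], of v] L[of "Rz z v" "Rz p v"] by (simp add: Qi_D reg z p)
      then have "norm (L (Rz z v) - L (Rz p v))
          \<le> B * (1 / norm z ^ k) * norm (cs (p - z) (2 *\<^sub>R Kz p v + cs (z - p) (Rz p v)))"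
        using le[OF z] by simp
      moreover have "norm (cs (p - z) (2 *\<^sub>R Kz p v + cs (z - p) (Rz p v)))
          \<le> norm (p - z) * (2 * norm (Kz p v) + norm (z - p) * norm (Rz p v))"
        using norm_cs[of "z - p" "Rz p v"]
        by (intro order_trans[OF norm_cs] mult_left_mono norm_triangle_le) auto
      ultimately show ?thesis using B by (meson mult_left_mono order_trans zero_le_mult_iff zero_le_divide_1_iff zero_le_power norm_ge_zero)
    qed
    then show "\<forall>\<^sub>F z in at p within Sc \<phi>. norm (L (Rz z v) - L (Rz p v))
      \<le> B * (1 / norm z ^ k) * (norm (p - z) * (2 * norm (Kz p v) + norm (z - p) * norm (Rz p v)))"
      by (auto simp: eventually_at_filter)
    have "p \<noteq> 0" using p by (simp add: Sc_def)
    then have "((\<lambda>z. B * (1 / norm z ^ k) * (norm (p - z) * (2 * norm (Kz p v) + norm (z - p) * norm (Rz p v))))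
      \<longlongrightarrow> B * (1 / norm p ^ k) * (norm (p - p) * (2 * norm (Kz p v) + norm (p - p) * norm (Rz p v)))) (at p within Sc \<phi>)"
      by (intro tendsto_intros) auto
    then show "((\<lambda>z. B * (1 / norm z ^ k) * (norm (p - z) * (2 * norm (Kz p v) + norm (z - p) * norm (Rz p v))))
      \<longlongrightarrow> 0) (at p within Sc \<phi>)" by simp
  qed
  then show "((\<lambda>z. L (Rz z v)) \<longlongrightarrow> L (Rz p v)) (at p within Sc \<phi>)" by (simp add: LIM_zero_iff)
qed

lemma continuous_on_Sc:
  assumes \<phi>: "\<omega> < \<phi>" "\<phi> < pi"
  shows "continuous_on (Sc \<phi>) (\<lambda>z. Rz z v)" "continuous_on (Sc \<phi>) (\<lambda>z. Kz z v)"
    "continuous_on (Sc \<phi>) (\<lambda>z. Nz z v)"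
proof -
  obtain C where C: "C > 0"
    "\<And>z v. z \<in> Sc \<phi> \<Longrightarrow> reg (qc J z) \<and> norm (Rz z v) \<le> C * (1 / norm z ^ 2) * norm v \<and>
      norm (Kz z v) \<le> C * (1 / norm z) * norm v \<and> norm (Nz z v) \<le> C * (1 / norm z) * norm v
      \<and> norm (Tc 0 (Rz z v)) \<le> C * (1 / norm z) * norm v"
    using Sc_bounds[OF \<phi>] by metis
  show 1: "continuous_on (Sc \<phi>) (\<lambda>z. Rz z v)"
    by (rule continuous_on_Sc_resolvent[OF \<phi>, where L="\<lambda>v. v" and k=2 and B=C]) (use C in auto)
  show "continuous_on (Sc \<phi>) (\<lambda>z. Nz z v)"
    unfolding Nq_def
    by (rule continuous_on_Sc_resolvent[OF \<phi>, where k=1 and B=C]) (use C in \<open>auto simp: Tv_linear Nq_def[symmetric]\<close>)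
  have "continuous_on (Sc \<phi>) (\<lambda>z. Tc 0 (Rz z v))"
    by (rule continuous_on_Sc_resolvent[OF \<phi>, where k=1 and B=C]) (use C in \<open>auto simp: Tc_linear\<close>)
  then show "continuous_on (Sc \<phi>) (\<lambda>z. Kz z v)"
    unfolding Kz_eq by (intro continuous_intros cs.continuous_on 1)
qed

text \<open>Divided by \<open>p - z\<close>, the second resolvent identity has the limit
  \<open>2 *\<^sub>R Rz p (Kz p v)\<close> as \<open>z\<close> tends to \<open>p\<close>;
  \<open>\<rho>\<close> is the error.\<close>

lemma Rz_has_derivative:
  assumes \<phi>: "\<omega> < \<phi>" "\<phi> < pi" and p: "p \<in> interior (Sc \<phi>)"
  shows "((\<lambda>z. Rz z v) has_derivative (\<lambda>d. cs d (- 2 *\<^sub>R Rz p (Kz p v)))) (at p)"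
proof -
  have pS: "p \<in> Sc \<phi>" using p interior_subset by blast
  have reg: "reg (qc J z)" if "z \<in> Sc \<phi>" for z using Sc_reg[OF \<phi> that] .
  define \<rho> where "\<rho> z = Rz z (2 *\<^sub>R Kz p v) + cs (z - p) (Rz z (Rz p v)) - 2 *\<^sub>R Rz p (Kz p v)" for z
  have "((\<lambda>z. \<rho> z) \<longlongrightarrow> Rz p (2 *\<^sub>R Kz p v) + cs (p - p) (Rz p (Rz p v)) - 2 *\<^sub>R Rz p (Kz p v)) (at p)"
  proof -
    have "isCont (\<lambda>z. Rz z u) p" for u
      using continuous_on_Sc(1)[OF \<phi>, of u] p continuous_on_interior by blast
    then have "((\<lambda>z. Rz z u) \<longlongrightarrow> Rz p u) (at p)" for u by (simp add: isCont_def)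
    then show ?thesis unfolding \<rho>_def by (intro tendsto_intros cs.tendsto)
  qed
  then have \<rho>0: "(\<rho> \<longlongrightarrow> 0) (at p)" by (simp add: Qi_linear reg pS cs.zero_left)
  have eq: "Rz z v - Rz p v - cs (z - p) (- 2 *\<^sub>R Rz p (Kz p v)) = cs (p - z) (\<rho> z)" if "z \<in> Sc \<phi>" for z
  proof -
    have "Rz z v - Rz p v = cs (p - z) (Rz z (2 *\<^sub>R Kz p v) + cs (z - p) (Rz z (Rz p v)))"
      using resolvent(2)[OF reg[OF that] reg[OF pS], of v] by (simp add: Rz_cs reg that Qi_linear)
    moreover have "cs (z - p) (- 2 *\<^sub>R Rz p (Kz p v)) = cs (p - z) (2 *\<^sub>R Rz p (Kz p v))"
      using cs.minus_left[of "p - z" "2 *\<^sub>R Rz p (Kz p v)"] cs.minus_right[of "z - p" "2 *\<^sub>R Rz p (Kz p v)"]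
      by simp
    ultimately show ?thesis by (simp add: \<rho>_def cs.diff_right)
  qed
  have "((\<lambda>z. norm (Rz z v - Rz p v - cs (z - p) (- 2 *\<^sub>R Rz p (Kz p v))) / norm (z - p)) \<longlongrightarrow> 0) (at p)"
  proof (rule Lim_null_comparison)
    have "\<forall>\<^sub>F z in at p. z \<in> Sc \<phi>"
      using eventually_at_in_open'[OF open_interior p] by eventually_elim (use interior_subset in blast)
    then show "\<forall>\<^sub>F z in at p. norm (norm (Rz z v - Rz p v - cs (z - p) (- 2 *\<^sub>R Rz p (Kz p v))) / norm (z - p)) \<le> norm (\<rho> z)"
    proof (eventually_elim)
      case (elim z)
      have "norm (cs (p - z) (\<rho> z)) \<le> norm (z - p) * norm (\<rho> z)"
        using norm_cs[of "p - z" "\<rho> z"] by (simp add: norm_minus_commute)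
      then show ?case unfolding eq[OF elim]
        by (cases "z = p") (auto simp: divide_simps mult_ac)
    qed
    show "((\<lambda>z. norm (\<rho> z)) \<longlongrightarrow> 0) (at p)" using \<rho>0 by (simp add: tendsto_norm_zero)
  qed
  then show ?thesis
    unfolding has_derivative_iff_norm using cs.bounded_linear_left by blast
qed

section \<open>Operators given by integrals over the boundary rays\<close>

abbreviation ray_term :: "(complex \<Rightarrow> 'v \<Rightarrow> 'v) \<Rightarrow> real \<Rightarrow> (complex \<Rightarrow> complex) \<Rightarrow> real \<Rightarrow> 'v \<Rightarrow> real \<Rightarrow> 'v" where
  "ray_term M \<phi> G \<sigma> v x \<equiv> M (pt \<phi> \<sigma> x) (cs (kern \<phi> G \<sigma> x) v)"

text \<open>The common features of \<open>Rz\<close>, \<open>Kz\<close> and \<open>Nz\<close> along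
  the rays: real linearity, growth of order |s|^-1 + |s|^-2 with |s| = e^x, and strong
  continuity.\<close>

definition fam :: "real \<Rightarrow> (complex \<Rightarrow> 'v \<Rightarrow> 'v) \<Rightarrow> bool" where
  "fam \<phi> M \<longleftrightarrow> (\<forall>\<sigma>\<in>{1,-1}. \<forall>x. linear (M (pt \<phi> \<sigma> x))) \<and>
    (\<exists>C\<ge>0. \<forall>\<sigma>\<in>{1,-1}. \<forall>x v. norm (M (pt \<phi> \<sigma> x) v) \<le> C * (exp (- x) + exp (- 2 * x)) * norm v) \<and>
    (\<forall>\<sigma>\<in>{1,-1}. \<forall>v. continuous_on UNIV (\<lambda>x. M (pt \<phi> \<sigma> x) v))"

lemma pt_Sc: "\<sigma> \<in> {1,-1} \<Longrightarrow> pt \<phi> \<sigma> x \<in> Sc \<phi>"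
  by (simp add: Sc_def Re_pt norm_pt)

lemma linear_Kz: "reg (qc J z) \<Longrightarrow> linear (Kz z)"
  by (rule linearI) (auto simp: Kz_eq Qi_linear Tc_linear Qi_D cs.add_right cs.scaleR_right algebra_simps)

lemma linear_Nz: "reg (qc J z) \<Longrightarrow> linear (Nz z)"
  by (rule linearI) (auto simp: Nq_def Qi_linear Tv_add Tv_scaleR Qi_D)

lemma fam_RKN:
  assumes \<phi>: "\<omega> < \<phi>" "\<phi> < pi"
  shows "fam \<phi> Rz" "fam \<phi> Kz" "fam \<phi> Nz"
proof -
  obtain C where C: "C > 0"
    "\<And>z v. z \<in> Sc \<phi> \<Longrightarrow> reg (qc J z) \<and> norm (Rz z v) \<le> C * (1 / norm z ^ 2) * norm v \<and>
      norm (Kz z v) \<le> C * (1 / norm z) * norm v \<and> norm (Nz z v) \<le> C * (1 / norm z) * norm v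
      \<and> norm (Tc 0 (Rz z v)) \<le> C * (1 / norm z) * norm v"
    using Sc_bounds[OF \<phi>] by metis
  have cont: "continuous_on (Sc \<phi>) f \<Longrightarrow> \<sigma> \<in> {1,-1} \<Longrightarrow> continuous_on UNIV (\<lambda>x. f (pt \<phi> \<sigma> x))" for f :: "complex \<Rightarrow> 'v" and \<sigma>
    by (erule continuous_on_compose2[OF _ continuous_pt]) (auto simp: pt_Sc)
  have *: "fam \<phi> M" if "\<And>z. z \<in> Sc \<phi> \<Longrightarrow> linear (M z)" "\<And>v. continuous_on (Sc \<phi>) (\<lambda>z. M z v)"
    "\<And>z v. z \<in> Sc \<phi> \<Longrightarrow> norm (M z v) \<le> C * (1 / norm z + 1 / norm z ^ 2) * norm v" for M
    unfolding fam_def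
  proof (intro conjI ballI allI exI[of _ C])
    fix \<sigma> x :: real and v assume \<sigma>: "\<sigma> \<in> {1, -1::real}"
    show "linear (M (pt \<phi> \<sigma> x))" using that(1) pt_Sc[OF \<sigma>] by blast
    show "continuous_on UNIV (\<lambda>x. M (pt \<phi> \<sigma> x) v)" by (rule cont[OF that(2) \<sigma>])
    have "1 / exp x + 1 / (exp x)\<^sup>2 = exp (- x) + exp (- 2 * x)"
      by (simp add: exp_minus inverse_eq_divide power2_eq_square flip: exp_add)
    then show "norm (M (pt \<phi> \<sigma> x) v) \<le> C * (exp (- x) + exp (- 2 * x)) * norm v"
      using that(3)[OF pt_Sc[OF \<sigma>, of \<phi> x], of v] by (simp add: norm_pt)
  qed (use C in auto)
  have m: "C * x * norm v \<le> C * (1 / norm z + 1 / norm z ^ 2) * norm v"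
    if "x = 1 / norm z \<or> x = 1 / norm z ^ 2" for z :: complex and v :: 'v and x
    using C(1) that by (intro mult_right_mono mult_left_mono) auto
  have b: "norm (Rz z v) \<le> C * (1 / norm z ^ 2) * norm v" "norm (Kz z v) \<le> C * (1 / norm z) * norm v"
    "norm (Nz z v) \<le> C * (1 / norm z) * norm v" "reg (qc J z)" if "z \<in> Sc \<phi>" for z v
    using C(2)[OF that] by blast+
  show "fam \<phi> Rz"
    by (rule *) (use b(4) linear_Qi continuous_on_Sc(1)[OF \<phi>] order_trans[OF b(1) m] in blast)+
  show "fam \<phi> Kz"
    by (rule *) (use b(4) linear_Kz continuous_on_Sc(2)[OF \<phi>] order_trans[OF b(2) m] in blast)+
  show "fam \<phi> Nz"
    by (rule *) (use b(4) linear_Nz continuous_on_Sc(3)[OF \<phi>] order_trans[OF b(3) m] in blast)+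
qed

text \<open>Both rays are taken at the same parameter, so that conjugate points are paired as in
  \<open>Qpair\<close>.\<close>

definition Opi :: "(complex \<Rightarrow> 'v \<Rightarrow> 'v) \<Rightarrow> real \<Rightarrow> (complex \<Rightarrow> complex) \<Rightarrow> 'v \<Rightarrow> real \<Rightarrow> 'v" where
  "Opi M \<phi> G v x = (\<Sum>\<sigma>\<in>{1,-1}. ray_term M \<phi> G \<sigma> v x)"

text \<open>For \<open>M\<close> the families \<open>Rz\<close>, \<open>Kz\<close>, \<open>Nz\<close> this is \<open>W\<close>, \<open>U\<close>, \<open>X\<close> of the introduction.\<close>
definition Op :: "(complex \<Rightarrow> 'v \<Rightarrow> 'v) \<Rightarrow> real \<Rightarrow> (complex \<Rightarrow> complex) \<Rightarrow> 'v \<Rightarrow> 'v" where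
  "Op M \<phi> G v = (1 / (2 * pi)) *\<^sub>R integral UNIV (Opi M \<phi> G v)"

lemma fam_term:
  assumes M: "fam \<phi> M" and G: "strip_admissible \<theta> G" and \<phi>: "\<bar>\<phi>\<bar> < \<theta>"
  obtains a B where "a > 0" "B \<ge> 0"
    "\<forall>\<sigma>\<in>{1,-1}. \<forall>x v. norm (ray_term M \<phi> G \<sigma> v x) \<le> B * edecay a x * norm v"
    "\<forall>\<sigma>\<in>{1,-1}. \<forall>v. continuous_on UNIV (ray_term M \<phi> G \<sigma> v)"
proof -
  obtain a B where G': "a > 0" "B \<ge> 0"
    "\<And>w. \<bar>Im w\<bar> < \<theta> \<Longrightarrow> norm (G w) \<le> B * exp (min 0 (Re w)) * edecay a (Re w)"
    using strip_admissibleE[OF G] by metis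
  obtain C where C: "C \<ge> 0"
    "\<And>\<sigma> x v. \<sigma> \<in> {1,-1} \<Longrightarrow> norm (M (pt \<phi> \<sigma> x) v) \<le> C * (exp (- x) + exp (- 2 * x)) * norm v"
    using M unfolding fam_def by blast
  show thesis
  proof (rule that[of a "2 * C * B"]; (intro ballI allI)?)
    fix \<sigma> x :: real and v assume \<sigma>: "\<sigma> \<in> {1, -1::real}"
    let ?e = "exp (- x) + exp (- 2 * x)"
    have "norm (kern \<phi> G \<sigma> x) = exp x * norm (G (Complex x (\<sigma> * \<phi>)))"
      using \<sigma> by (auto simp: kern_def norm_mult norm_pt)
    also have "\<dots> \<le> exp x * (B * exp (min 0 x) * edecay a x)"
      using G'(3)[of "Complex x (\<sigma> * \<phi>)"] \<sigma> \<phi> by (intro mult_left_mono) auto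
    finally have "norm (cs (kern \<phi> G \<sigma> x) v) \<le> exp x * (B * exp (min 0 x) * edecay a x) * norm v"
      by (intro order_trans[OF norm_cs] mult_right_mono) auto
    then have "norm (ray_term M \<phi> G \<sigma> v x)
        \<le> C * ?e * (exp x * (B * exp (min 0 x) * edecay a x) * norm v)"
      using C by (intro order_trans[OF C(2)[OF \<sigma>]] mult_left_mono) auto
    also have "\<dots> = (exp x * exp (min 0 x) * ?e) * (C * B * edecay a x * norm v)" by (simp add: mult_ac)
    also have "\<dots> \<le> 2 * (C * B * edecay a x * norm v)"
      using exp_weight[of x] C G' by (intro mult_right_mono) auto
    finally show "norm (ray_term M \<phi> G \<sigma> v x) \<le> 2 * C * B * edecay a x * norm v" by (simp add: mult_ac)
  next
    fix \<sigma> v assume \<sigma>: "\<sigma> \<in> {1, -1::real}"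
    have lin: "linear (M (pt \<phi> \<sigma> x))" for x using M \<sigma> by (auto simp: fam_def)
    \<comment> \<open>Operator and argument both vary with \<open>x\<close>. Real linearity moves
      the varying scalar outside and leaves only the fixed vectors \<open>v\<close> and
      \<open>lm J v\<close>, to which strong continuity applies.\<close>
    have "M (pt \<phi> \<sigma> x) (cs c v) = Re c *\<^sub>R M (pt \<phi> \<sigma> x) v + Im c *\<^sub>R M (pt \<phi> \<sigma> x) (lm J v)" for x c
      by (simp add: cs_expand linear_add[OF lin] linear_scale[OF lin])
    moreover have "continuous_on UNIV (\<lambda>x. M (pt \<phi> \<sigma> x) u)" for u
      using M \<sigma> by (auto simp: fam_def)
    ultimately show "continuous_on UNIV (ray_term M \<phi> G \<sigma> v)"
      using continuous_kern[OF G \<phi> \<sigma>] by (simp add: continuous_intros)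
  qed (use G' C in auto)
qed

lemma exp_decaying_ray_term:
  assumes "fam \<phi> M" "strip_admissible \<theta> G" "\<bar>\<phi>\<bar> < \<theta>" and \<sigma>: "\<sigma> \<in> {1,-1}"
  shows "exp_decaying (ray_term M \<phi> G \<sigma> v)"
proof -
  obtain a B where *: "a > 0" "B \<ge> 0"
    "\<forall>\<sigma>\<in>{1,-1}. \<forall>x v. norm (ray_term M \<phi> G \<sigma> v x) \<le> B * edecay a x * norm v"
    "\<forall>\<sigma>\<in>{1,-1}. \<forall>v. continuous_on UNIV (ray_term M \<phi> G \<sigma> v)"
    by (rule fam_term[OF assms(1-3)])
  then have "\<forall>x. norm (ray_term M \<phi> G \<sigma> v x) \<le> (B * norm v) * edecay a x"
    using \<sigma> by (simp add: mult_ac) blast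
  then show ?thesis using * \<sigma> unfolding exp_decaying_def by blast
qed

lemma Opi_props:
  assumes M: "fam \<phi> M" and G: "strip_admissible \<theta> G" and \<phi>: "\<bar>\<phi>\<bar> < \<theta>"
  obtains a B where "a > 0" "B \<ge> 0"
    "\<forall>x v. norm (Opi M \<phi> G v x) \<le> B * norm v * edecay a x"
    "\<forall>v. continuous_on UNIV (Opi M \<phi> G v)"
proof -
  obtain a B where *: "a > 0" "B \<ge> 0"
    "\<forall>\<sigma>\<in>{1,-1}. \<forall>x v. norm (ray_term M \<phi> G \<sigma> v x) \<le> B * edecay a x * norm v"
    "\<forall>\<sigma>\<in>{1,-1}. \<forall>v. continuous_on UNIV (ray_term M \<phi> G \<sigma> v)"
    by (rule fam_term[OF assms])
  show thesis
  proof (rule that[of a "2 * B"]; (intro allI)?)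
    fix v and x :: real
    have "norm (Opi M \<phi> G v x) \<le> (\<Sum>\<sigma>\<in>{1,-1::real}. B * edecay a x * norm v)"
      unfolding Opi_def using *(3) by (intro sum_norm_le) blast
    then show "norm (Opi M \<phi> G v x) \<le> 2 * B * norm v * edecay a x" by (simp add: mult_ac)
  next
    fix v
    show "continuous_on UNIV (Opi M \<phi> G v)"
      unfolding Opi_def[abs_def] using *(4) by (intro continuous_on_sum) blast
  qed (use * in auto)
qed

lemma Opi_integrable:
  assumes M: "fam \<phi> M" and G: "strip_admissible \<theta> G" and \<phi>: "\<bar>\<phi>\<bar> < \<theta>"
  shows "Opi M \<phi> G v integrable_on UNIV"
  unfolding Opi_def[abs_def]
  by (intro exp_decaying_integrable exp_decaying_sum exp_decaying_ray_term[OF assms])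

lemma Opi_add:
  assumes "fam \<phi> M"
  shows "Opi M \<phi> G (v + w) x = Opi M \<phi> G v x + Opi M \<phi> G w x"
    and "Opi M \<phi> G (r *\<^sub>R v) x = r *\<^sub>R Opi M \<phi> G v x"
proof -
  have "linear (M (pt \<phi> \<sigma> x))" if "\<sigma> \<in> {1,-1}" for \<sigma> using assms that by (auto simp: fam_def)
  from this[of 1] this[of "-1"] show "Opi M \<phi> G (v + w) x = Opi M \<phi> G v x + Opi M \<phi> G w x"
    "Opi M \<phi> G (r *\<^sub>R v) x = r *\<^sub>R Opi M \<phi> G v x"
    by (simp_all add: Opi_def cs.add_right cs.scaleR_right linear_add linear_scale algebra_simps)
qed

lemma bounded_linear_Op:
  assumes M: "fam \<phi> M" and G: "strip_admissible \<theta> G" and \<phi>: "\<bar>\<phi>\<bar> < \<theta>"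
  shows "bounded_linear (Op M \<phi> G)"
proof -
  obtain a B where *: "a > 0" "B \<ge> 0"
    "\<forall>x v. norm (Opi M \<phi> G v x) \<le> B * norm v * edecay a x"
    "\<forall>v. continuous_on UNIV (Opi M \<phi> G v)"
    by (rule Opi_props[OF assms])
  note int = Opi_integrable[OF assms]
  show ?thesis
  proof (rule bounded_linear_intro)
    fix v w r
    show "Op M \<phi> G (v + w) = Op M \<phi> G v + Op M \<phi> G w"
      unfolding Op_def using Opi_add(1)[OF M, abs_def] 
      by (simp add: HK_add[OF int int, symmetric] Opi_add(1)[OF M] flip: scaleR_add_right)
    have "integral UNIV (Opi M \<phi> G (r *\<^sub>R v)) = integral UNIV (\<lambda>x. r *\<^sub>R Opi M \<phi> G v x)"
      by (intro arg_cong[where f="integral UNIV"] ext Opi_add(2)[OF M])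
    then show "Op M \<phi> G (r *\<^sub>R v) = r *\<^sub>R Op M \<phi> G v"
      unfolding Op_def by simp
    have "norm (integral UNIV (Opi M \<phi> G v)) \<le> B * norm v * integral UNIV (\<lambda>x. edecay a x)"
      by (rule exp_decay_norm_integral[OF *(1) int *(3)[rule_format]])
    then show "norm (Op M \<phi> G v) \<le> norm v * (1 / (2 * pi) * B * integral UNIV (\<lambda>x. edecay a x))"
      by (simp add: Op_def field_simps)
  qed
qed

end

text \<open>The factor \<open>\<sigma> * \<i>\<close> is conjugated when the sign changes; together
  with the symmetry of \<open>G\<close> this conjugates the whole weight.\<close>

lemma kern_minus:
  assumes G: "strip_admissible \<theta> G" and \<phi>: "\<bar>\<phi>\<bar> < \<theta>"
  shows "pt \<phi> (-1) x = cnj (pt \<phi> 1 x)" "kern \<phi> G (-1) x = cnj (kern \<phi> G 1 x)"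
proof -
  have c: "Complex x (- \<phi>) = cnj (Complex x \<phi>)" by (simp add: complex_eq_iff)
  show 1: "pt \<phi> (-1) x = cnj (pt \<phi> 1 x)" by (simp add: pt_def c exp_cnj)
  have "G (cnj (Complex x \<phi>)) = cnj (G (Complex x \<phi>))"
    using G \<phi> by (simp add: strip_admissible_def)
  then show "kern \<phi> G (-1) x = cnj (kern \<phi> G 1 x)"
    by (simp add: kern_def 1 c[symmetric])
qed

text \<open>For distinct angles none of the four differences of heights is a multiple of 2 pi, so
  \<open>exp_kernel_bound\<close> applies to every pair of rays; the sum of the four constants
  serves all of them.\<close>

lemma pt_kernel_bound:
  assumes \<alpha>: "0 < \<alpha>" "\<alpha> < pi" and \<beta>: "0 < \<beta>" "\<beta> < pi" and "\<alpha> \<noteq> \<beta>"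
  obtains k where "k > 0" "\<forall>\<sigma>\<in>{1,-1}. \<forall>\<tau>\<in>{1,-1}. \<forall>x y. pt \<beta> \<tau> y \<noteq> pt \<alpha> \<sigma> x \<and>
    norm (pt \<alpha> \<sigma> x / (pt \<beta> \<tau> y - pt \<alpha> \<sigma> x)) \<le> k"
proof -
  have "\<exists>k>0. \<forall>x y. pt \<beta> \<tau> y \<noteq> pt \<alpha> \<sigma> x \<and> norm (pt \<alpha> \<sigma> x / (pt \<beta> \<tau> y - pt \<alpha> \<sigma> x)) \<le> k"
    if "\<sigma> \<in> {1,-1}" "\<tau> \<in> {1,-1}" for \<sigma> \<tau>
  proof -
    have "\<tau> * \<beta> - \<sigma> * \<alpha> \<noteq> 0" "\<bar>\<tau> * \<beta> - \<sigma> * \<alpha>\<bar> < 2 * pi" using that assms by auto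
    then have "cos (\<tau> * \<beta> - \<sigma> * \<alpha>) \<noteq> 1" by (intro cos_neq_1)
    then obtain c where c: "c > 0"
      "\<And>w z. Im w = \<tau> * \<beta> \<Longrightarrow> Im z = \<sigma> * \<alpha> \<Longrightarrow> norm (exp w / (exp w - exp z)) \<le> c \<and> norm (exp z / (exp w - exp z)) \<le> c
      \<and> exp w \<noteq> exp z"
      using exp_kernel_bound[of "\<tau> * \<beta>" "\<sigma> * \<alpha>"] by blast
    then show ?thesis unfolding pt_def by (intro exI[of _ c]) simp
  qed
  then have "\<forall>q\<in>{1,-1} \<times> {1,-1}. \<exists>k>0. \<forall>x y. pt \<beta> (snd q) y \<noteq> pt \<alpha> (fst q) x \<and>
      norm (pt \<alpha> (fst q) x / (pt \<beta> (snd q) y - pt \<alpha> (fst q) x)) \<le> k"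
    by auto
  from bchoice[OF this] obtain f where f: "\<forall>q\<in>{1,-1} \<times> {1,-1}. f q > 0 \<and> (\<forall>x y. pt \<beta> (snd q) y \<noteq> pt \<alpha> (fst q) x \<and>
      norm (pt \<alpha> (fst q) x / (pt \<beta> (snd q) y - pt \<alpha> (fst q) x)) \<le> f q)" by blast
  let ?Q = "{1,-1} \<times> {1,-1::real}"
  show thesis
  proof (rule that[of "sum f ?Q"])
    show "sum f ?Q > 0" using f by (intro sum_pos) auto
    show "\<forall>\<sigma>\<in>{1,-1}. \<forall>\<tau>\<in>{1,-1}. \<forall>x y. pt \<beta> \<tau> y \<noteq> pt \<alpha> \<sigma> x \<and>
        norm (pt \<alpha> \<sigma> x / (pt \<beta> \<tau> y - pt \<alpha> \<sigma> x)) \<le> sum f ?Q"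
    proof (intro ballI allI)
      fix \<sigma> \<tau> x y :: real assume s: "\<sigma> \<in> {1,-1}" "\<tau> \<in> {1,-1}"
      then have q: "(\<sigma>, \<tau>) \<in> ?Q" by blast
      have "f (\<sigma>, \<tau>) \<le> sum f ?Q"
        using f by (intro member_le_sum[OF q]) (auto intro: less_imp_le)
      then show "pt \<beta> \<tau> y \<noteq> pt \<alpha> \<sigma> x \<and> norm (pt \<alpha> \<sigma> x / (pt \<beta> \<tau> y - pt \<alpha> \<sigma> x)) \<le> sum f ?Q"
        using bspec[OF f q] by (auto intro: order_trans)
    qed
  qed
qed

text \<open>The factor \<i> in \<open>kern\<close> turns the -2 pi \<i> of the strip formula into 2
  pi; the value 0 belongs to points outside the sector of angle \<beta>.\<close>

lemma kern_Cauchy: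
  fixes G :: "complex \<Rightarrow> complex"
  assumes G: "strip_admissible \<theta> G" and \<theta>: "\<theta> \<le> pi" and \<beta>: "0 < \<beta>" "\<beta> < \<theta>"
    and w: "\<bar>Im w\<bar> < pi" "\<bar>Im w\<bar> \<noteq> \<beta>"
  shows "((\<lambda>y. \<Sum>\<tau>\<in>{1,-1}. kern \<beta> G \<tau> y / (pt \<beta> \<tau> y - exp w)) has_integral
     (if \<bar>Im w\<bar> < \<beta> then of_real (2 * pi) * G w else 0)) UNIV"
proof -
  obtain a C where G': "a > 0" "C \<ge> 0" "\<And>w. \<bar>Im w\<bar> < \<theta> \<Longrightarrow> norm (G w) \<le> C * edecay a (Re w)"
    using strip_admissibleE[OF G] by metis
  define H where "H u = exp u * G u / (exp u - exp w)" for u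
  have "((\<lambda>x. H (Complex x \<beta>) - H (Complex x (- \<beta>))) has_integral
     (if \<bar>Im w\<bar> < \<beta> then - 2 * pi * \<i> * G w else 0)) UNIV"
    unfolding H_def
  proof (rule strip_Cauchy_formula[OF _ \<theta> \<beta> G'(1) _ w])
    show "G holomorphic_on {w. \<bar>Im w\<bar> < \<theta>}" using G by (simp add: strip_admissible_def)
    show "norm (G w) \<le> C * edecay a (Re w)" if "\<bar>Im w\<bar> \<le> \<beta>" for w
      using G'(3)[of w] that \<beta> by simp
  qed
  from has_integral_mult_right[OF this, of \<i>]
  have "((\<lambda>x. \<i> * (H (Complex x \<beta>) - H (Complex x (- \<beta>)))) has_integral
     (if \<bar>Im w\<bar> < \<beta> then of_real (2 * pi) * G w else 0)) UNIV"
    by (rule has_integral_eq_rhs) (auto simp: mult_ac)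
  moreover have "(\<Sum>\<tau>\<in>{1,-1}. kern \<beta> G \<tau> y / (pt \<beta> \<tau> y - exp w))
      = \<i> * (H (Complex y \<beta>) - H (Complex y (- \<beta>)))" for y
    by (simp add: kern_def pt_def H_def algebra_simps)
  ultimately show ?thesis by simp
qed

context quat_op_slice
begin

lemma fam_linear: "fam \<phi> M \<Longrightarrow> \<sigma> \<in> {1,-1} \<Longrightarrow> linear (M (pt \<phi> \<sigma> x))"
  by (auto simp: fam_def)

lemma bounded_linear_Opi:
  assumes M: "fam \<phi> M" and G: "strip_admissible \<theta> G" and \<phi>: "\<bar>\<phi>\<bar> < \<theta>"
  shows "bounded_linear (\<lambda>v. Opi M \<phi> G v x)"
proof -
  obtain a B where *: "a > 0" "B \<ge> 0" "\<forall>v x. norm (Opi M \<phi> G v x) \<le> B * norm v * edecay a x"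
    using Opi_props[OF assms] by metis
  show ?thesis
  proof (rule bounded_linear_intro)
    show "norm (Opi M \<phi> G v x) \<le> norm v * (B * edecay a x)" for v
      using *(3) by (simp add: mult_ac)
  qed (simp_all add: Opi_add[OF M])
qed

text \<open>At a fixed \<open>x\<close> the outer integrand is a bounded operator and passes under
  the inner integral.\<close>

lemma Opi_Op_has_integral:
  assumes M: "fam \<alpha> M" "strip_admissible \<theta> F" "\<bar>\<alpha>\<bar> < \<theta>"
    and M': "fam \<beta> M'" "strip_admissible \<theta> G" "\<bar>\<beta>\<bar> < \<theta>"
  shows "((\<lambda>y. Opi M \<alpha> F (Opi M' \<beta> G v y) x) has_integral (2 * pi) *\<^sub>R Opi M \<alpha> F (Op M' \<beta> G v) x) UNIV"
proof -
  interpret L: bounded_linear "\<lambda>v. Opi M \<alpha> F v x" by (rule bounded_linear_Opi[OF M])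
  have "(2 * pi) *\<^sub>R Opi M \<alpha> F (Op M' \<beta> G v) x = Opi M \<alpha> F (integral UNIV (Opi M' \<beta> G v)) x"
    by (simp add: Op_def L.scaleR)
  then show ?thesis
    using has_integral_linear[OF integrable_integral[OF Opi_integrable[OF M']] L.bounded_linear_axioms]
    by (simp add: o_def)
qed

section \<open>Independence of W from the angle\<close>

lemma continuous_on_Sc_Rz_Kz:
  assumes \<phi>: "\<omega> < \<phi>" "\<phi> < pi"
  shows "continuous_on (Sc \<phi>) (\<lambda>z. Rz z (Kz z v))"
  unfolding continuous_on_def
proof
  fix p assume p: "p \<in> Sc \<phi>"
  obtain C where C: "C > 0"
    "\<And>z v. z \<in> Sc \<phi> \<Longrightarrow> reg (qc J z) \<and> norm (Rz z v) \<le> C * (1 / norm z ^ 2) * norm v"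
    using Sc_bounds[OF \<phi>] by metis
  have lim: "((\<lambda>z. Rz z u) \<longlongrightarrow> Rz p u) (at p within Sc \<phi>)" "((\<lambda>z. Kz z u) \<longlongrightarrow> Kz p u) (at p within Sc \<phi>)" for u
    using continuous_on_Sc[OF \<phi>, of u] p by (auto simp: continuous_on_def)
  have "((\<lambda>z. Rz z (Kz z v - Kz p v)) \<longlongrightarrow> 0) (at p within Sc \<phi>)"
  proof (rule Lim_null_comparison)
    show "\<forall>\<^sub>F z in at p within Sc \<phi>. norm (Rz z (Kz z v - Kz p v)) \<le> C * (1 / norm z ^ 2) * norm (Kz z v - Kz p v)"
      using C(2) by (auto simp: eventually_at_filter)
    have "p \<noteq> 0" using p by (simp add: Sc_def)
    then have "((\<lambda>z. C * (1 / norm z ^ 2) * norm (Kz z v - Kz p v)) \<longlongrightarrow> C * (1 / norm p ^ 2) * norm (Kz p v - Kz p v)) (at p within Sc \<phi>)"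
      by (intro tendsto_intros lim) auto
    then show "((\<lambda>z. C * (1 / norm z ^ 2) * norm (Kz z v - Kz p v)) \<longlongrightarrow> 0) (at p within Sc \<phi>)" by simp
  qed
  from tendsto_add[OF this lim(1)[of "Kz p v"]]
  have "((\<lambda>z. Rz z (Kz z v - Kz p v) + Rz z (Kz p v)) \<longlongrightarrow> Rz p (Kz p v)) (at p within Sc \<phi>)" by simp
  then show "((\<lambda>z. Rz z (Kz z v)) \<longlongrightarrow> Rz p (Kz p v)) (at p within Sc \<phi>)"
  proof (rule Lim_transform_eventually)
    show "\<forall>\<^sub>F z in at p within Sc \<phi>. Rz z (Kz z v - Kz p v) + Rz z (Kz p v) = Rz z (Kz z v)"
      using C(2) by (auto simp: eventually_at_filter Qi_linear intro!: always_eventually)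
  qed
qed

text \<open>Each ray is moved separately: in the logarithmic coordinate the integrand is complex
  differentiable on the closed strip between the two heights and decays at both ends.\<close>

lemma Op_Rz_angle_le:
  assumes \<phi>: "\<omega> < \<phi>" "\<phi> \<le> \<phi>'" "\<phi>' < \<theta>" and \<theta>: "\<theta> \<le> pi" and G: "strip_admissible \<theta> G"
  shows "Op Rz \<phi> G v = Op Rz \<phi>' G v"
proof -
  \<comment> \<open>An angle strictly below \<phi> puts the closed region between the contours into
    the interior of \<open>Sc \<phi>0\<close>, where the resolvent is differentiable.\<close>
  obtain \<phi>0 where \<phi>0: "\<omega> < \<phi>0" "\<phi>0 < \<phi>" using \<phi>(1) dense by blast
  have \<phi>0pi: "\<phi>0 < pi" using \<phi>0 \<phi> \<theta> by linarith
  obtain a B where G': "a > 0" "B \<ge> 0"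
    "\<And>w. \<bar>Im w\<bar> < \<theta> \<Longrightarrow> norm (G w) \<le> B * exp (min 0 (Re w)) * edecay a (Re w)"
    using strip_admissibleE[OF G] by metis
  obtain C where C: "C > 0"
    "\<And>z v. z \<in> Sc \<phi>0 \<Longrightarrow> reg (qc J z) \<and> norm (Rz z v) \<le> C * (1 / norm z ^ 2) * norm v"
    using Sc_bounds[OF \<phi>0(1) \<phi>0pi] by metis
  let ?S = "{w. \<bar>Im w\<bar> < \<theta>}"
  have Ghol: "G holomorphic_on ?S" using G by (simp add: strip_admissible_def)
  have sub: "{z. Re z < norm z * cos \<phi>0} \<subseteq> interior (Sc \<phi>0)"
    by (rule interior_maximal) (auto simp: Sc_def intro!: open_Collect_less continuous_intros)
  define c where "c \<sigma> w = of_real \<sigma> * \<i> * exp w * G w" for \<sigma> w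
  define H where "H \<sigma> w = cs (c \<sigma> w) (Rz (exp w) v)" for \<sigma> w
  have eq: "integral UNIV (\<lambda>x. H \<sigma> (Complex x y1)) = integral UNIV (\<lambda>x. H \<sigma> (Complex x y2))"
    if \<sigma>: "\<sigma> \<in> {1,-1}" and y: "y1 \<le> y2" "\<And>y. y1 \<le> y \<Longrightarrow> y \<le> y2 \<Longrightarrow> \<phi> \<le> \<bar>y\<bar> \<and> \<bar>y\<bar> \<le> \<phi>'" for \<sigma> y1 y2 :: real
  proof -
    define c' where "c' w = of_real \<sigma> * \<i> * exp w * G w + of_real \<sigma> * \<i> * exp w * deriv G w" for w
    define H' where "H' w = cs (c' w) (Rz (exp w) v) + cs (c \<sigma> w * exp w) (- 2 *\<^sub>R Rz (exp w) (Kz (exp w) v))" for w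
    let ?R = "{w. y1 \<le> Im w \<and> Im w \<le> y2}"
    have RS: "w \<in> ?S" if "w \<in> ?R" for w using y(2)[of "Im w"] that \<phi> by auto
    have int: "exp w \<in> interior (Sc \<phi>0)" if "w \<in> ?R" for w
    proof -
      have "cos \<bar>Im w\<bar> < cos \<phi>0"
        using y(2)[of "Im w"] that \<phi> \<phi>0 \<theta> \<omega> by (intro cos_monotone_0_pi) auto
      then have "Re (exp w) < norm (exp w) * cos \<phi>0" by (simp add: Re_exp)
      then show ?thesis using sub by auto
    qed
    then have Sc: "exp w \<in> Sc \<phi>0" if "w \<in> ?R" for w using that interior_subset by blast
    show "integral UNIV (\<lambda>x. H \<sigma> (Complex x y1)) = integral UNIV (\<lambda>x. H \<sigma> (Complex x y2))"
    proof (rule integral_horizontal_lines_eq[where H'=H' and a=a and M="C * B * norm v"])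
      fix w assume "y1 \<le> Im w" "Im w \<le> y2"
      then have w: "w \<in> ?R" by simp
      have dG: "(G has_field_derivative deriv G w) (at w)"
        using holomorphic_derivI[OF Ghol open_strip RS[OF w]] .
      have "(c \<sigma> has_field_derivative c' w) (at w)"
        unfolding c_def c'_def by (auto intro!: derivative_eq_intros dG)
      then have dc: "(c \<sigma> has_derivative (\<lambda>d. d * c' w)) (at w)"
        by (simp add: has_field_derivative_def mult_commute_abs)
      have de: "(exp has_derivative (\<lambda>d. exp w * d)) (at w)"
        using DERIV_exp[of w] by (simp add: has_field_derivative_def)
      have dR: "((\<lambda>w. Rz (exp w) v) has_derivative (\<lambda>d. cs (exp w * d) (- 2 *\<^sub>R Rz (exp w) (Kz (exp w) v)))) (at w)"
        using diff_chain_at[OF de Rz_has_derivative[OF \<phi>0(1) \<phi>0pi int[OF w], of v]] by (simp add: o_def)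
      have "((\<lambda>w. cs (c \<sigma> w) (Rz (exp w) v)) has_derivative
          (\<lambda>d. cs (c \<sigma> w) (cs (exp w * d) (- 2 *\<^sub>R Rz (exp w) (Kz (exp w) v))) + cs (d * c' w) (Rz (exp w) v))) (at w)"
        by (rule cs.FDERIV[OF dc dR])
      then show "(H \<sigma> has_derivative (\<lambda>d. cs d (H' w))) (at w)"
        unfolding H_def[abs_def] H'_def cs.add_right cs_cs by (simp add: add.commute mult_ac)
      have "norm (H \<sigma> w) \<le> norm (c \<sigma> w) * (C * (1 / norm (exp w) ^ 2) * norm v)"
        unfolding H_def using C(2)[OF Sc[OF w], of v] by (intro order_trans[OF norm_cs] mult_left_mono) auto
      also have "norm (c \<sigma> w) = exp (Re w) * norm (G w)" using \<sigma> by (auto simp: c_def norm_mult)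
      also have "exp (Re w) * norm (G w) * (C * (1 / norm (exp w) ^ 2) * norm v)
          \<le> exp (Re w) * (B * exp (min 0 (Re w)) * edecay a (Re w)) * (C * (1 / norm (exp w) ^ 2) * norm v)"
        using G'(3)[of w] RS[OF w] C(1) by (intro mult_right_mono mult_left_mono) auto
      also have "\<dots> = (exp (Re w) * exp (min 0 (Re w)) * exp (- 2 * Re w)) * (C * B * norm v * edecay a (Re w))"
      proof -
        have "1 / norm (exp w) ^ 2 = exp (- 2 * Re w)"
          by (simp add: exp_minus inverse_eq_divide flip: exp_double)
        then show ?thesis by (simp only: mult_ac)
      qed
      also have "exp (Re w) * exp (min 0 (Re w)) * exp (- 2 * Re w) = exp (min 0 (Re w) - Re w)"
        by (simp flip: exp_add)
      also have "exp (min 0 (Re w) - Re w) * (C * B * norm v * edecay a (Re w)) \<le> 1 * (C * B * norm v * edecay a (Re w))"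
        using C(1) G'(2) by (intro mult_right_mono) auto
      finally show "norm (H \<sigma> w) \<le> C * B * norm v * edecay a (Re w)" by simp
    next
      have cG: "continuous_on ?R G" "continuous_on ?R (deriv G)"
        using RS holomorphic_on_imp_continuous_on[OF Ghol]
          holomorphic_on_imp_continuous_on[OF holomorphic_deriv[OF Ghol open_strip]]
        by (auto intro: continuous_on_subset)
      have cR: "continuous_on ?R (\<lambda>w. Rz (exp w) v)" "continuous_on ?R (\<lambda>w. Rz (exp w) (Kz (exp w) v))"
        using Sc
        by (auto intro!: continuous_on_compose2[OF continuous_on_Sc(1)[OF \<phi>0(1) \<phi>0pi]]
            continuous_on_compose2[OF continuous_on_Sc_Rz_Kz[OF \<phi>0(1) \<phi>0pi]] continuous_intros)
      show "continuous_on ?R H'"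
        unfolding H'_def c_def c'_def by (intro continuous_intros cs.continuous_on cG cR)
    qed (use y G' in auto)
  qed
  have \<phi>pi: "\<phi> < pi" "\<phi>' < pi" "\<bar>\<phi>\<bar> < \<theta>" "\<bar>\<phi>'\<bar> < \<theta>" "\<omega> < \<phi>'" using \<phi> \<theta> \<omega> by linarith+
  have Op: "integral UNIV (Opi Rz \<psi> G v) = (\<Sum>\<sigma>\<in>{1,-1}. integral UNIV (\<lambda>x. H \<sigma> (Complex x (\<sigma> * \<psi>))))"
    if \<psi>: "\<omega> < \<psi>" "\<psi> < pi" "\<bar>\<psi>\<bar> < \<theta>" for \<psi>
  proof -
    have int: "ray_term Rz \<psi> G \<sigma> v integrable_on UNIV" if "\<sigma> \<in> {1,-1}" for \<sigma>
      by (intro exp_decaying_integrable exp_decaying_ray_term[OF fam_RKN(1)[OF \<psi>(1,2)] G \<psi>(3) that])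
    have "integral UNIV (Opi Rz \<psi> G v) = (\<Sum>\<sigma>\<in>{1,-1}. integral UNIV (ray_term Rz \<psi> G \<sigma> v))"
      unfolding Opi_def[abs_def] by (intro HK_sum int) auto
    also have "\<dots> = (\<Sum>\<sigma>\<in>{1,-1}. integral UNIV (\<lambda>x. H \<sigma> (Complex x (\<sigma> * \<psi>))))"
    proof (rule sum.cong[OF refl])
      fix \<sigma> :: real assume \<sigma>: "\<sigma> \<in> {1,-1}"
      have "reg (qc J (pt \<psi> \<sigma> x))" for x using Sc_reg[OF \<psi>(1,2) pt_Sc[OF \<sigma>]] .
      then show "integral UNIV (ray_term Rz \<psi> G \<sigma> v) = integral UNIV (\<lambda>x. H \<sigma> (Complex x (\<sigma> * \<psi>)))"
        by (simp add: Rz_cs) (simp add: kern_def pt_def H_def c_def)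
    qed
    finally show ?thesis .
  qed
  have "integral UNIV (Opi Rz \<phi> G v) = integral UNIV (Opi Rz \<phi>' G v)"
    unfolding Op[OF \<phi>pi(5,2,4)] Op[OF \<phi>(1) \<phi>pi(1,3)]
  proof (rule sum.cong[OF refl])
    fix \<sigma> :: real assume \<sigma>: "\<sigma> \<in> {1,-1}"
    then consider "\<sigma> * \<phi> = \<phi>" "\<sigma> * \<phi>' = \<phi>'" | "\<sigma> * \<phi> = - \<phi>" "\<sigma> * \<phi>' = - \<phi>'" by auto
    then show "integral UNIV (\<lambda>x. H \<sigma> (Complex x (\<sigma> * \<phi>)))
       = integral UNIV (\<lambda>x. H \<sigma> (Complex x (\<sigma> * \<phi>')))"
    proof cases
      case 1
      show ?thesis unfolding 1 by (rule eq[OF \<sigma>]) (use \<phi> \<omega> in auto)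
    next
      case 2
      \<comment> \<open>On the lower ray the heights come in the reversed order
        \<open>- \<phi>' \<le> - \<phi>\<close>.\<close>
      show ?thesis unfolding 2 by (rule eq[OF \<sigma>, symmetric]) (use \<phi> \<omega> in auto)
    qed
  qed
  then show ?thesis unfolding Op_def by (simp only:)
qed

lemma Op_Rz_angle:
  assumes "\<omega> < \<phi>" "\<phi> < \<theta>" "\<omega> < \<phi>'" "\<phi>' < \<theta>" "\<theta> \<le> pi" "strip_admissible \<theta> G"
  shows "Op Rz \<phi> G v = Op Rz \<phi>' G v"
proof (cases "\<phi> \<le> \<phi>'")
  case True
  then show ?thesis by (rule Op_Rz_angle_le[OF assms(1) _ assms(4,5,6)])
next
  case False
  then have "\<phi>' \<le> \<phi>" by simp
  then show ?thesis by (rule Op_Rz_angle_le[OF assms(3) _ assms(2,5,6), symmetric])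
qed

text \<open>For each of the four pairs of rays, the first resolvent identity replaces the products
  of two resolvents by a Cauchy kernel times a difference of single ones.\<close>

lemma Opi_Rz_Kz_sum:
  assumes \<alpha>: "\<omega> < \<alpha>" "\<alpha> < pi" and \<beta>: "\<omega> < \<beta>" "\<beta> < pi"
    and ne: "\<And>\<sigma> \<tau>. \<sigma> \<in> {1,-1} \<Longrightarrow> \<tau> \<in> {1,-1} \<Longrightarrow> pt \<beta> \<tau> y \<noteq> pt \<alpha> \<sigma> x"
  shows "Opi Rz \<alpha> F (Opi Kz \<beta> G v y) x + Opi Kz \<alpha> F (Opi Rz \<beta> G v y) x =
    (\<Sum>\<sigma>\<in>{1,-1}. \<Sum>\<tau>\<in>{1,-1}. cs (kern \<alpha> F \<sigma> x * (kern \<beta> G \<tau> y / (pt \<beta> \<tau> y - pt \<alpha> \<sigma> x))) (Rz (pt \<alpha> \<sigma> x) v))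
    - (\<Sum>\<sigma>\<in>{1,-1}. \<Sum>\<tau>\<in>{1,-1}. cs (kern \<alpha> F \<sigma> x * (kern \<beta> G \<tau> y / (pt \<beta> \<tau> y - pt \<alpha> \<sigma> x))) (Rz (pt \<beta> \<tau> y) v))"
proof -
  have reg: "reg (qc J (pt \<alpha> \<sigma> x))" "reg (qc J (pt \<beta> \<sigma> y))" if "\<sigma> \<in> {1,-1}" for \<sigma>
    using Sc_reg[OF \<alpha> pt_Sc[OF that]] Sc_reg[OF \<beta> pt_Sc[OF that]] .
  have t: "Rz (pt \<alpha> \<sigma> x) (cs (kern \<alpha> F \<sigma> x) (ray_term Kz \<beta> G \<tau> v y))
     + Kz (pt \<alpha> \<sigma> x) (cs (kern \<alpha> F \<sigma> x) (ray_term Rz \<beta> G \<tau> v y))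
     = cs (kern \<alpha> F \<sigma> x * (kern \<beta> G \<tau> y / (pt \<beta> \<tau> y - pt \<alpha> \<sigma> x))) (Rz (pt \<alpha> \<sigma> x) v)
      - cs (kern \<alpha> F \<sigma> x * (kern \<beta> G \<tau> y / (pt \<beta> \<tau> y - pt \<alpha> \<sigma> x))) (Rz (pt \<beta> \<tau> y) v)"
    if s: "\<sigma> \<in> {1,-1}" "\<tau> \<in> {1,-1}" for \<sigma> \<tau>
  proof -
    let ?c = "kern \<alpha> F \<sigma> x" and ?d = "kern \<beta> G \<tau> y" and ?z = "pt \<alpha> \<sigma> x" and ?p = "pt \<beta> \<tau> y"
    have "Rz ?z (cs ?c (Kz ?p (cs ?d v))) + Kz ?z (cs ?c (Rz ?p (cs ?d v)))
        = cs (?c * ?d) (Rz ?z (Kz ?p v) + Kz ?z (Rz ?p v))"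
      by (simp only: Rz_cs[OF reg(1)[OF s(1)]] Rz_cs[OF reg(2)[OF s(2)]] Kz_cs[OF reg(1)[OF s(1)]]
          Kz_cs[OF reg(2)[OF s(2)]] cs_cs cs.add_right)
    also have "?c * ?d = ?c * (?d / (?p - ?z)) * (?p - ?z)"
    proof -
      have "?p - ?z \<noteq> 0" using ne[OF s] by simp
      moreover have "c * d = c * (d / x) * x" if "x \<noteq> 0" for c d x :: complex using that by simp
      ultimately show ?thesis by blast
    qed
    also have "cs (?c * (?d / (?p - ?z)) * (?p - ?z)) (Rz ?z (Kz ?p v) + Kz ?z (Rz ?p v))
       = cs (?c * (?d / (?p - ?z))) (cs (?p - ?z) (Rz ?z (Kz ?p v) + Kz ?z (Rz ?p v)))"
      by (simp only: cs_cs)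
    also have "\<dots> = cs (?c * (?d / (?p - ?z))) (Rz ?z v - Rz ?p v)"
      by (simp only: resolvent(1)[OF reg(1)[OF s(1)] reg(2)[OF s(2)]])
    finally show ?thesis by (simp add: cs.diff_right)
  qed
  have "Opi Rz \<alpha> F (Opi Kz \<beta> G v y) x = (\<Sum>\<sigma>\<in>{1,-1}. \<Sum>\<tau>\<in>{1,-1}. Rz (pt \<alpha> \<sigma> x) (cs (kern \<alpha> F \<sigma> x) (ray_term Kz \<beta> G \<tau> v y)))"
    unfolding Opi_def cs.sum_right by (intro sum.cong refl linear_sum linear_Qi reg)
  moreover have "Opi Kz \<alpha> F (Opi Rz \<beta> G v y) x = (\<Sum>\<sigma>\<in>{1,-1}. \<Sum>\<tau>\<in>{1,-1}. Kz (pt \<alpha> \<sigma> x) (cs (kern \<alpha> F \<sigma> x) (ray_term Rz \<beta> G \<tau> v y)))"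
    unfolding Opi_def cs.sum_right by (intro sum.cong refl linear_sum linear_Kz reg)
  ultimately show ?thesis
    unfolding sum_subtractf[symmetric] by (simp only: sum.distrib[symmetric]) (intro sum.cong refl t)
qed

text \<open>The terms with the resolvent on the \<alpha>-rays are integrated over \<open>y\<close>
  by Cauchy's formula; those with the resolvent on the \<beta>-rays first require an exchange of the
  integrals. Only a point on the inner contour is enclosed by the other one, so a single term
  survives, at the smaller angle.\<close>

theorem Op_product:
  assumes \<theta>: "\<theta> \<le> pi" and \<alpha>: "\<omega> < \<alpha>" "\<alpha> < \<theta>" and \<beta>: "\<omega> < \<beta>" "\<beta> < \<theta>" and ne: "\<alpha> \<noteq> \<beta>"
    and F: "strip_admissible \<theta> F" and G: "strip_admissible \<theta> G"
  shows "Op Rz \<alpha> F (Op Kz \<beta> G v) + Op Kz \<alpha> F (Op Rz \<beta> G v) = Op Rz (min \<alpha> \<beta>) (\<lambda>w. F w * G w) v"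
proof -
  have \<alpha>': "\<alpha> < pi" "\<bar>\<alpha>\<bar> < \<theta>" "0 < \<alpha>" and \<beta>': "\<beta> < pi" "\<bar>\<beta>\<bar> < \<theta>" "0 < \<beta>" using \<alpha> \<beta> \<theta> \<omega> by linarith+
  note f\<alpha> = fam_RKN[OF \<alpha>(1) \<alpha>'(1)] and f\<beta> = fam_RKN[OF \<beta>(1) \<beta>'(1)]
  let ?FG = "\<lambda>w. F w * G w"
  have FG: "strip_admissible \<theta> ?FG" by (rule strip_admissible_mult[OF F G])
  obtain k where k: "k > 0" "\<forall>\<sigma>\<in>{1,-1}. \<forall>\<tau>\<in>{1,-1}. \<forall>x y. pt \<beta> \<tau> y \<noteq> pt \<alpha> \<sigma> x \<and>
      norm (pt \<alpha> \<sigma> x / (pt \<beta> \<tau> y - pt \<alpha> \<sigma> x)) \<le> k"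
    by (rule pt_kernel_bound[OF \<alpha>'(3,1) \<beta>'(3,1) ne])
  define q where "q \<sigma> \<tau> x y = kern \<alpha> F \<sigma> x * (kern \<beta> G \<tau> y / (pt \<beta> \<tau> y - pt \<alpha> \<sigma> x))" for \<sigma> \<tau> x y
  define I1 where "I1 x y = (\<Sum>\<sigma>\<in>{1,-1}. \<Sum>\<tau>\<in>{1,-1}. cs (q \<sigma> \<tau> x y) (Rz (pt \<alpha> \<sigma> x) v))" for x y
  define I2 where "I2 x y = (\<Sum>\<sigma>\<in>{1,-1}. \<Sum>\<tau>\<in>{1,-1}. cs (q \<sigma> \<tau> x y) (Rz (pt \<beta> \<tau> y) v))" for x y
  define Z where "Z x = Opi Rz \<alpha> F (Op Kz \<beta> G v) x + Opi Kz \<alpha> F (Op Rz \<beta> G v) x" for x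
  \<comment> \<open>The values of the two Cauchy integrals for the constant 1, formally: 2 pi if the
    pole lies inside the contour and 0 otherwise.\<close>
  define b1 b2 :: real where "b1 = (if \<alpha> < \<beta> then 2 * pi else 0)" and "b2 = (if \<beta> < \<alpha> then 2 * pi else 0)"
  have A: "((\<lambda>y. I1 x y - I2 x y) has_integral (2 * pi) *\<^sub>R Z x) UNIV" for x
  proof -
    have "((\<lambda>y. Opi Rz \<alpha> F (Opi Kz \<beta> G v y) x + Opi Kz \<alpha> F (Opi Rz \<beta> G v y) x) has_integral
       ((2 * pi) *\<^sub>R Opi Rz \<alpha> F (Op Kz \<beta> G v) x + (2 * pi) *\<^sub>R Opi Kz \<alpha> F (Op Rz \<beta> G v) x)) UNIV"
      by (intro has_integral_add Opi_Op_has_integral[OF f\<alpha>(1) F \<alpha>'(2) f\<beta>(2) G \<beta>'(2)]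
          Opi_Op_has_integral[OF f\<alpha>(2) F \<alpha>'(2) f\<beta>(1) G \<beta>'(2)])
    moreover have "Opi Rz \<alpha> F (Opi Kz \<beta> G v y) x + Opi Kz \<alpha> F (Opi Rz \<beta> G v y) x = I1 x y - I2 x y" for y
      unfolding I1_def I2_def q_def by (rule Opi_Rz_Kz_sum[OF \<alpha>(1) \<alpha>'(1) \<beta>(1) \<beta>'(1)]) (use k in blast)
    ultimately show ?thesis by (simp add: Z_def scaleR_add_right)
  qed
  have reg: "reg (qc J (pt \<alpha> \<sigma> x))" "reg (qc J (pt \<beta> \<sigma> x))" if "\<sigma> \<in> {1,-1}" for \<sigma> x
    using Sc_reg[OF \<alpha>(1) \<alpha>'(1) pt_Sc[OF that]] Sc_reg[OF \<beta>(1) \<beta>'(1) pt_Sc[OF that]] .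
  have S1: "(I1 x has_integral b1 *\<^sub>R Opi Rz \<alpha> ?FG v x) UNIV" for x
  proof -
    have t: "((\<lambda>y. \<Sum>\<tau>\<in>{1,-1}. cs (q \<sigma> \<tau> x y) (Rz (pt \<alpha> \<sigma> x) v)) has_integral
        b1 *\<^sub>R ray_term Rz \<alpha> ?FG \<sigma> v x) UNIV" if \<sigma>: "\<sigma> \<in> {1,-1}" for \<sigma>
    proof -
      let ?w = "Complex x (\<sigma> * \<alpha>)"
      have "\<bar>Im ?w\<bar> = \<alpha>" using \<sigma> \<alpha>'(3) by auto
      then have *: "((\<lambda>y. \<Sum>\<tau>\<in>{1,-1}. kern \<beta> G \<tau> y / (pt \<beta> \<tau> y - pt \<alpha> \<sigma> x)) has_integral (of_real b1 * G ?w)) UNIV"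
        using kern_Cauchy[OF G \<theta> \<beta>'(3) \<beta>(2), of ?w] \<open>\<bar>Im ?w\<bar> = \<alpha>\<close> \<alpha>'(1) ne
        unfolding pt_def[of \<alpha> \<sigma>] by (cases "\<alpha> < \<beta>") (simp_all add: b1_def)
      have bl: "bounded_linear (\<lambda>s. cs (kern \<alpha> F \<sigma> x * s) (Rz (pt \<alpha> \<sigma> x) v))"
        by (intro bounded_linear_compose[OF cs.bounded_linear_left] bounded_linear_mult_right)
      have "cs (kern \<alpha> F \<sigma> x * (of_real b1 * G ?w)) (Rz (pt \<alpha> \<sigma> x) v) = b1 *\<^sub>R ray_term Rz \<alpha> ?FG \<sigma> v x"
        unfolding Rz_cs[OF reg(1)[OF \<sigma>]] cs_of_real[symmetric] cs_cs by (simp add: kern_def mult_ac)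
      then show ?thesis
        using has_integral_linear[OF * bl] by (simp add: o_def q_def sum_distrib_left cs.add_left distrib_left)
    qed
    show ?thesis
      unfolding I1_def[abs_def] Opi_def scaleR_sum_right by (intro has_integral_sum t) auto
  qed
  have S2: "((\<lambda>x. I2 x y) has_integral (- b2) *\<^sub>R Opi Rz \<beta> ?FG v y) UNIV" for y
  proof -
    have t: "((\<lambda>x. \<Sum>\<sigma>\<in>{1,-1}. cs (q \<sigma> \<tau> x y) (Rz (pt \<beta> \<tau> y) v)) has_integral
        (- b2) *\<^sub>R ray_term Rz \<beta> ?FG \<tau> v y) UNIV" if \<tau>: "\<tau> \<in> {1,-1}" for \<tau>
    proof -
      let ?w = "Complex y (\<tau> * \<beta>)"
      have "\<bar>Im ?w\<bar> = \<beta>" using \<tau> \<beta>'(3) by auto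
      then have *: "((\<lambda>x. \<Sum>\<sigma>\<in>{1,-1}. kern \<alpha> F \<sigma> x / (pt \<alpha> \<sigma> x - pt \<beta> \<tau> y)) has_integral (of_real b2 * F ?w)) UNIV"
        using kern_Cauchy[OF F \<theta> \<alpha>'(3) \<alpha>(2), of ?w] \<open>\<bar>Im ?w\<bar> = \<beta>\<close> \<beta>'(1) ne
        unfolding pt_def[of \<beta> \<tau>] by (cases "\<beta> < \<alpha>") (simp_all add: b2_def)
      have bl: "bounded_linear (\<lambda>s. cs (- kern \<beta> G \<tau> y * s) (Rz (pt \<beta> \<tau> y) v))"
        by (intro bounded_linear_compose[OF cs.bounded_linear_left] bounded_linear_mult_right)
      have "cs (- kern \<beta> G \<tau> y * (of_real b2 * F ?w)) (Rz (pt \<beta> \<tau> y) v) = (- b2) *\<^sub>R ray_term Rz \<beta> ?FG \<tau> v y"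
        unfolding Rz_cs[OF reg(2)[OF \<tau>]] cs_of_real[symmetric] cs_cs by (simp add: kern_def mult_ac)
      moreover have "(\<Sum>\<sigma>\<in>{1,-1}. cs (q \<sigma> \<tau> x y) (Rz (pt \<beta> \<tau> y) v)) =
          cs (- kern \<beta> G \<tau> y * (\<Sum>\<sigma>\<in>{1,-1}. kern \<alpha> F \<sigma> x / (pt \<alpha> \<sigma> x - pt \<beta> \<tau> y))) (Rz (pt \<beta> \<tau> y) v)" for x
      proof -
        have "q \<sigma> \<tau> x y = - kern \<beta> G \<tau> y * (kern \<alpha> F \<sigma> x / (pt \<alpha> \<sigma> x - pt \<beta> \<tau> y))" for \<sigma>
          unfolding q_def by (metis (no_types, lifting) minus_diff_eq minus_divide_right minus_mult_commute mult.commute times_divide_eq_right)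
        then show ?thesis by (simp only: cs.sum_left sum_distrib_left)
      qed
      ultimately show ?thesis
        using has_integral_linear[OF * bl] by (simp add: o_def)
    qed
    have "I2 x y = (\<Sum>\<tau>\<in>{1,-1}. \<Sum>\<sigma>\<in>{1,-1}. cs (q \<sigma> \<tau> x y) (Rz (pt \<beta> \<tau> y) v))" for x
      unfolding I2_def by (rule sum.swap)
    then show ?thesis
      unfolding Opi_def scaleR_sum_right by (simp only:) (intro has_integral_sum t, auto)
  qed
  have I2int: "integral UNIV (I2 x) = b1 *\<^sub>R Opi Rz \<alpha> ?FG v x - (2 * pi) *\<^sub>R Z x" for x
  proof -
    have "((\<lambda>y. I1 x y - (I1 x y - I2 x y)) has_integral (b1 *\<^sub>R Opi Rz \<alpha> ?FG v x - (2 * pi) *\<^sub>R Z x)) UNIV"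
      by (intro has_integral_diff S1 A)
    then show ?thesis by (simp add: integral_unique)
  qed
  obtain a C where F': "a > 0" "C \<ge> 0" "\<And>w. \<bar>Im w\<bar> < \<theta> \<Longrightarrow> norm (F w) \<le> C * edecay a (Re w)"
    using strip_admissibleE[OF F] by metis
  obtain b B where R': "b > 0" "B \<ge> 0"
      "\<forall>\<sigma>\<in>{1,-1}. \<forall>x v. norm (ray_term Rz \<beta> G \<sigma> v x) \<le> B * edecay b x * norm v"
      "\<forall>\<sigma>\<in>{1,-1}. \<forall>v. continuous_on UNIV (ray_term Rz \<beta> G \<sigma> v)"
    by (rule fam_term[OF f\<beta>(1) G \<beta>'(2)])
  define m where "m = min a b"
  have m: "m > 0" using F' R' by (simp add: m_def)
  have qb: "norm (cs (q \<sigma> \<tau> x y) (Rz (pt \<beta> \<tau> y) v)) \<le> (k * C * B * norm v) * edecay m x * edecay m y"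
    if s: "\<sigma> \<in> {1,-1}" "\<tau> \<in> {1,-1}" for \<sigma> \<tau> x y
  proof -
    have e: "edecay a x \<le> edecay m x" "edecay b y \<le> edecay m y"
      by (auto simp: m_def intro!: mult_right_mono)
    \<comment> \<open>The growing factor \<open>pt \<alpha> \<sigma> x\<close> of the weight is
      grouped with the kernel, where \<open>k\<close> bounds it; decay in \<open>x\<close> then
      comes from \<open>F\<close> and decay in \<open>y\<close> from the ray term.\<close>
    have eq: "cs (q \<sigma> \<tau> x y) (Rz (pt \<beta> \<tau> y) v)
        = cs (of_real \<sigma> * \<i> * (pt \<alpha> \<sigma> x / (pt \<beta> \<tau> y - pt \<alpha> \<sigma> x)) * F (Complex x (\<sigma> * \<alpha>))) (ray_term Rz \<beta> G \<tau> v y)"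
      unfolding Rz_cs[OF reg(2)[OF s(2)]] cs_cs by (simp add: q_def kern_def[of \<alpha>] mult_ac)
    have "norm (of_real \<sigma> * \<i> * (pt \<alpha> \<sigma> x / (pt \<beta> \<tau> y - pt \<alpha> \<sigma> x)) * F (Complex x (\<sigma> * \<alpha>)))
        \<le> k * (C * edecay m x)"
    proof -
      have "norm (F (Complex x (\<sigma> * \<alpha>))) \<le> C * edecay a x"
        using F'(3)[of "Complex x (\<sigma> * \<alpha>)"] s(1) \<alpha>'(2) by auto
      also have "\<dots> \<le> C * edecay m x" by (rule mult_left_mono[OF e(1) F'(2)])
      finally have nF: "norm (F (Complex x (\<sigma> * \<alpha>))) \<le> C * edecay m x" .
      have nk: "norm (pt \<alpha> \<sigma> x / (pt \<beta> \<tau> y - pt \<alpha> \<sigma> x)) \<le> k" using k(2) s by blast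
      have "norm (of_real \<sigma> * \<i> * (pt \<alpha> \<sigma> x / (pt \<beta> \<tau> y - pt \<alpha> \<sigma> x)) * F (Complex x (\<sigma> * \<alpha>)))
          = norm (pt \<alpha> \<sigma> x / (pt \<beta> \<tau> y - pt \<alpha> \<sigma> x)) * norm (F (Complex x (\<sigma> * \<alpha>)))"
      proof -
        have "\<bar>\<sigma>\<bar> = 1" using s(1) by auto
        then show ?thesis by (simp only: norm_mult norm_of_real norm_ii mult_1_left mult_1_right)
      qed
      also have "\<dots> \<le> k * (C * edecay m x)"
        using nF nk k(1) by (intro mult_mono) auto
      finally show ?thesis .
    qed
    moreover have "norm (ray_term Rz \<beta> G \<tau> v y) \<le> B * edecay m y * norm v"
    proof -
      have "norm (ray_term Rz \<beta> G \<tau> v y) \<le> B * edecay b y * norm v" using R'(3) s(2) by blast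
      also have "\<dots> \<le> B * edecay m y * norm v" using e(2) R'(2) by (intro mult_right_mono mult_left_mono) auto
      finally show ?thesis .
    qed
    ultimately have "norm (cs (q \<sigma> \<tau> x y) (Rz (pt \<beta> \<tau> y) v)) \<le> k * (C * edecay m x) * (B * edecay m y * norm v)"
      unfolding eq using k(1) F'(2) by (intro order_trans[OF norm_cs] mult_mono) auto
    then show ?thesis by (simp add: mult_ac)
  qed
  have qc: "continuous_on UNIV (\<lambda>(x, y). cs (q \<sigma> \<tau> x y) (Rz (pt \<beta> \<tau> y) v))"
    if s: "\<sigma> \<in> {1,-1}" "\<tau> \<in> {1,-1}" for \<sigma> \<tau>
  proof -
    have "continuous_on UNIV (\<lambda>y. Rz (pt \<beta> \<tau> y) v)" using f\<beta>(1) s by (auto simp: fam_def)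
    then have "continuous_on UNIV (\<lambda>p::real\<times>real. Rz (pt \<beta> \<tau> (snd p)) v)"
      by (rule continuous_on_compose2) (auto intro: continuous_intros)
    moreover have "continuous_on UNIV (\<lambda>p::real\<times>real. kern \<alpha> F \<sigma> (fst p))" "continuous_on UNIV (\<lambda>p::real\<times>real. kern \<beta> G \<tau> (snd p))"
      "continuous_on UNIV (\<lambda>p::real\<times>real. pt \<alpha> \<sigma> (fst p))" "continuous_on UNIV (\<lambda>p::real\<times>real. pt \<beta> \<tau> (snd p))"
      by (rule continuous_on_compose2[OF continuous_kern[OF F \<alpha>'(2) s(1)]] continuous_on_compose2[OF continuous_kern[OF G \<beta>'(2) s(2)]]
          continuous_on_compose2[OF continuous_pt]; auto intro: continuous_intros)+
    ultimately show ?thesis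
      unfolding q_def case_prod_beta using k(2) s by (intro cs.continuous_on continuous_intros) auto
  qed
  have I2c: "continuous_on UNIV (\<lambda>(x, y). I2 x y)"
    unfolding I2_def case_prod_beta using qc by (intro continuous_on_sum) (simp add: case_prod_beta)
  have I2b: "norm (I2 x y) \<le> (4 * (k * C * B * norm v)) * edecay m x * edecay m y" for x y
  proof -
    have "norm (I2 x y) \<le> (\<Sum>\<sigma>\<in>{1,-1::real}. \<Sum>\<tau>\<in>{1,-1::real}. (k * C * B * norm v) * edecay m x * edecay m y)"
      unfolding I2_def by (intro sum_norm_le qb)
    then show ?thesis by simp
  qed
  have "integral UNIV (\<lambda>x. integral UNIV (I2 x)) = integral UNIV (\<lambda>y. integral UNIV (\<lambda>x. I2 x y))"
    by (rule swap_integral_exp_decay(2)[OF m I2c I2b])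
  then have sw: "integral UNIV (\<lambda>x. b1 *\<^sub>R Opi Rz \<alpha> ?FG v x - (2 * pi) *\<^sub>R Z x) = integral UNIV (\<lambda>y. (- b2) *\<^sub>R Opi Rz \<beta> ?FG v y)"
    unfolding I2int integral_unique[OF S2] .
  have i: "Opi Rz \<alpha> ?FG v integrable_on UNIV" "Opi Rz \<beta> ?FG v integrable_on UNIV"
    "Opi Rz \<alpha> F (Op Kz \<beta> G v) integrable_on UNIV" "Opi Kz \<alpha> F (Op Rz \<beta> G v) integrable_on UNIV"
    by (rule Opi_integrable[OF f\<alpha>(1) FG \<alpha>'(2)] Opi_integrable[OF f\<beta>(1) FG \<beta>'(2)]
        Opi_integrable[OF f\<alpha>(1) F \<alpha>'(2)] Opi_integrable[OF f\<alpha>(2) F \<alpha>'(2)])+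
  have Zi: "(Z has_integral (integral UNIV (Opi Rz \<alpha> F (Op Kz \<beta> G v)) + integral UNIV (Opi Kz \<alpha> F (Op Rz \<beta> G v)))) UNIV"
    unfolding Z_def[abs_def] using i by (intro has_integral_add integrable_integral)
  have "integral UNIV (\<lambda>x. b1 *\<^sub>R Opi Rz \<alpha> ?FG v x - (2 * pi) *\<^sub>R Z x)
      = b1 *\<^sub>R integral UNIV (Opi Rz \<alpha> ?FG v) - (2 * pi) *\<^sub>R integral UNIV Z"
    using i(1) Zi by (intro integral_unique has_integral_diff has_integral_cmul integrable_integral) auto
  moreover have "integral UNIV (\<lambda>y. (- b2) *\<^sub>R Opi Rz \<beta> ?FG v y) = (- b2) *\<^sub>R integral UNIV (Opi Rz \<beta> ?FG v)"
    by (rule integral_cmul)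
  ultimately have "(2 * pi) *\<^sub>R integral UNIV Z
      = b1 *\<^sub>R integral UNIV (Opi Rz \<alpha> ?FG v) + b2 *\<^sub>R integral UNIV (Opi Rz \<beta> ?FG v)"
    using sw by (simp add: algebra_simps)
  also have "\<dots> = (2 * pi) *\<^sub>R integral UNIV (Opi Rz (min \<alpha> \<beta>) ?FG v)"
    using ne by (auto simp: b1_def b2_def min_def)
  finally have "integral UNIV Z = integral UNIV (Opi Rz (min \<alpha> \<beta>) ?FG v)" by simp
  then show ?thesis
    unfolding Op_def integral_unique[OF Zi] by (simp flip: scaleR_add_right)
qed

text \<open>The product formula at two different angles shows that \<open>W(f) U(g)\<close> does not depend on the angle used
  for \<open>U\<close>, which gives the case of equal angles.\<close>
theorem Op_product_angles:
  assumes \<theta>: "\<theta> \<le> pi" and angles: "\<And>\<phi>. \<phi> \<in> {\<alpha>, \<beta>, \<alpha>', \<beta>', \<gamma>} \<Longrightarrow> \<omega> < \<phi> \<and> \<phi> < \<theta>"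
    and F: "strip_admissible \<theta> F" and G: "strip_admissible \<theta> G"
  shows "Op Rz \<alpha> F (Op Kz \<beta> G v) + Op Kz \<alpha>' F (Op Rz \<beta>' G v) = Op Rz \<gamma> (\<lambda>w. F w * G w) v"
proof -
  let ?W = "\<lambda>\<phi> F. Op Rz \<phi> F" and ?U = "\<lambda>\<phi> F. Op Kz \<phi> F"
  have FG: "strip_admissible \<theta> (\<lambda>w. F w * G w)" by (rule strip_admissible_mult[OF F G])
  note W = Op_Rz_angle[OF _ _ _ _ \<theta>]
  have P: "?W \<alpha> F (?U b G v) + ?U a F (?W \<beta>' G v) = ?W \<gamma> (\<lambda>w. F w * G w) v"
    if "\<omega> < a" "a < \<theta>" "\<omega> < b" "b < \<theta>" "a \<noteq> b" for a b
    using Op_product[OF \<theta> that(1,2,3,4,5) F G, of v] that angles[of \<alpha>] angles[of \<beta>'] angles[of \<gamma>]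
      W[of \<alpha> a F "?U b G v"] W[of \<beta>' b G v] W[of \<gamma> "min a b" "\<lambda>w. F w * G w" v] F G FG
    by (simp add: min_def split: if_splits)
  show ?thesis
  proof (cases "\<alpha>' = \<beta>")
    case False
    then show ?thesis using P[of \<alpha>' \<beta>] angles by simp
  next
    case True
    have \<beta>: "\<omega> < \<beta>" "\<beta> < \<theta>" using angles by auto
    \<comment> \<open>With three distinct angles, the pairs (a, \<beta>) and (a, b) share the term
      with \<open>?U a F\<close> and can be compared; the pair (\<beta>, b) then replaces the equal
      one.\<close>
    obtain b where b: "\<omega> < b" "b < \<beta>" using dense \<beta>(1) by blast
    obtain a where a: "\<omega> < a" "a < b" using dense b(1) by blast
    have "?W \<alpha> F (?U \<beta> G v) + ?U a F (?W \<beta>' G v) = ?W \<alpha> F (?U b G v) + ?U a F (?W \<beta>' G v)"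
      using P[of a \<beta>] P[of a b] a b \<beta> by simp
    then have "?W \<alpha> F (?U \<beta> G v) = ?W \<alpha> F (?U b G v)" by simp
    then show ?thesis using P[of \<beta> b] b \<beta> True by simp
  qed
qed

text \<open>All three integrands are expressed through \<open>Qpair\<close> and so inherit its
  independence of the slice. For \<open>Kz\<close> the factor \<open>z\<close> joins the weight, as
  its conjugate does at the conjugate point.\<close>

lemma Opi_Qpair:
  assumes G: "strip_admissible \<theta> G" and \<phi>: "\<omega> < \<phi>" "\<phi> < \<theta>" "\<theta> \<le> pi"
  defines "z \<equiv> \<lambda>x. pt \<phi> 1 x" and "c \<equiv> \<lambda>x. kern \<phi> G 1 x"
  shows "Opi Rz \<phi> G v x = Qpair J (z x) (c x) v"
    and "Opi Kz \<phi> G v x = Qpair J (z x) (z x * c x) v - Tc 0 (Qpair J (z x) (c x) v)"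
    and "Opi Nz \<phi> G v x = Tv (Qpair J (z x) (c x) v)"
    and "Re (z x) < norm (z x) * cos \<omega>"
proof -
  have \<phi>': "\<phi> < pi" "\<bar>\<phi>\<bar> < \<theta>" using \<phi> \<omega> by linarith+
  have reg: "reg (qc J (pt \<phi> \<sigma> x))" if "\<sigma> \<in> {1,-1}" for \<sigma> using Sc_reg[OF \<phi>(1) \<phi>'(1) pt_Sc[OF that]] .
  note k = kern_minus[OF G \<phi>'(2)]
  show R: "Opi Rz \<phi> G v x = Qpair J (z x) (c x) v"
    by (simp add: Opi_def Qpair_def k z_def c_def cs_def)
  have r: "reg (qc J (z x))" "reg (qc J (cnj (z x)))" using reg[of 1] reg[of "-1"] k by (simp_all add: z_def)
  then show "Re (z x) < norm (z x) * cos \<omega>" by (simp add: reg_qc J)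
  have Q: "Qpair J (z x) d v = Rz (z x) (cs d v) + Rz (cnj (z x)) (cs (cnj d) v)" for d
    by (simp add: Qpair_def cs_def)
  show "Opi Nz \<phi> G v x = Tv (Qpair J (z x) (c x) v)"
    unfolding Q using r by (simp add: Opi_def k Nq_def Tv_add Qi_D z_def c_def)
  show "Opi Kz \<phi> G v x = Qpair J (z x) (z x * c x) v - Tc 0 (Qpair J (z x) (c x) v)"
    unfolding Q using r
    by (simp add: Opi_def k Kz_eq Tc_add Qi_D D_cs Rz_cs cs_cs z_def[symmetric] c_def[symmetric])
qed

text \<open>For \<open>w\<close> in the domain the paired integrand of \<open>W(f)\<close> commutes with \<open>Tv\<close>; no continuity of \<open>Tv\<close> is used,
  since it is moved across the integrand pointwise.\<close>
lemma Op_Rz_Nz: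
  assumes F: "strip_admissible \<theta> F" and G: "strip_admissible \<theta> G" and \<theta>: "\<theta> \<le> pi"
    and angles: "\<And>\<phi>. \<phi> \<in> {\<alpha>, \<beta>, \<alpha>', \<beta>'} \<Longrightarrow> \<omega> < \<phi> \<and> \<phi> < \<theta>"
  shows "Op Rz \<alpha> F (Op Nz \<beta> G v) = Op Nz \<alpha>' F (Op Rz \<beta>' G v)"
proof -
  have *: "\<omega> < \<phi>" "\<phi> < \<theta>" "\<phi> < pi" "\<bar>\<phi>\<bar> < \<theta>" if "\<phi> \<in> {\<alpha>, \<beta>, \<alpha>', \<beta>'}" for \<phi>
    using angles[OF that] \<theta> \<omega> by auto
  have eq: "Op Rz a F (Op Nz b G v) = Op Nz a F (Op Rz b G v)"
    if a: "a \<in> {\<alpha>, \<beta>, \<alpha>', \<beta>'}" and b: "b \<in> {\<alpha>, \<beta>, \<alpha>', \<beta>'}" for a b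
  proof -
    note fa = fam_RKN[OF *(1,3)[OF a]] and fb = fam_RKN[OF *(1,3)[OF b]]
    note qa = Opi_Qpair[OF F *(1,2)[OF a] \<theta>] and qb = Opi_Qpair[OF G *(1,2)[OF b] \<theta>]
    have "Opi Rz a F (Op Nz b G v) x = Opi Nz a F (Op Rz b G v) x" for x
    proof -
      \<comment> \<open>Both sides are \<open>Tv\<close> of the same composition of two pairs, taken
        in the same order.\<close>
      have "Opi Rz a F (Opi Nz b G v y) x = Opi Nz a F (Opi Rz b G v y) x" for y
        by (simp add: qa qb Qpair_Tv J Qpair_D)
      then have "(2 * pi) *\<^sub>R Opi Rz a F (Op Nz b G v) x = (2 * pi) *\<^sub>R Opi Nz a F (Op Rz b G v) x"
        using has_integral_unique[OF Opi_Op_has_integral[OF fa(1) F *(4)[OF a] fb(3) G *(4)[OF b], of v x]]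
          Opi_Op_has_integral[OF fa(3) F *(4)[OF a] fb(1) G *(4)[OF b], of v x]
        by simp
      then show ?thesis by simp
    qed
    then show ?thesis unfolding Op_def by presburger
  qed
  have W: "Op Rz a H u = Op Rz b H u" if "a \<in> {\<alpha>, \<beta>, \<alpha>', \<beta>'}" "b \<in> {\<alpha>, \<beta>, \<alpha>', \<beta>'}" "strip_admissible \<theta> H" for a b H u
    using Op_Rz_angle[OF *(1,2)[OF that(1)] *(1,2)[OF that(2)] \<theta> that(3)] .
  have "Op Rz \<alpha> F (Op Nz \<beta> G v) = Op Rz \<alpha>' F (Op Nz \<beta> G v)" by (rule W[OF _ _ F]) auto
  also have "\<dots> = Op Nz \<alpha>' F (Op Rz \<beta> G v)" by (rule eq) auto
  also have "Op Rz \<beta> G v = Op Rz \<beta>' G v" by (rule W[OF _ _ G]) auto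
  finally show ?thesis .
qed

end

section \<open>Slice functions and the product rule\<close>

lemma has_integral_punctured_line:
  fixes f :: "real \<Rightarrow> 'v::banach"
  assumes pos: "(f has_integral I) {0<..}" and neg: "((\<lambda>t. f (- t)) has_integral I') {0<..}"
  shows "(f has_integral (I' + I)) (UNIV - {0})"
proof -
  have "((\<lambda>t. if t \<in> {0<..} then f (- t) else 0) has_integral I') UNIV"
    using neg by (simp only: has_integral_restrict_UNIV)
  from has_integral_reflect_UNIV[OF this]
  have "((\<lambda>t. if t \<in> {..<0} then f t else 0) has_integral I') UNIV"
    by (simp cong: if_cong)
  then have "(f has_integral I') {..<0}" by (simp only: has_integral_restrict_UNIV)
  moreover have "{..<0} \<inter> {0<..} = ({} :: real set)" by auto
  then have "negligible ({..<0} \<inter> {0<..} :: real set)" by simp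
  ultimately have "(f has_integral (I' + I)) ({..<0} \<union> {0<..})"
    by (rule has_integral_Un[OF _ pos])
  moreover have "{..<0} \<union> {0<..} = UNIV - {0::real}" by auto
  ultimately show ?thesis by simp
qed

lemma norm_qmul: "norm (qmul p q) = norm p * norm q"
  unfolding norm_quat real_sqrt_mult[symmetric]
  by (rule arg_cong[where f=sqrt]) (simp add: power2_eq_square algebra_simps)

section \<open>Intrinsic components of slice functions\<close>

definition qcomp :: "nat \<Rightarrow> quat \<Rightarrow> real" where
  "qcomp i q = (if i = 0 then q$0 else if i = 1 then q$1 else if i = 2 then q$2 else q$3)"

lemma bounded_linear_qcomp: "bounded_linear (qcomp i)"
  unfolding qcomp_def
  by (cases "i = 0"; cases "i = 1"; cases "i = 2") (simp_all add: bounded_linear_vec_nth)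

lemma abs_qcomp_le: "\<bar>qcomp i q\<bar> \<le> norm q"
  unfolding qcomp_def using component_le_norm_cart by auto

lemma qcomp_expand: "q = (\<Sum>i<4. qmul (qreal (qcomp i q)) (qe i))"
  by (simp add: sum_lessThan_4 qe_simps quat_eq_iff qcomp_def)

text \<open>The splitting h = h_0 + h_1 e_1 + h_2 e_2 + h_3 e_3 into intrinsic functions, with
  \<open>G i w\<close> standing for h_i at e^w. The units stand on the right and thus act on the
  vector before the slice scalars do.\<close>

definition slice_components :: "real \<Rightarrow> (quat \<Rightarrow> quat) \<Rightarrow> (nat \<Rightarrow> complex \<Rightarrow> complex) \<Rightarrow> bool" where
  "slice_components \<theta> h G \<longleftrightarrow> (\<forall>i<4. strip_admissible \<theta> (G i)) \<and>
    (\<forall>J\<in>imag_units. \<forall>w. \<bar>Im w\<bar> < \<theta> \<longrightarrow> h (qc J (exp w)) = (\<Sum>i<4. qmul (qc J (G i w)) (qe i)))"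

lemma strip_admissible_0: "strip_admissible \<theta> (\<lambda>w. 0)"
  unfolding strip_admissible_def by (intro conjI exI[of _ 1] exI[of _ 0]) auto

lemma exp_mem_slice_dom:
  assumes "0 < \<theta>" "\<theta> < pi" "\<bar>Im w\<bar> < \<theta>"
  shows "(Re (exp w), Im (exp w)) \<in> slice_dom \<theta>" "J \<in> imag_units \<Longrightarrow> qc J (exp w) \<in> sector \<theta>"
proof -
  have "cos \<theta> < cos \<bar>Im w\<bar>" using assms by (intro cos_monotone_0_pi) auto
  then have "norm (exp w) * cos \<theta> < Re (exp w)" by (simp add: Re_exp)
  then have *: "qc J (exp w) \<in> sector \<theta>" if "J \<in> imag_units" for J
    using qc_in_sector_iff[OF that, of \<theta>] assms by simp
  then show "J \<in> imag_units \<Longrightarrow> qc J (exp w) \<in> sector \<theta>" .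
  show "(Re (exp w), Im (exp w)) \<in> slice_dom \<theta>" using * by (simp add: slice_dom_def qc_def)
qed

text \<open>Of the two summands in the denominator the dominant one is kept: the power for |s| \<ge>
  1, the 1 for |s| < 1. The second case leaves an additional factor |s|, written
  \<open>exp (min 0 x)\<close>.\<close>

lemma decay_exp_bound:
  fixes x a :: real
  assumes a: "a > 0"
  shows "exp x powr (1 + a) / (1 + exp x powr (1 + 2 * a)) \<le> exp (min 0 x) * edecay a x"
proof (cases "x \<ge> 0")
  case True
  have "exp ((1 + a) * x) / (1 + exp ((1 + 2 * a) * x)) \<le> exp ((1 + a) * x) / exp ((1 + 2 * a) * x)"
    by (intro divide_left_mono) (auto simp: add_pos_pos)
  also have "\<dots> = exp (- a * x)" by (simp add: algebra_simps flip: exp_diff)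
  finally show ?thesis using True by (simp add: powr_def min_def)
next
  case False
  have "exp ((1 + a) * x) / (1 + exp ((1 + 2 * a) * x)) \<le> exp ((1 + a) * x) / 1"
    by (intro divide_left_mono) (auto simp: add_pos_pos)
  also have "\<dots> = exp x * exp (a * x)" by (simp add: algebra_simps flip: exp_add)
  finally show ?thesis using False by (simp add: powr_def min_def)
qed

text \<open>The components of \<alpha> and \<beta> satisfy the scalar Cauchy-Riemann equations, and
  their parity in v is the reflection symmetry of \<open>G i\<close>. Their size is read off from
  \<open>h\<close> at two conjugate points, where it takes the values \<alpha> + J \<beta> and
  \<alpha> - J \<beta>; this costs the factor 2.\<close>

lemma slice_components_ex:
  assumes \<theta>: "0 < \<theta>" "\<theta> < pi" and h: "slice_repr \<theta> h \<alpha> \<beta>" and dec: "decay_Q \<theta> h"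
  defines "G \<equiv> \<lambda>i w. Complex (qcomp i (\<alpha> (Re (exp w), Im (exp w)))) (qcomp i (\<beta> (Re (exp w), Im (exp w))))"
  shows "slice_components \<theta> h G"
proof -
  obtain \<alpha>u \<alpha>v \<beta>u \<beta>v where C1: "C1_partials \<alpha> \<alpha>u \<alpha>v (slice_dom \<theta>)" "C1_partials \<beta> \<beta>u \<beta>v (slice_dom \<theta>)"
    and CR: "\<And>p. p \<in> slice_dom \<theta> \<Longrightarrow> \<alpha>u p = \<beta>v p \<and> \<alpha>v p = - \<beta>u p"
    and sym: "\<And>u v. (u, v) \<in> slice_dom \<theta> \<Longrightarrow> \<alpha> (u, - v) = \<alpha> (u, v) \<and> \<beta> (u, - v) = - \<beta> (u, v)"
    and val: "\<And>u v J. (u, v) \<in> slice_dom \<theta> \<Longrightarrow> J \<in> imag_units \<Longrightarrow> h (qreal u + v *\<^sub>R J) = \<alpha> (u, v) + qmul J (\<beta> (u, v))"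
    using h unfolding slice_repr_def by blast
  obtain a C where aC: "a > 0" "C \<ge> 0"
    "\<And>s. s \<in> sector \<theta> \<Longrightarrow> norm (h s) \<le> C * norm s powr (1 + a) / (1 + norm s powr (1 + 2 * a))"
    using dec unfolding decay_Q_def by blast
  define p where "p w = (Re (exp w), Im (exp w))" for w
  have p: "p w \<in> slice_dom \<theta>" if "\<bar>Im w\<bar> < \<theta>" for w using exp_mem_slice_dom[OF \<theta> that] by (simp add: p_def)
  have hv: "h (qc J (exp w)) = \<alpha> (p w) + qmul J (\<beta> (p w))" if "\<bar>Im w\<bar> < \<theta>" "J \<in> imag_units" for J w
    using val[of "Re (exp w)" "Im (exp w)" J] p[OF that(1)] that(2) by (simp add: qc_def p_def)
  have hol: "G i holomorphic_on {w. \<bar>Im w\<bar> < \<theta>}" for i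
  proof (rule holomorphic_onI)
    fix w assume "w \<in> {w. \<bar>Im w\<bar> < \<theta>}"
    then have pw: "p w \<in> slice_dom \<theta>" using p by simp
    let ?c = "Complex (qcomp i (\<alpha>u (p w))) (qcomp i (\<beta>u (p w)))"
    interpret qi: bounded_linear "qcomp i" by (rule bounded_linear_qcomp)
    have dp: "((\<lambda>z. (Re z, Im z)) has_derivative (\<lambda>d. (Re d, Im d))) (at z)" for z
      by (auto intro!: derivative_eq_intros)
    have d1: "((\<lambda>z. \<alpha> (Re z, Im z)) has_derivative (\<lambda>d. Re d *\<^sub>R \<alpha>u (p w) + Im d *\<^sub>R \<alpha>v (p w))) (at (exp w))"
      using diff_chain_at[OF dp, of \<alpha> "\<lambda>(h, k). h *\<^sub>R \<alpha>u (p w) + k *\<^sub>R \<alpha>v (p w)" "exp w"] C1(1) pw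
      by (simp add: C1_partials_def p_def o_def)
    have d2: "((\<lambda>z. \<beta> (Re z, Im z)) has_derivative (\<lambda>d. Re d *\<^sub>R \<beta>u (p w) + Im d *\<^sub>R \<beta>v (p w))) (at (exp w))"
      using diff_chain_at[OF dp, of \<beta> "\<lambda>(h, k). h *\<^sub>R \<beta>u (p w) + k *\<^sub>R \<beta>v (p w)" "exp w"] C1(2) pw
      by (simp add: C1_partials_def p_def o_def)
    have "((\<lambda>z. of_real (qcomp i (\<alpha> (Re z, Im z))) + \<i> * of_real (qcomp i (\<beta> (Re z, Im z)))) has_derivative
        (\<lambda>d. of_real (qcomp i (Re d *\<^sub>R \<alpha>u (p w) + Im d *\<^sub>R \<alpha>v (p w))) + \<i> * of_real (qcomp i (Re d *\<^sub>R \<beta>u (p w) + Im d *\<^sub>R \<beta>v (p w))))) (at (exp w))"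
      by (intro has_derivative_add has_derivative_mult_right has_derivative_of_real qi.has_derivative d1 d2)
    moreover have "(\<lambda>d. of_real (qcomp i (Re d *\<^sub>R \<alpha>u (p w) + Im d *\<^sub>R \<alpha>v (p w))) + \<i> * of_real (qcomp i (Re d *\<^sub>R \<beta>u (p w) + Im d *\<^sub>R \<beta>v (p w))))
        = (*) ?c"
      using CR[OF pw] by (intro ext) (simp add: qi.add qi.diff qi.scaleR qi.neg complex_eq_iff algebra_simps)
    ultimately have "((\<lambda>z. Complex (qcomp i (\<alpha> (Re z, Im z))) (qcomp i (\<beta> (Re z, Im z)))) has_field_derivative ?c) (at (exp w))"
      by (simp add: has_field_derivative_def Complex_eq)
    from DERIV_chain2[OF this DERIV_exp[of w]]
    show "G i field_differentiable at w within {w. \<bar>Im w\<bar> < \<theta>}"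
      unfolding G_def using field_differentiable_at_within field_differentiable_def by blast
  qed
  have cnj: "G i (cnj w) = cnj (G i w)" if "\<bar>Im w\<bar> < \<theta>" for i w
  proof -
    interpret qi: bounded_linear "qcomp i" by (rule bounded_linear_qcomp)
    show ?thesis using sym[of "Re (exp w)" "Im (exp w)"] p[OF that]
      by (simp add: G_def p_def qi.neg complex_eq_iff Re_exp Im_exp)
  qed
  have bound: "norm (G i w) \<le> (2 * C) * exp (min 0 (Re w)) * edecay a (Re w)" if w: "\<bar>Im w\<bar> < \<theta>" for i w
  proof -
    define b where "b = C * exp (min 0 (Re w)) * edecay a (Re w)"
    obtain J where J: "J \<in> imag_units" using ex_imag_unit by blast
    have hb: "norm (h (qc J (exp w))) \<le> b" if "J \<in> imag_units" for J
    proof -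
      have "norm (h (qc J (exp w))) \<le> C * (exp (Re w) powr (1 + a) / (1 + exp (Re w) powr (1 + 2 * a)))"
        using aC(3)[OF exp_mem_slice_dom(2)[OF \<theta> w that]] by (simp add: norm_qc that)
      also have "\<dots> \<le> C * (exp (min 0 (Re w)) * edecay a (Re w))"
        by (intro mult_left_mono decay_exp_bound aC)
      finally show ?thesis by (simp add: b_def mult_ac)
    qed
    let ?A = "\<alpha> (p w)" and ?B = "qmul J (\<beta> (p w))"
    have "norm (?A + ?B) \<le> b" "norm (?A - ?B) \<le> b"
      using hb[OF J] hb[OF imag_units_uminus[OF J]] hv[OF w J] hv[OF w imag_units_uminus[OF J]]
      by (simp_all add: qmul_minus_left)
    moreover note norm_add_diff_bounds[where k = ?A and n = ?B]
    moreover have "norm ?B = norm (\<beta> (p w))" using imag_units_D[OF J] by (simp add: norm_qmul)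
    ultimately have "norm (\<alpha> (p w)) + norm (\<beta> (p w)) \<le> 2 * b" by linarith
    moreover have "norm (G i w) \<le> \<bar>qcomp i (\<alpha> (p w))\<bar> + \<bar>qcomp i (\<beta> (p w))\<bar>"
      unfolding G_def p_def using cmod_le by (metis complex.sel)
    ultimately show ?thesis using abs_qcomp_le[of i "\<alpha> (p w)"] abs_qcomp_le[of i "\<beta> (p w)"]
      by (simp add: b_def)
  qed
  have "strip_admissible \<theta> (G i)" for i
    unfolding strip_admissible_def using hol cnj bound aC by (intro conjI exI[of _ a] exI[of _ "2 * C"]) auto
  moreover have "h (qc J (exp w)) = (\<Sum>i<4. qmul (qc J (G i w)) (qe i))"
    if w: "\<bar>Im w\<bar> < \<theta>" and J: "J \<in> imag_units" for J w
  proof -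
    have "(\<Sum>i<4. qmul (qc J (G i w)) (qe i))
        = (\<Sum>i<4. qmul (qreal (qcomp i (\<alpha> (p w)))) (qe i)) + qmul J (\<Sum>i<4. qmul (qreal (qcomp i (\<beta> (p w)))) (qe i))"
      by (simp add: qmul_sum_right sum.distrib[symmetric] G_def qc_def p_def[symmetric] qmul_add_left qmul_scaleR_left
          qmul_scaleR_right qmul_qreal)
    then show ?thesis using hv[OF w J] qcomp_expand by metis
  qed
  ultimately show ?thesis by (simp add: slice_components_def)
qed

lemma PsiLQ_components:
  assumes "0 < \<theta>" "\<theta> < pi" "g \<in> PsiLQ \<theta>"
  obtains G where "slice_components \<theta> g G"
  using assms slice_components_ex unfolding PsiLQ_def left_slice_hol_def by blast

lemma PsiQ_components:
  assumes \<theta>: "0 < \<theta>" "\<theta> < pi" and f: "f \<in> PsiQ \<theta>"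
  obtains F where "strip_admissible \<theta> F" "\<forall>J\<in>imag_units. \<forall>w. \<bar>Im w\<bar> < \<theta> \<longrightarrow> f (qc J (exp w)) = qc J (F w)"
proof -
  obtain \<alpha> \<beta> where ab: "slice_repr \<theta> f \<alpha> \<beta>" "\<forall>p\<in>slice_dom \<theta>. \<alpha> p \<in> range qreal \<and> \<beta> p \<in> range qreal"
    and dec: "decay_Q \<theta> f"
    using f unfolding PsiQ_def intrinsic_slice_hol_def by blast
  define G where "G i w = Complex (qcomp i (\<alpha> (Re (exp w), Im (exp w)))) (qcomp i (\<beta> (Re (exp w), Im (exp w))))" for i w
  have G: "slice_components \<theta> f G"
    using slice_components_ex[OF \<theta> ab(1) dec] unfolding G_def .
  show thesis
  proof (rule that[of "G 0"])
    show "strip_admissible \<theta> (G 0)" using G by (simp add: slice_components_def)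
    show "\<forall>J\<in>imag_units. \<forall>w. \<bar>Im w\<bar> < \<theta> \<longrightarrow> f (qc J (exp w)) = qc J (G 0 w)"
    proof (intro ballI allI impI)
      fix J w assume J: "J \<in> imag_units" and w: "\<bar>Im w\<bar> < \<theta>"
      have "\<alpha> (Re (exp w), Im (exp w)) \<in> range qreal \<and> \<beta> (Re (exp w), Im (exp w)) \<in> range qreal"
        using ab(2) exp_mem_slice_dom(1)[OF \<theta> w] by blast
      then have "G (Suc 0) w = 0" "G 2 w = 0" "G 3 w = 0" by (auto simp: G_def qcomp_def complex_eq_iff)
      then show "f (qc J (exp w)) = qc J (G 0 w)"
        using G J w by (simp add: slice_components_def sum_lessThan_4 qe_simps qmul_qreal)
    qed
  qed
qed

lemma slice_components_intrinsic:
  assumes "strip_admissible \<theta> F" "\<forall>J\<in>imag_units. \<forall>w. \<bar>Im w\<bar> < \<theta> \<longrightarrow> f (qc J (exp w)) = qc J (F w)"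
  shows "slice_components \<theta> f (\<lambda>i. if i = 0 then F else (\<lambda>w. 0))"
  using assms by (simp add: slice_components_def strip_admissible_0 sum_lessThan_4 qe_simps qmul_qreal)

text \<open>Values of an intrinsic \<open>f\<close> lie in the slice of the argument, so they
  multiply the coefficients as complex numbers and leave the units on the right in place.\<close>

lemma slice_components_mult:
  assumes F: "strip_admissible \<theta> F" "\<forall>J\<in>imag_units. \<forall>w. \<bar>Im w\<bar> < \<theta> \<longrightarrow> f (qc J (exp w)) = qc J (F w)"
    and G: "slice_components \<theta> g G"
  shows "slice_components \<theta> (\<lambda>s. qmul (f s) (g s)) (\<lambda>i w. F w * G i w)"
  using assms strip_admissible_mult[OF F(1)]
  by (auto simp: slice_components_def qmul_sum_right qc_mult qmul_assoc)

section \<open>The functional calculi in logarithmic coordinates and the product rules\<close>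

context quat_op_slice
begin

lemma contour_integral_components:
  fixes Mq :: "quat \<Rightarrow> 'v \<Rightarrow> 'v"
  assumes M: "fam \<phi> (\<lambda>z. Mq (qc J z))" and \<phi>: "0 < \<phi>" "\<phi> < \<theta>" and G: "slice_components \<theta> h G"
  shows "((\<lambda>t. Mq (gam \<phi> J t) (lm (qmul (gam' \<phi> J t) (qmul (qinv J) (h (gam \<phi> J t)))) v)) has_integral
     (2 * pi) *\<^sub>R (\<Sum>i<4. Op (\<lambda>z. Mq (qc J z)) \<phi> (G i) (lm (qe i) v))) (UNIV - {0})"
proof -
  define f where "f t = Mq (gam \<phi> J t) (lm (qmul (gam' \<phi> J t) (qmul (qinv J) (h (gam \<phi> J t)))) v)" for t
  define M' where "M' z = Mq (qc J z)" for z
  have M': "fam \<phi> M'" using M by (simp add: M'_def[abs_def])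
  have \<phi>': "\<bar>\<phi>\<bar> < \<theta>" using \<phi> by simp
  have Gi: "strip_admissible \<theta> (G i)" if "i < 4" for i using G that by (simp add: slice_components_def)
  let ?r = "\<lambda>i \<sigma>. ray_term M' \<phi> (G i) \<sigma> (lm (qe i) v)"
  define \<tau> where "\<tau> \<sigma> x = (\<Sum>i<4. ?r i \<sigma> x)" for \<sigma> x
  have pt: "pt \<phi> \<sigma> x = exp x *\<^sub>R cis (\<sigma> * \<phi>)" for \<sigma> x
    by (simp add: pt_def exp_eq_polar scaleR_conv_of_real exp_of_real)
  \<comment> \<open>The substitution t = -\<sigma> e^x sends negative parameters to the upper ray.
    Combined with \<open>qinv J = - J\<close>, the sign of the derivative gives the factor
    \<open>\<sigma> * \<i>\<close> of \<open>kern\<close>.\<close>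
  have gam: "gam \<phi> J (- \<sigma> * exp x) = qc J (pt \<phi> \<sigma> x)" "exp x *\<^sub>R gam' \<phi> J (- \<sigma> * exp x) = qc J (- of_real \<sigma> * pt \<phi> \<sigma> x)"
    if "\<sigma> \<in> {1,-1}" for \<sigma> x
    using that by (auto simp: gam_def gam'_def qexpJ_eq pt qc_scaleR qc_minus)
  have trm: "exp x *\<^sub>R f (- \<sigma> * exp x) = \<tau> \<sigma> x" if \<sigma>: "\<sigma> \<in> {1,-1}" for \<sigma> x
  proof -
    let ?q = "qmul (gam' \<phi> J (- \<sigma> * exp x)) (qmul (qinv J) (h (gam \<phi> J (- \<sigma> * exp x))))"
    have lin: "linear (M' (pt \<phi> \<sigma> x))" by (rule fam_linear[OF M' \<sigma>])
    have "exp x *\<^sub>R ?q = qmul (qc J (- of_real \<sigma> * pt \<phi> \<sigma> x)) (qmul (qc J (- \<i>)) (h (qc J (pt \<phi> \<sigma> x))))"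
      using \<sigma> unfolding qmul_scaleR_left[symmetric] gam(1)[OF \<sigma>] gam(2)[OF \<sigma>] by (simp add: qinv_imag_unit J qc_minus qc_ii)
    also have "\<dots> = qmul (qc J (of_real \<sigma> * \<i> * pt \<phi> \<sigma> x)) (h (qc J (pt \<phi> \<sigma> x)))"
      unfolding qmul_assoc[symmetric] qc_mult[OF J, symmetric] by (simp add: mult_ac)
    also have "h (qc J (pt \<phi> \<sigma> x)) = (\<Sum>i<4. qmul (qc J (G i (Complex x (\<sigma> * \<phi>)))) (qe i))"
      unfolding pt_def using G J \<sigma> \<phi>' by (auto simp: slice_components_def)
    also have "qmul (qc J (of_real \<sigma> * \<i> * pt \<phi> \<sigma> x)) \<dots> = (\<Sum>i<4. qmul (qc J (kern \<phi> (G i) \<sigma> x)) (qe i))"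
      by (simp add: qmul_sum_right qmul_assoc[symmetric] qc_mult[OF J, symmetric] kern_def)
    finally have "exp x *\<^sub>R lm ?q v = (\<Sum>i<4. cs (kern \<phi> (G i) \<sigma> x) (lm (qe i) v))"
      by (simp add: lm_scaleR_left[symmetric] lm.sum_left cs_def lm_lm)
    moreover have "exp x *\<^sub>R f (- \<sigma> * exp x) = M' (pt \<phi> \<sigma> x) (exp x *\<^sub>R lm ?q v)"
      unfolding f_def gam(1)[OF \<sigma>] linear_scale[OF lin] by (simp add: M'_def)
    ultimately show ?thesis by (simp add: \<tau>_def linear_sum[OF lin])
  qed
  have dec: "exp_decaying (?r i \<sigma>)" if "i < 4" "\<sigma> \<in> {1,-1}" for i \<sigma>
    by (rule exp_decaying_ray_term[OF M' Gi[OF that(1)] \<phi>' that(2)])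
  have int: "?r i \<sigma> integrable_on UNIV" if "i < 4" "\<sigma> \<in> {1,-1}" for i \<sigma>
    by (rule exp_decaying_integrable[OF dec[OF that]])
  have half: "((\<lambda>t. f (- \<sigma> * t)) has_integral (\<Sum>i<4. integral UNIV (?r i \<sigma>))) {0<..}"
    if \<sigma>: "\<sigma> \<in> {1,-1}" for \<sigma>
  proof -
    have "exp_decaying (\<tau> \<sigma>)"
      unfolding \<tau>_def[abs_def] using \<sigma> by (intro exp_decaying_sum dec) auto
    then have "((\<lambda>t. f (- \<sigma> * t)) has_integral integral UNIV (\<lambda>x. exp x *\<^sub>R f (- \<sigma> * exp x))) {0<..}"
      by (intro has_integral_Ioi_exp_substitution) (simp only: trm[OF \<sigma>])
    then have "((\<lambda>t. f (- \<sigma> * t)) has_integral integral UNIV (\<tau> \<sigma>)) {0<..}"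
      by (simp only: trm[OF \<sigma>])
    moreover have "integral UNIV (\<tau> \<sigma>) = (\<Sum>i<4. integral UNIV (?r i \<sigma>))"
      unfolding \<tau>_def[abs_def] using \<sigma> by (intro HK_sum int) auto
    ultimately show ?thesis by simp
  qed
  have "(f has_integral ((\<Sum>i<4. integral UNIV (?r i 1)) + (\<Sum>i<4. integral UNIV (?r i (-1))))) (UNIV - {0})"
    using half[of 1] half[of "-1"] by (intro has_integral_punctured_line) auto
  moreover have "(2 * pi) *\<^sub>R Op M' \<phi> (G i) (lm (qe i) v) = integral UNIV (?r i 1) + integral UNIV (?r i (-1))"
    if "i < 4" for i
  proof -
    have "integral UNIV (Opi M' \<phi> (G i) (lm (qe i) v)) = integral UNIV (\<lambda>x. ?r i 1 x + ?r i (-1) x)"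
      by (simp add: Opi_def[abs_def])
    also have "\<dots> = integral UNIV (?r i 1) + integral UNIV (?r i (-1))"
      using int[OF that] by (intro HK_add) auto
    finally show ?thesis by (simp add: Op_def)
  qed
  then have "(2 * pi) *\<^sub>R (\<Sum>i<4. Op M' \<phi> (G i) (lm (qe i) v)) =
      (\<Sum>i<4. integral UNIV (?r i 1)) + (\<Sum>i<4. integral UNIV (?r i (-1)))"
    unfolding scaleR_sum_right sum.distrib[symmetric] by (intro sum.cong) auto
  ultimately show ?thesis by (simp add: f_def[abs_def] M'_def[abs_def])
qed

text \<open>The normalization 1 / (2 pi) is part of \<open>Op\<close>, so \<open>SFC\<close> has
  coefficient 1, while the -1 / pi of \<open>HFC\<close> becomes -2.\<close>

lemma HFC_SFC_eq_self:
  assumes G: "slice_components \<theta> h G" and \<phi>: "\<omega> < \<phi>" "\<phi> < \<theta>" and \<theta>: "\<theta> < pi"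
  shows "HFC lm D Tc \<phi> J h v = - 2 *\<^sub>R (\<Sum>i<4. Op Rz \<phi> (G i) (lm (qe i) v))"
    and "SFC lm D Tc \<phi> J h v = (\<Sum>i<4. Op Kz \<phi> (G i) (lm (qe i) v)) + (\<Sum>i<4. Op Nz \<phi> (G i) (lm (qe i) v))"
    and "SFC lm D (conjc Tc) \<phi> J h v = (\<Sum>i<4. Op Kz \<phi> (G i) (lm (qe i) v)) - (\<Sum>i<4. Op Nz \<phi> (G i) (lm (qe i) v))"
proof -
  have \<phi>': "\<phi> < pi" "0 < \<phi>" using \<phi> \<theta> \<omega> by linarith+
  note fam = fam_RKN[OF \<phi>(1) \<phi>'(1)]
  note c = contour_integral_components[OF _ \<phi>'(2) \<phi>(2) G, of _ v]
  show "HFC lm D Tc \<phi> J h v = - 2 *\<^sub>R (\<Sum>i<4. Op Rz \<phi> (G i) (lm (qe i) v))"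
    unfolding HFC_def integral_unique[OF c[OF fam(1)]] by simp
  show "SFC lm D Tc \<phi> J h v = (\<Sum>i<4. Op Kz \<phi> (G i) (lm (qe i) v)) + (\<Sum>i<4. Op Nz \<phi> (G i) (lm (qe i) v))"
    unfolding SFC_def SLinv_eq integral_unique[OF has_integral_add[OF c[OF fam(2)] c[OF fam(3)]]]
    by (simp add: scaleR_add_right[symmetric])
  show "SFC lm D (conjc Tc) \<phi> J h v = (\<Sum>i<4. Op Kz \<phi> (G i) (lm (qe i) v)) - (\<Sum>i<4. Op Nz \<phi> (G i) (lm (qe i) v))"
    unfolding SFC_def SLinv_conj_eq integral_unique[OF has_integral_diff[OF c[OF fam(2)] c[OF fam(3)]]]
    by (simp add: scaleR_diff_right[symmetric])
qed

text \<open>The calculus on the slice of \<open>J'\<close> is expressed by integrals on the fixed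
  slice of \<open>J\<close>: by \<open>Opi_Qpair\<close> the integrands depend on the unit through
  \<open>Qpair\<close> only, and \<open>Qpair\<close> does not depend on it.\<close>

lemma HFC_SFC_eq:
  assumes G: "slice_components \<theta> h G" and \<phi>: "\<omega> < \<phi>" "\<phi> < \<theta>" and \<theta>: "\<theta> < pi" and J': "J' \<in> imag_units"
  shows "HFC lm D Tc \<phi> J' h v = - 2 *\<^sub>R (\<Sum>i<4. Op Rz \<phi> (G i) (lm (qe i) v))"
    and "SFC lm D Tc \<phi> J' h v = (\<Sum>i<4. Op Kz \<phi> (G i) (lm (qe i) v)) + (\<Sum>i<4. Op Nz \<phi> (G i) (lm (qe i) v))"
    and "SFC lm D (conjc Tc) \<phi> J' h v = (\<Sum>i<4. Op Kz \<phi> (G i) (lm (qe i) v)) - (\<Sum>i<4. Op Nz \<phi> (G i) (lm (qe i) v))"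
proof -
  interpret B: quat_op_slice lm rm D Tc \<omega> J' by unfold_locales (rule J')
  have "B.Op (\<lambda>z. Qi (qc J' z)) \<phi> (G i) u = Op Rz \<phi> (G i) u
     \<and> B.Op (\<lambda>z. Kq (qc J' z)) \<phi> (G i) u = Op Kz \<phi> (G i) u
     \<and> B.Op (\<lambda>z. Nq (qc J' z)) \<phi> (G i) u = Op Nz \<phi> (G i) u" if "i < 4" for i u
  proof -
    have Gi: "strip_admissible \<theta> (G i)" using G that by (simp add: slice_components_def)
    have \<theta>': "\<theta> \<le> pi" using \<theta> by simp
    note A = Opi_Qpair[OF Gi \<phi> \<theta>'] and A' = B.Opi_Qpair[OF Gi \<phi> \<theta>']
    have Q: "Qpair J' (pt \<phi> 1 x) c u = Qpair J (pt \<phi> 1 x) c u" for x c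
      by (rule Qpair_indep[OF A(4) J J'])
    show ?thesis
      unfolding B.Op_def Op_def
      by (intro conjI arg_cong[where f="\<lambda>f. (1 / (2 * pi)) *\<^sub>R integral UNIV f"] ext) (simp_all add: A A' Q)
  qed
  then show "HFC lm D Tc \<phi> J' h v = - 2 *\<^sub>R (\<Sum>i<4. Op Rz \<phi> (G i) (lm (qe i) v))"
    "SFC lm D Tc \<phi> J' h v = (\<Sum>i<4. Op Kz \<phi> (G i) (lm (qe i) v)) + (\<Sum>i<4. Op Nz \<phi> (G i) (lm (qe i) v))"
    "SFC lm D (conjc Tc) \<phi> J' h v = (\<Sum>i<4. Op Kz \<phi> (G i) (lm (qe i) v)) - (\<Sum>i<4. Op Nz \<phi> (G i) (lm (qe i) v))"
    unfolding B.HFC_SFC_eq_self[OF G \<phi> \<theta>] by simp_all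
qed

end

theorem theorem3p10:
  fixes lm :: "quat \<Rightarrow> 'v::banach \<Rightarrow> 'v" and rm :: "'v \<Rightarrow> quat \<Rightarrow> 'v"
    and D :: "'v set" and Tc :: "nat \<Rightarrow> 'v \<Rightarrow> 'v"
    and \<omega> \<theta> :: real and f g :: "quat \<Rightarrow> quat"
    and \<phi> :: "nat \<Rightarrow> real" and J :: "nat \<Rightarrow> quat"
  assumes V: "two_sided_banach lm rm"
    and T: "KC lm rm D Tc"
    and \<omega>: "0 < \<omega>" "\<omega> < pi"
    and typeT: "of_type lm D Tc \<omega>"
    and typeTbar: "of_type lm D (conjc Tc) \<omega>"
    and \<theta>: "\<omega> < \<theta>" "\<theta> < pi"
    and choices: "\<And>k. \<omega> < \<phi> k \<and> \<phi> k < \<theta> \<and> J k \<in> imag_units"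
    and f: "f \<in> PsiQ \<theta>"
    and g: "g \<in> PsiLQ \<theta>"
  shows "HFC lm D Tc (\<phi> 0) (J 0) (\<lambda>s. qmul (f s) (g s))
           = (\<lambda>v. HFC lm D Tc (\<phi> 1) (J 1) f (SFC lm D Tc (\<phi> 2) (J 2) g v)
                 + SFC lm D (conjc Tc) (\<phi> 3) (J 3) f (HFC lm D Tc (\<phi> 4) (J 4) g v))
    \<and> HFC lm D Tc (\<phi> 0) (J 0) (\<lambda>s. qmul (f s) (g s))
           = (\<lambda>v. HFC lm D Tc (\<phi> 1) (J 1) f (SFC lm D (conjc Tc) (\<phi> 5) (J 5) g v)
                 + SFC lm D Tc (\<phi> 6) (J 6) f (HFC lm D Tc (\<phi> 4) (J 4) g v))"
proof -
  have \<phi>: "\<omega> < \<phi> k" "\<phi> k < \<theta>" "\<phi> k < pi" "\<bar>\<phi> k\<bar> < \<theta>" and Jk: "J k \<in> imag_units" for k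
    using choices[of k] \<theta> \<omega> by auto
  \<comment> \<open>All seven contours are transported to the slice of \<open>J 0\<close>; their
    angles remain independent.\<close>
  interpret quat_op_slice lm rm D Tc \<omega> "J 0"
    by unfold_locales (use V T \<omega> typeT typeTbar Jk in auto)
  have \<theta>0: "0 < \<theta>" "\<theta> \<le> pi" using \<theta> \<omega> by linarith+
  obtain F where F: "strip_admissible \<theta> F" "\<forall>J\<in>imag_units. \<forall>w. \<bar>Im w\<bar> < \<theta> \<longrightarrow> f (qc J (exp w)) = qc J (F w)"
    by (rule PsiQ_components[OF \<theta>0(1) \<theta>(2) f])
  obtain G where G: "slice_components \<theta> g G" by (rule PsiLQ_components[OF \<theta>0(1) \<theta>(2) g])
  have Gi: "strip_admissible \<theta> (G i)" if "i < 4" for i using G that by (simp add: slice_components_def)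
  note FG = slice_components_mult[OF F G] and f_comp = slice_components_intrinsic[OF F]
  note fam = fam_RKN[OF \<phi>(1,3)]
  have lin: "linear (Op M (\<phi> k) F)" if "fam (\<phi> k) M" for M k
    using bounded_linear_Op[OF that F(1) \<phi>(4)] by (rule bounded_linear.linear)
  have zero: "Op M (\<phi> k) (\<lambda>w. 0) u = 0" if "fam (\<phi> k) M" for M k u
  proof -
    have "M (pt (\<phi> k) \<sigma> x) 0 = 0" if "\<sigma> \<in> {1,-1}" for \<sigma> x
      using fam_linear[OF \<open>fam (\<phi> k) M\<close> that] by (rule linear_0)
    then show ?thesis by (simp add: Op_def Opi_def[abs_def] kern_def cs.zero_left)
  qed
  have fH: "HFC lm D Tc (\<phi> k) (J k) f u = - 2 *\<^sub>R Op Rz (\<phi> k) F u"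
    and fS: "SFC lm D Tc (\<phi> k) (J k) f u = Op Kz (\<phi> k) F u + Op Nz (\<phi> k) F u"
    and fSc: "SFC lm D (conjc Tc) (\<phi> k) (J k) f u = Op Kz (\<phi> k) F u - Op Nz (\<phi> k) F u" for k u
    using HFC_SFC_eq[OF f_comp \<phi>(1,2)[of k] \<theta>(2) Jk[of k], of u]
    by (simp_all add: sum_lessThan_4 zero fam lm_one)
  \<comment> \<open>The values s = 1 and s = -1 give the two rules. Summed over the components of
    \<open>g\<close>, the terms carrying \<open>s\<close> cancel by \<open>N\<close>, and
    \<open>P\<close> supplies the rest.\<close>
  have main: "- 2 *\<^sub>R (\<Sum>i<4. Op Rz (\<phi> 0) (\<lambda>w. F w * G i w) (lm (qe i) v))
     = - 2 *\<^sub>R Op Rz (\<phi> 1) F ((\<Sum>i<4. Op Kz (\<phi> k) (G i) (lm (qe i) v)) + s *\<^sub>R (\<Sum>i<4. Op Nz (\<phi> k) (G i) (lm (qe i) v)))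
       + (Op Kz (\<phi> l) F (- 2 *\<^sub>R (\<Sum>i<4. Op Rz (\<phi> 4) (G i) (lm (qe i) v)))
          - s *\<^sub>R Op Nz (\<phi> l) F (- 2 *\<^sub>R (\<Sum>i<4. Op Rz (\<phi> 4) (G i) (lm (qe i) v))))" for v k l and s :: real
  proof -
    have P: "Op Rz (\<phi> 0) (\<lambda>w. F w * G i w) (lm (qe i) v) =
        Op Rz (\<phi> 1) F (Op Kz (\<phi> k) (G i) (lm (qe i) v)) + Op Kz (\<phi> l) F (Op Rz (\<phi> 4) (G i) (lm (qe i) v))" if "i < 4" for i
      by (rule Op_product_angles[OF \<theta>0(2) _ F(1) Gi[OF that], symmetric]) (use \<phi> in auto)
    have N: "Op Rz (\<phi> 1) F (Op Nz (\<phi> k) (G i) (lm (qe i) v)) = Op Nz (\<phi> l) F (Op Rz (\<phi> 4) (G i) (lm (qe i) v))" if "i < 4" for i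
      by (rule Op_Rz_Nz[OF F(1) Gi[OF that] \<theta>0(2)]) (use \<phi> in auto)
    show ?thesis
      using P N
      by (simp add: linear_add[OF lin[OF fam(1)]] linear_scale[OF lin[OF fam(1)]] linear_sum[OF lin[OF fam(1)]]
          linear_scale[OF lin[OF fam(2)]] linear_sum[OF lin[OF fam(2)]]
          linear_scale[OF lin[OF fam(3)]] linear_sum[OF lin[OF fam(3)]] linear_neg[OF lin[OF fam(2)]] linear_neg[OF lin[OF fam(3)]]
          sum.distrib algebra_simps)
  qed
  show ?thesis
    unfolding fun_eq_iff fH fS fSc HFC_SFC_eq[OF FG \<phi>(1,2) \<theta>(2) Jk] HFC_SFC_eq[OF G \<phi>(1,2) \<theta>(2) Jk]
    using main[of _ 2 1 3] main[of _ 5 "-1" 6] by simp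
qed

end
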